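(* Let $G = \mathrm{GL}_n(\mathbb{C})$ and let $B \subset G$ be a Borel subgroup. Let $K = \mathrm{GL}_p(\mathbb{C}) \times \mathrm{GL}_q(\mathbb{C})$, with $p + q = n$ and $q \ge p \ge 1$, embedded block diagonally in $G$. Let $Q^1$ be a parabolic subgroup of $\mathrm{GL}_p(\mathbb{C})$, let $Q^2$ be a parabolic subgroup of $\mathrm{GL}_q(\mathbb{C})$, and put $Q = Q^1 \times Q^2$, a parabolic subgroup of $K$. Then there are only finitely many $K$-orbits on $G/B \times K/Q$ (diagonal action) if and only if one of the following holds: (i) $p$ is arbitrary, $Q^1 = \mathrm{GL}_p$ and $Q^2 = \mathrm{GL}_q$; (ii) $p$ is arbitrary, $Q^1 = \mathrm{GL}_p$ and $Q^2$ is mirabolic in $\mathrm{GL}_q$ (so $K/Q \simeq \mathbb{P}(\mathbb{C}^q)$); (iii) $p = 1$, $Q^1 = \mathrm{GL}_1$ and $Q^2$ is an arbitrary parabolic subgroup of $\mathrm{GL}_q$; (iv) $p = 2$, $Q^1 = \mathrm{GL}_2$ and $Q^2$ is a maximal parabolic subgroup of $\mathrm{GL}_q$ (so $K/Q$ is a Grassmannian of $m$-dimensional subspaces of $\mathbb{C}^q$ for some $m$); (v) $p$ is arbitrary, $Q^1$ is mirabolic in $\mathrm{GL}_p$ and $Q^2 = \mathrm{GL}_q$ (so $K/Q \simeq \mathbb{P}(\mathbb{C}^p)$).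
   Context: $K$ is the fixed point subgroup of the involution of $\mathrm{GL}_n$ given by conjugation by $\mathrm{diag}(1_p, -1_q)$ (symmetric pair of type AIII). A parabolic subgroup of $\mathrm{GL}_r$ is called mirabolic if it is of partition type $(1, r-1)$ or $(r-1, 1)$, i.e. it is the stabilizer of a line or of a hyperplane in $\mathbb{C}^r$; the corresponding partial flag variety is isomorphic as a variety to the projective space $\mathbb{P}(\mathbb{C}^r)$. *)

theory Defs
  imports
    "HOL-Algebra.Group_Action"
    "HOL-Algebra.Solvable_Groups"
    "HOL-Algebra.Left_Coset"
    "HOL-Analysis.Abstract_Topology"
    "Jordan_Normal_Form.VS_Connect"
begin

definition GL :: "nat \<Rightarrow> complex mat monoid" where
  "GL n = units_of (ring_mat TYPE(complex) n ())"

lemma group_GL: "group (GL n)"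
proof -
  interpret ring "ring_mat TYPE(complex) n ()" by (rule ring_mat)
  show ?thesis unfolding GL_def by (rule units_group)
qed

inductive_set poly_fun :: "nat \<Rightarrow> (complex mat \<Rightarrow> complex) set" for n :: nat where
  const: "(\<lambda>_. c) \<in> poly_fun n"
| coord: "i < n \<Longrightarrow> j < n \<Longrightarrow> (\<lambda>A. A $$ (i, j)) \<in> poly_fun n"
| add: "f \<in> poly_fun n \<Longrightarrow> g \<in> poly_fun n \<Longrightarrow> (\<lambda>A. f A + g A) \<in> poly_fun n"
| mult: "f \<in> poly_fun n \<Longrightarrow> g \<in> poly_fun n \<Longrightarrow> (\<lambda>A. f A * g A) \<in> poly_fun n"

text \<open>The Zariski topology on \<open>GL n\<close>, as an open subvariety of the affine space of all
  \<open>n \<times> n\<close> matrices: the closed sets are the zero loci of families of polynomials in the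
  matrix entries (see \<open>closedin_zariski\<close>). Allowing the inverse of the determinant as a
  further coordinate gives the same closed sets.\<close>

definition zariski :: "nat \<Rightarrow> complex mat topology" where
  "zariski n = topology (\<lambda>U. \<exists>F \<subseteq> poly_fun n. U = {A \<in> carrier (GL n). \<exists>f \<in> F. f A \<noteq> 0})"

lemma istopology_zariski:
  "istopology (\<lambda>U. \<exists>F \<subseteq> poly_fun n. U = {A \<in> carrier (GL n). \<exists>f \<in> F. f A \<noteq> 0})"
  unfolding istopology_def
proof (intro conjI allI impI)
  fix S T
  assume "\<exists>F \<subseteq> poly_fun n. S = {A \<in> carrier (GL n). \<exists>f \<in> F. f A \<noteq> 0}"
    and "\<exists>F \<subseteq> poly_fun n. T = {A \<in> carrier (GL n). \<exists>f \<in> F. f A \<noteq> 0}"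
  then obtain F F' where F: "F \<subseteq> poly_fun n" "S = {A \<in> carrier (GL n). \<exists>f \<in> F. f A \<noteq> 0}"
    and F': "F' \<subseteq> poly_fun n" "T = {A \<in> carrier (GL n). \<exists>f \<in> F'. f A \<noteq> 0}"
    by blast
  let ?H = "{(\<lambda>A. f A * g A) | f g. f \<in> F \<and> g \<in> F'}"
  have "?H \<subseteq> poly_fun n"
    using F(1) F'(1) by (auto intro!: poly_fun.mult)
  moreover have "S \<inter> T = {A \<in> carrier (GL n). \<exists>f \<in> ?H. f A \<noteq> 0}"
  proof (intro equalityI subsetI)
    fix A assume "A \<in> S \<inter> T"
    then obtain f g where fg: "A \<in> carrier (GL n)" "f \<in> F" "g \<in> F'" "f A \<noteq> 0" "g A \<noteq> 0"
      unfolding F(2) F'(2) by blast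
    have "(\<lambda>A. f A * g A) \<in> ?H" using fg(2,3) by auto
    then have "\<exists>h \<in> ?H. h A \<noteq> 0"
      using fg(4,5) by (intro bexI[of _ "\<lambda>A. f A * g A"]) simp_all
    then show "A \<in> {A \<in> carrier (GL n). \<exists>f \<in> ?H. f A \<noteq> 0}" using fg(1) by simp
  next
    fix A assume "A \<in> {A \<in> carrier (GL n). \<exists>f \<in> ?H. f A \<noteq> 0}"
    then obtain f g where "A \<in> carrier (GL n)" "f \<in> F" "g \<in> F'" "f A * g A \<noteq> 0" by auto
    then show "A \<in> S \<inter> T" unfolding F(2) F'(2) by auto
  qed
  ultimately show "\<exists>H \<subseteq> poly_fun n. S \<inter> T = {A \<in> carrier (GL n). \<exists>f \<in> H. f A \<noteq> 0}"
    by (intro exI[of _ ?H] conjI)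
next
  fix \<K>
  assume *: "\<forall>K\<in>\<K>. \<exists>F \<subseteq> poly_fun n. K = {A \<in> carrier (GL n). \<exists>f \<in> F. f A \<noteq> 0}"
  let ?H = "{f \<in> poly_fun n. \<exists>K\<in>\<K>. {A \<in> carrier (GL n). f A \<noteq> 0} \<subseteq> K}"
  have "\<Union>\<K> = {A \<in> carrier (GL n). \<exists>f \<in> ?H. f A \<noteq> 0}"
  proof
    show "\<Union>\<K> \<subseteq> {A \<in> carrier (GL n). \<exists>f \<in> ?H. f A \<noteq> 0}"
    proof
      fix A assume "A \<in> \<Union>\<K>"
      then obtain K where K: "K \<in> \<K>" "A \<in> K" by blast
      with * obtain F where F: "F \<subseteq> poly_fun n" "K = {A \<in> carrier (GL n). \<exists>f \<in> F. f A \<noteq> 0}"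
        by blast
      with K obtain f where f: "A \<in> carrier (GL n)" "f \<in> F" "f A \<noteq> 0" by blast
      have "{A \<in> carrier (GL n). f A \<noteq> 0} \<subseteq> K" using F(2) f(2) by auto
      then have "f \<in> ?H" using F(1) f(2) K(1) by auto
      then have "\<exists>f \<in> ?H. f A \<noteq> 0" using f(3) by (intro bexI[of _ f])
      then show "A \<in> {A \<in> carrier (GL n). \<exists>f \<in> ?H. f A \<noteq> 0}" using f(1) by simp
    qed
  qed auto
  then show "\<exists>F \<subseteq> poly_fun n. \<Union>\<K> = {A \<in> carrier (GL n). \<exists>f \<in> F. f A \<noteq> 0}"
    by (intro exI[of _ ?H]) auto
qed

lemma topspace_zariski: "topspace (zariski n) = carrier (GL n)"
proof -
  have "openin (zariski n) (carrier (GL n))"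
    unfolding zariski_def topology_inverse'[OF istopology_zariski]
    by (intro exI[of _ "{\<lambda>_. 1}"]) (auto intro: poly_fun.const)
  moreover have "U \<subseteq> carrier (GL n)" if "openin (zariski n) U" for U
    using that unfolding zariski_def topology_inverse'[OF istopology_zariski] by blast
  ultimately show ?thesis
    using openin_subset[of "zariski n"] openin_topspace[of "zariski n"] by (intro subset_antisym)
qed

lemma closedin_zariski:
  "closedin (zariski n) S \<longleftrightarrow>
    (\<exists>F \<subseteq> poly_fun n. S = {A \<in> carrier (GL n). \<forall>f \<in> F. f A = 0})"
proof -
  have *: "(S \<subseteq> carrier (GL n) \<and> carrier (GL n) - S = {A \<in> carrier (GL n). \<exists>f \<in> F. f A \<noteq> 0})
    \<longleftrightarrow> S = {A \<in> carrier (GL n). \<forall>f \<in> F. f A = 0}" for F :: "(complex mat \<Rightarrow> complex) set"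
    by blast
  have "closedin (zariski n) S \<longleftrightarrow> (\<exists>F \<subseteq> poly_fun n. S \<subseteq> carrier (GL n) \<and>
      carrier (GL n) - S = {A \<in> carrier (GL n). \<exists>f \<in> F. f A \<noteq> 0})"
    unfolding closedin_def topspace_zariski
    unfolding zariski_def topology_inverse'[OF istopology_zariski]
    by (simp only: ex_simps[symmetric] conj_left_commute)
  then show ?thesis
    unfolding * .
qed

text \<open>Borel subgroups are the maximal closed connected solvable subgroups; parabolic subgroups are
  the closed subgroups containing a Borel subgroup.\<close>

definition closed_connected_solvable :: "nat \<Rightarrow> complex mat set \<Rightarrow> bool" where
  "closed_connected_solvable n H \<longleftrightarrow>
    subgroup H (GL n) \<and> closedin (zariski n) H \<and> connectedin (zariski n) H \<and>
    solvable (GL n\<lparr>carrier := H\<rparr>)"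

definition borel_subgroup :: "nat \<Rightarrow> complex mat set \<Rightarrow> bool" where
  "borel_subgroup n B \<longleftrightarrow>
    closed_connected_solvable n B \<and>
    (\<forall>H. closed_connected_solvable n H \<and> B \<subseteq> H \<longrightarrow> H = B)"

definition parabolic_subgroup :: "nat \<Rightarrow> complex mat set \<Rightarrow> bool" where
  "parabolic_subgroup n P \<longleftrightarrow>
    subgroup P (GL n) \<and> closedin (zariski n) P \<and> (\<exists>B. borel_subgroup n B \<and> B \<subseteq> P)"

definition maximal_parabolic :: "nat \<Rightarrow> complex mat set \<Rightarrow> bool" where
  "maximal_parabolic n P \<longleftrightarrow>
    parabolic_subgroup n P \<and> P \<noteq> carrier (GL n) \<and>
    (\<forall>P'. parabolic_subgroup n P' \<and> P \<subseteq> P' \<longrightarrow> P' = P \<or> P' = carrier (GL n))"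

definition subspace_stabilizer :: "nat \<Rightarrow> complex vec set \<Rightarrow> complex mat set" where
  "subspace_stabilizer n W = {A \<in> carrier (GL n). (\<lambda>v. A *\<^sub>v v) ` W = W}"

text \<open>Stabilizer of a line or of a hyperplane. For \<open>n = 1\<close> both are the whole of \<open>GL 1\<close>, so
  \<open>GL 1\<close> counts as mirabolic.\<close>

definition mirabolic :: "nat \<Rightarrow> complex mat set \<Rightarrow> bool" where
  "mirabolic n P \<longleftrightarrow>
    parabolic_subgroup n P \<and>
    (\<exists>W. subspace class_ring W (module_vec TYPE(complex) n) \<and>
      vectorspace.dim class_ring (module_vec TYPE(complex) n\<lparr>carrier := W\<rparr>) \<in> {1, n - 1} \<and>
      P = subspace_stabilizer n W)"

definition block_diag :: "nat \<Rightarrow> nat \<Rightarrow> complex mat set \<Rightarrow> complex mat set \<Rightarrow> complex mat set" where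
  "block_diag p q S T = {four_block_mat A (0\<^sub>m p q) (0\<^sub>m q p) D | A D. A \<in> S \<and> D \<in> T}"

definition K_group :: "nat \<Rightarrow> nat \<Rightarrow> complex mat monoid" where
  "K_group p q = GL (p + q)\<lparr>carrier := block_diag p q (carrier (GL p)) (carrier (GL q))\<rparr>"

definition double_flag :: "nat \<Rightarrow> nat \<Rightarrow> complex mat set \<Rightarrow> complex mat set \<Rightarrow> complex mat set
    \<Rightarrow> (complex mat set \<times> complex mat set) set" where
  "double_flag p q B Q1 Q2 =
    (lcosets\<^bsub>GL (p + q)\<^esub> B) \<times> (lcosets\<^bsub>K_group p q\<^esub> (block_diag p q Q1 Q2))"

text \<open>The diagonal action by left translation. Each translation is restricted to the set acted
  upon, as the library's notion of a group action requires.\<close>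

definition diag_action :: "nat \<Rightarrow> nat \<Rightarrow> complex mat set \<Rightarrow> complex mat set \<Rightarrow> complex mat set
    \<Rightarrow> complex mat \<Rightarrow> complex mat set \<times> complex mat set \<Rightarrow> complex mat set \<times> complex mat set" where
  "diag_action p q B Q1 Q2 k =
    (\<lambda>(C, D) \<in> double_flag p q B Q1 Q2. (k <#\<^bsub>GL (p + q)\<^esub> C, k <#\<^bsub>K_group p q\<^esub> D))"

end

theory Submission
  imports Defs "Jordan_Normal_Form.Spectral_Radius"
begin

text \<open>The orbits of \<open>K\<close> on \<open>G/B \<times> K/Q\<close> correspond to the double cosets in \<open>Q\<setminus>G/B\<close>
  (\<open>finite_orbits_iff\<close>), and conjugating \<open>B\<close> in \<open>G\<close> or the factors of \<open>Q\<close> in \<open>K\<close> does not change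
  their number. By the Lie--Kolchin theorem every Borel subgroup is conjugate to the group of upper
  triangular matrices (\<open>borel_conj_UT\<close>), and a subgroup containing the latter is the stabilizer of
  some of the steps of the standard flag (\<open>contains_UT_std_parabolic\<close>). So \<open>Q\<^sup>1\<close> and \<open>Q\<^sup>2\<close> may be taken
  to be the block upper triangular groups given by sets \<open>I \<subseteq> {1..<p}\<close> and \<open>J \<subseteq> {1..<q}\<close> of dimensions
  of flag steps, and the question is for which \<open>I\<close> and \<open>J\<close> there are finitely many double cosets
  modulo the upper triangular matrices.

  \<^emph>\<open>Finiteness.\<close> The Bruhat decomposition relative to the stabilizer of the second summand writes an
  element of \<open>G\<close> as a block diagonal matrix of upper triangular blocks, times a unipotent matrix with
  a single nontrivial \<open>q \<times> p\<close> block \<open>Y\<close>, times a permutation matrix \<open>w\<close>, times an upper triangular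
  matrix. The orders of the rows of the two summands that \<open>w\<close> induces define triangular subgroups of
  \<open>GL\<^sub>p\<close> and \<open>GL\<^sub>q\<close> whose elements can be moved past \<open>w\<close>; they act on \<open>Y\<close> by column and row
  operations. If those of them that lie in \<open>Q\<close> suffice to make all entries of \<open>Y\<close> equal to \<open>0\<close> or
  \<open>1\<close>, there are finitely many double cosets (\<open>finite_double_cosets_zero_one\<close>). For \<open>p = 1\<close> the
  diagonal matrices suffice (\<open>finite_cosets_line\<close>); for \<open>p = 2\<close> and a maximal parabolic subgroup of
  \<open>GL\<^sub>q\<close> the matrix \<open>Y\<close> has two columns, each cut into two blocks, and can be handled by elimination
  (\<open>finite_cosets_plane\<close>). If \<open>Q = K\<close>, then \<open>Y\<close> can be made a partial permutation matrix, and the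
  stabilizer of the resulting representative contains a torus that maps onto the diagonal torus of
  either factor of \<open>K\<close>. Since the diagonal torus has finitely many orbits on the projective spaces of
  lines and of hyperplanes, one mirabolic factor keeps the number of double cosets finite
  (\<open>finite_cosets_mirabolic_left\<close>, \<open>finite_cosets_mirabolic_right\<close>).

  \<^emph>\<open>Infiniteness.\<close> In the other cases a coordinate subspace of dimension \<open>4\<close>, \<open>5\<close> or \<open>7\<close>, adapted to
  the flags stabilized by \<open>Q\<close>, carries a family of flags with one complex parameter in its last
  proper step. The earlier steps do not depend on the parameter, and an element of \<open>Q\<close> that respects
  them acts on the relevant part of the subspace as a scalar, so it cannot change the parameter
  (\<open>infinite_double_cosets\<close>). The cases are \<open>I\<close> and \<open>J\<close> both nonempty (\<open>infinite_two_proper\<close>); two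
  steps in one summand, the other summand having dimension at least \<open>2\<close>
  (\<open>infinite_two_step_right\<close>, \<open>infinite_two_step_left\<close>); one step of dimension and codimension at
  least \<open>2\<close>, the other summand having dimension at least \<open>3\<close> (\<open>infinite_middle_right\<close>,
  \<open>infinite_middle_left\<close>). The five cases of the classification are exactly what these three leave
  over.\<close>

section \<open>Matrix groups and double cosets\<close>

lemma GL_carrier_iff: "A \<in> carrier (GL n) \<longleftrightarrow> A \<in> carrier_mat n n \<and> det A \<noteq> 0"
proof -
  have c: "carrier (ring_mat TYPE(complex) n ()) = carrier_mat n n"
    by (simp add: ring_mat_def)
  show ?thesis
    unfolding GL_def units_of_carrier
    using unit_imp_det_non_zero[of A n "()"] det_non_zero_imp_unit[of A n "()"] c
    by (auto simp: Units_def)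
qed

lemma GL_mat [dest]: "A \<in> carrier (GL n) \<Longrightarrow> A \<in> carrier_mat n n"
  by (simp add: GL_carrier_iff)

lemma GL_mult [simp]: "x \<otimes>\<^bsub>GL n\<^esub> y = x * y"
  by (simp add: GL_def units_of_def ring_mat_def)

lemma GL_one [simp]: "\<one>\<^bsub>GL n\<^esub> = 1\<^sub>m n"
  by (simp add: GL_def units_of_def ring_mat_def)

abbreviation ginv :: "nat \<Rightarrow> complex mat \<Rightarrow> complex mat" where
  "ginv n A \<equiv> inv\<^bsub>GL n\<^esub> A"

lemma GL_mult_closed [simp, intro]:
  "A \<in> carrier (GL n) \<Longrightarrow> B \<in> carrier (GL n) \<Longrightarrow> A * B \<in> carrier (GL n)"
  using group.is_monoid[OF group_GL, THEN monoid.m_closed, of A n B] by simp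

lemma GL_one_closed [simp, intro]: "1\<^sub>m n \<in> carrier (GL n)"
  by (simp add: GL_carrier_iff)

lemma GL_inv_closed [simp, intro]: "A \<in> carrier (GL n) \<Longrightarrow> ginv n A \<in> carrier (GL n)"
  using group.inv_closed[OF group_GL] .

lemma GL_l_inv [simp]: "A \<in> carrier (GL n) \<Longrightarrow> ginv n A * A = 1\<^sub>m n"
  using group.l_inv[OF group_GL, of A n] by simp

lemma GL_r_inv [simp]: "A \<in> carrier (GL n) \<Longrightarrow> A * ginv n A = 1\<^sub>m n"
  using group.r_inv[OF group_GL, of A n] by simp

lemma GL_l_one [simp]: "A \<in> carrier (GL n) \<Longrightarrow> 1\<^sub>m n * A = A"
  using left_mult_one_mat[of A n n] by (simp add: GL_mat)

lemma GL_r_one [simp]: "A \<in> carrier (GL n) \<Longrightarrow> A * 1\<^sub>m n = A"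
  using right_mult_one_mat[of A n n] by (simp add: GL_mat)

lemma GL_assoc:
  "A \<in> carrier (GL n) \<Longrightarrow> B \<in> carrier (GL n) \<Longrightarrow> C \<in> carrier (GL n) \<Longrightarrow> (A * B) * C = A * (B * C)"
  by (rule assoc_mult_mat[of A n n B n C n]) (auto simp: GL_mat)

lemma GL_cancel1 [simp]:
  assumes "A \<in> carrier (GL n)" "B \<in> carrier (GL n)"
  shows "ginv n A * (A * B) = B" "A * (ginv n A * B) = B"
  using assms by (simp_all add: GL_assoc[where n=n, symmetric])

lemma GL_inv_one [simp]: "ginv n (1\<^sub>m n) = 1\<^sub>m n"
  using monoid.inv_one[OF group.is_monoid[OF group_GL], of n] by simp

lemma GL_inv_inv [simp]: "A \<in> carrier (GL n) \<Longrightarrow> ginv n (ginv n A) = A"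
  using group.inv_inv[OF group_GL] .

lemma GL_inv_mult [simp]:
  "A \<in> carrier (GL n) \<Longrightarrow> B \<in> carrier (GL n) \<Longrightarrow> ginv n (A * B) = ginv n B * ginv n A"
  using group.inv_mult_group[OF group_GL, of A n B] by simp

lemma GL_inv_unique: "A \<in> carrier (GL n) \<Longrightarrow> C \<in> carrier_mat n n \<Longrightarrow> C * A = 1\<^sub>m n \<Longrightarrow> ginv n A = C"
proof -
  assume a: "A \<in> carrier (GL n)" "C \<in> carrier_mat n n" "C * A = 1\<^sub>m n"
  have "det C * det A = 1"
    using det_mult[of C n A] a by (auto simp: GL_mat)
  then have "C \<in> carrier (GL n)" using a by (auto simp: GL_carrier_iff)
  then show ?thesis using group.inv_equality[OF group_GL, of n C A] a by simp
qed

lemma GL_memI: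
  assumes "A \<in> carrier_mat n n" "C \<in> carrier_mat n n" "A * C = 1\<^sub>m n"
  shows "A \<in> carrier (GL n)"
proof -
  have "det A * det C = 1" using det_mult[of A n C] assms by auto
  then show ?thesis using assms by (auto simp: GL_carrier_iff)
qed

lemma subgroup_GL_D:
  assumes "subgroup H (GL n)"
  shows "H \<subseteq> carrier (GL n)" "1\<^sub>m n \<in> H"
    "\<And>x y. x \<in> H \<Longrightarrow> y \<in> H \<Longrightarrow> x * y \<in> H" "\<And>x. x \<in> H \<Longrightarrow> ginv n x \<in> H"
  using subgroup.subset[OF assms] subgroup.one_closed[OF assms] subgroup.m_closed[OF assms]
    subgroup.m_inv_closed[OF assms] by auto

lemma subgroup_GL_I:
  assumes "H \<subseteq> carrier (GL n)" "1\<^sub>m n \<in> H"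
    "\<And>x y. x \<in> H \<Longrightarrow> y \<in> H \<Longrightarrow> x * y \<in> H" "\<And>x. x \<in> H \<Longrightarrow> ginv n x \<in> H"
  shows "subgroup H (GL n)"
  using assms by (intro subgroup.intro) auto

definition conj_set :: "nat \<Rightarrow> complex mat \<Rightarrow> complex mat set \<Rightarrow> complex mat set" where
  "conj_set n x H = (\<lambda>h. x * h * ginv n x) ` H"

lemma conj_set_carrier:
  "x \<in> carrier (GL n) \<Longrightarrow> H \<subseteq> carrier (GL n) \<Longrightarrow> conj_set n x H \<subseteq> carrier (GL n)"
  by (auto simp: conj_set_def)

lemma conj_set_conj_set:
  assumes "x \<in> carrier (GL n)" "y \<in> carrier (GL n)" "H \<subseteq> carrier (GL n)"
  shows "conj_set n x (conj_set n y H) = conj_set n (x * y) H"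
  unfolding conj_set_def image_image
  using assms by (intro image_cong) (auto simp: GL_assoc[where n=n] subset_iff)

lemma conj_set_one: "H \<subseteq> carrier (GL n) \<Longrightarrow> conj_set n (1\<^sub>m n) H = H"
  unfolding conj_set_def by (auto simp: subset_iff image_iff)

lemma conj_set_inv:
  assumes "x \<in> carrier (GL n)" "H \<subseteq> carrier (GL n)"
  shows "conj_set n (ginv n x) (conj_set n x H) = H" "conj_set n x (conj_set n (ginv n x) H) = H"
  using assms by (simp_all add: conj_set_conj_set conj_set_one)

lemma conj_set_mono: "H \<subseteq> H' \<Longrightarrow> conj_set n x H \<subseteq> conj_set n x H'"
  by (auto simp: conj_set_def)

lemma conj_set_GL:
  assumes "x \<in> carrier (GL n)"
  shows "conj_set n x (carrier (GL n)) = carrier (GL n)"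
proof
  show "conj_set n x (carrier (GL n)) \<subseteq> carrier (GL n)" using assms conj_set_carrier by blast
  have "conj_set n x (conj_set n (ginv n x) (carrier (GL n))) \<subseteq> conj_set n x (carrier (GL n))"
    by (intro conj_set_mono conj_set_carrier) (use assms in auto)
  then show "carrier (GL n) \<subseteq> conj_set n x (carrier (GL n))"
    using conj_set_inv(2)[OF assms subset_refl] by simp
qed

lemma subgroup_conj_set:
  assumes x: "x \<in> carrier (GL n)" and H: "subgroup H (GL n)"
  shows "subgroup (conj_set n x H) (GL n)"
proof (rule subgroup_GL_I)
  note H' = subgroup_GL_D[OF H]
  show "conj_set n x H \<subseteq> carrier (GL n)" using conj_set_carrier x H' by blast
  have "x * 1\<^sub>m n * ginv n x = 1\<^sub>m n" using x by simp
  then show "1\<^sub>m n \<in> conj_set n x H" unfolding conj_set_def using H'(2) by (metis image_eqI)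
  fix a assume "a \<in> conj_set n x H"
  then obtain h where h: "h \<in> H" "a = x * h * ginv n x" by (auto simp: conj_set_def)
  then have hG: "h \<in> carrier (GL n)" using H' by blast
  have "ginv n a = x * ginv n h * ginv n x" using h hG x by (simp add: GL_assoc[where n=n])
  then show "ginv n a \<in> conj_set n x H" using H'(4)[OF h(1)] by (auto simp: conj_set_def)
  fix b assume "b \<in> conj_set n x H"
  then obtain k where k: "k \<in> H" "b = x * k * ginv n x" by (auto simp: conj_set_def)
  then have kG: "k \<in> carrier (GL n)" using H' by blast
  have "a * b = x * (h * k) * ginv n x" using h k hG kG x by (simp add: GL_assoc[where n=n])
  then show "a * b \<in> conj_set n x H" using H'(3)[OF h(1) k(1)] by (auto simp: conj_set_def)
qed

definition finite_double_cosets :: "nat \<Rightarrow> complex mat set \<Rightarrow> complex mat set \<Rightarrow> bool" where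
  "finite_double_cosets n H B \<longleftrightarrow> (\<exists>S. finite S \<and> S \<subseteq> carrier (GL n) \<and>
     (\<forall>g\<in>carrier (GL n). \<exists>h\<in>H. \<exists>s\<in>S. \<exists>b\<in>B. g = h * s * b))"

lemma finite_double_cosets_conjI:
  assumes f: "finite_double_cosets n H B" and x: "x \<in> carrier (GL n)" and y: "y \<in> carrier (GL n)"
    and H: "H \<subseteq> carrier (GL n)" and B: "B \<subseteq> carrier (GL n)"
  shows "finite_double_cosets n (conj_set n x H) (conj_set n y B)"
proof -
  obtain S where S: "finite S" "S \<subseteq> carrier (GL n)"
    and g: "\<forall>g\<in>carrier (GL n). \<exists>h\<in>H. \<exists>s\<in>S. \<exists>b\<in>B. g = h * s * b"
    using f unfolding finite_double_cosets_def by blast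
  let ?S = "(\<lambda>s. x * s * ginv n y) ` S"
  have "\<exists>h\<in>conj_set n x H. \<exists>s\<in>?S. \<exists>b\<in>conj_set n y B. g = h * s * b" if gG: "g \<in> carrier (GL n)" for g
  proof -
    have "ginv n x * g * y \<in> carrier (GL n)" using gG x y by auto
    then obtain h s b where hsb: "h \<in> H" "s \<in> S" "b \<in> B" "ginv n x * g * y = h * s * b"
      using g by blast
    have G: "h \<in> carrier (GL n)" "s \<in> carrier (GL n)" "b \<in> carrier (GL n)" using hsb S H B by auto
    have "g = x * (ginv n x * g * y) * ginv n y" using gG x y by (simp add: GL_assoc[where n=n])
    also have "\<dots> = (x * h * ginv n x) * (x * s * ginv n y) * (y * b * ginv n y)"
      unfolding hsb(4) using G x y by (simp add: GL_assoc[where n=n])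
    finally show ?thesis using hsb unfolding conj_set_def by blast
  qed
  moreover have "?S \<subseteq> carrier (GL n)" using S x y by auto
  ultimately show ?thesis unfolding finite_double_cosets_def using S(1) by (intro exI[of _ ?S]) simp
qed

lemma finite_double_cosets_conj_iff:
  assumes x: "x \<in> carrier (GL n)" and y: "y \<in> carrier (GL n)"
    and H: "H \<subseteq> carrier (GL n)" and B: "B \<subseteq> carrier (GL n)"
  shows "finite_double_cosets n (conj_set n x H) (conj_set n y B) \<longleftrightarrow> finite_double_cosets n H B"
  using finite_double_cosets_conjI[OF _ x y H B]
    finite_double_cosets_conjI[of n "conj_set n x H" "conj_set n y B" "ginv n x" "ginv n y"]
    conj_set_inv[OF x H] conj_set_inv[OF y B] conj_set_carrier[OF x H] conj_set_carrier[OF y B] x y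
  by auto

subsection \<open>Block diagonal matrices\<close>

abbreviation bd :: "nat \<Rightarrow> nat \<Rightarrow> complex mat \<Rightarrow> complex mat \<Rightarrow> complex mat" where
  "bd p q A D \<equiv> four_block_mat A (0\<^sub>m p q) (0\<^sub>m q p) D"

lemma bd_mult:
  assumes "A \<in> carrier_mat p p" "D \<in> carrier_mat q q" "A' \<in> carrier_mat p p" "D' \<in> carrier_mat q q"
  shows "bd p q A D * bd p q A' D' = bd p q (A * A') (D * D')"
  using assms
  by (subst mult_four_block_mat[where ?nr1.0 = p and ?n1.0 = p and ?n2.0 = q and ?nr2.0 = q and ?nc1.0 = p and ?nc2.0 = q]) auto

lemma bd_one: "bd p q (1\<^sub>m p) (1\<^sub>m q) = 1\<^sub>m (p + q)"
  by auto

lemma bd_GL [simp, intro]: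
  assumes "A \<in> carrier (GL p)" "D \<in> carrier (GL q)"
  shows "bd p q A D \<in> carrier (GL (p + q))"
  by (rule GL_memI[of _ _ "bd p q (ginv p A) (ginv q D)"])
    (use assms in \<open>auto simp: bd_mult bd_one GL_mat\<close>)

lemma bd_inv:
  assumes "A \<in> carrier (GL p)" "D \<in> carrier (GL q)"
  shows "ginv (p + q) (bd p q A D) = bd p q (ginv p A) (ginv q D)"
  by (rule GL_inv_unique) (use assms in \<open>auto simp: bd_mult bd_one GL_mat\<close>)

lemma block_diag_mono: "S \<subseteq> S' \<Longrightarrow> T \<subseteq> T' \<Longrightarrow> block_diag p q S T \<subseteq> block_diag p q S' T'"
  by (fastforce simp: block_diag_def)

lemma block_diagI: "A \<in> S \<Longrightarrow> D \<in> T \<Longrightarrow> bd p q A D \<in> block_diag p q S T"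
  by (auto simp: block_diag_def)

lemma subgroup_block_diag:
  assumes S: "subgroup S (GL p)" and T: "subgroup T (GL q)"
  shows "subgroup (block_diag p q S T) (GL (p + q))"
proof (rule subgroup_GL_I)
  note S' = subgroup_GL_D[OF S] and T' = subgroup_GL_D[OF T]
  show "block_diag p q S T \<subseteq> carrier (GL (p + q))" using S'(1) T'(1) by (auto simp: block_diag_def)
  show "1\<^sub>m (p + q) \<in> block_diag p q S T"
    using block_diagI[OF S'(2) T'(2), of p q] by (simp add: bd_one)
  fix x assume "x \<in> block_diag p q S T"
  then obtain A D where x: "A \<in> S" "D \<in> T" "x = bd p q A D" by (auto simp: block_diag_def)
  then show "ginv (p + q) x \<in> block_diag p q S T"
    using S'(1) T'(1) block_diagI[OF S'(4)[OF x(1)] T'(4)[OF x(2)]] by (auto simp: bd_inv subset_iff)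
  fix y assume "y \<in> block_diag p q S T"
  then obtain A' D' where y: "A' \<in> S" "D' \<in> T" "y = bd p q A' D'" by (auto simp: block_diag_def)
  have "x * y = bd p q (A * A') (D * D')"
    unfolding x(3) y(3) by (rule bd_mult) (use x y S'(1) T'(1) in auto)
  then show "x * y \<in> block_diag p q S T" using block_diagI[OF S'(3)[OF x(1) y(1)] T'(3)[OF x(2) y(2)]] by simp
qed

lemma conj_set_block_diag:
  assumes x: "x \<in> carrier (GL p)" and y: "y \<in> carrier (GL q)"
    and S: "S \<subseteq> carrier (GL p)" and T: "T \<subseteq> carrier (GL q)"
  shows "conj_set (p + q) (bd p q x y) (block_diag p q S T)
    = block_diag p q (conj_set p x S) (conj_set q y T)"
proof -
  have *: "bd p q x y * bd p q A D * ginv (p + q) (bd p q x y)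
      = bd p q (x * A * ginv p x) (y * D * ginv q y)" if "A \<in> S" "D \<in> T" for A D
  proof -
    have "A \<in> carrier (GL p)" "D \<in> carrier (GL q)" using that S T by auto
    then show ?thesis using x y by (simp add: bd_inv bd_mult GL_mat)
  qed
  show ?thesis
    unfolding conj_set_def block_diag_def using * by (auto simp: image_iff) metis
qed

subsection \<open>Orbits on the double flag variety are double cosets\<close>

lemma K_group_simps [simp]:
  "carrier (K_group p q) = block_diag p q (carrier (GL p)) (carrier (GL q))"
  "x \<otimes>\<^bsub>K_group p q\<^esub> y = x * y"
  by (auto simp: K_group_def)

lemma l_coset_GL: "x <#\<^bsub>GL n\<^esub> H = (*) x ` H"
  by (auto simp: l_coset_def)

lemma l_coset_K: "x <#\<^bsub>K_group p q\<^esub> H = (*) x ` H"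
  by (auto simp: l_coset_def)

lemma left_coset_eq_iff:
  assumes H: "subgroup H (GL n)" and x: "x \<in> carrier (GL n)" and y: "y \<in> carrier (GL n)"
  shows "(*) x ` H = (*) y ` H \<longleftrightarrow> (\<exists>h\<in>H. x = y * h)"
proof
  note H' = subgroup_GL_D[OF H]
  assume "(*) x ` H = (*) y ` H"
  moreover have "x \<in> (*) x ` H" using H'(2) x by (metis GL_r_one image_eqI)
  ultimately show "\<exists>h\<in>H. x = y * h" by auto
next
  note H' = subgroup_GL_D[OF H]
  assume "\<exists>h\<in>H. x = y * h"
  then obtain h where h: "h \<in> H" "x = y * h" by blast
  have hG: "h \<in> carrier (GL n)" using h H' by blast
  have "x * k \<in> (*) y ` H" if "k \<in> H" for k
    using H'(3)[OF h(1) that] that h H'(1) y by (auto simp: GL_assoc[where n=n] subset_iff)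
  moreover have "y * k \<in> (*) x ` H" if k: "k \<in> H" for k
  proof -
    have "y * k = x * (ginv n h * k)"
      using k h hG H'(1) y by (auto simp: GL_assoc[where n=n] subset_iff)
    then show ?thesis using H'(3)[OF H'(4)[OF h(1)] k] by blast
  qed
  ultimately show "(*) x ` H = (*) y ` H" by blast
qed

text \<open>Every \<open>K\<close>-orbit on \<open>G/B \<times> K/Q\<close> meets the fibre over the base point of \<open>K/Q\<close>, whose
  stabilizer is \<open>Q\<close>; hence the orbits are the double cosets in \<open>Q\<setminus>G/B\<close>.\<close>

lemma finite_orbits_iff:
  assumes B: "subgroup B (GL (p + q))" and Q1: "subgroup Q1 (GL p)" and Q2: "subgroup Q2 (GL q)"
  shows "finite (orbits (K_group p q) (double_flag p q B Q1 Q2) (diag_action p q B Q1 Q2))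
    \<longleftrightarrow> finite_double_cosets (p + q) (block_diag p q Q1 Q2) B"
proof -
  let ?n = "p + q" and ?K = "block_diag p q (carrier (GL p)) (carrier (GL q))"
    and ?Q = "block_diag p q Q1 Q2"
  let ?E = "double_flag p q B Q1 Q2"
  have Ksub: "subgroup ?K (GL ?n)"
    using subgroup_block_diag group.subgroup_self[OF group_GL] by blast
  note K = subgroup_GL_D[OF Ksub]
  have Qsub: "subgroup ?Q (GL ?n)" using subgroup_block_diag[OF Q1 Q2] .
  note Q = subgroup_GL_D[OF Qsub] and B' = subgroup_GL_D[OF B]
  have QK: "?Q \<subseteq> ?K" using block_diag_mono subgroup_GL_D(1)[OF Q1] subgroup_GL_D(1)[OF Q2] by blast
  have E: "?E = {((*) g ` B, (*) k ` ?Q) | g k. g \<in> carrier (GL ?n) \<and> k \<in> ?K}"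
    by (auto simp: double_flag_def LCOSETS_def l_coset_GL l_coset_K)
  have coset_mult: "(*) x ` (*) y ` H = (*) (x * y) ` H"
    if "x \<in> carrier (GL ?n)" "y \<in> carrier (GL ?n)" "H \<subseteq> carrier (GL ?n)" for x y H
    unfolding image_image using that by (intro image_cong) (auto simp: GL_assoc[where n="?n"] subset_iff)
  define orb where "orb g = {((*) (k * g) ` B, (*) k ` ?Q) | k. k \<in> ?K}" for g
  have act: "diag_action p q B Q1 Q2 k ((*) g ` B, (*) k' ` ?Q) = ((*) (k * g) ` B, (*) (k * k') ` ?Q)"
    if "k \<in> ?K" "k' \<in> ?K" "g \<in> carrier (GL ?n)" for k k' g
  proof -
    have m: "((*) g ` B, (*) k' ` ?Q) \<in> ?E" using E that by blast
    have "diag_action p q B Q1 Q2 k ((*) g ` B, (*) k' ` ?Q) = ((*) k ` (*) g ` B, (*) k ` (*) k' ` ?Q)"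
      unfolding diag_action_def using m by (simp add: l_coset_GL l_coset_K)
    then show ?thesis using coset_mult that K(1) Q(1) B'(1) by (simp add: subset_iff)
  qed
  have orbit: "orbit (K_group p q) (diag_action p q B Q1 Q2) ((*) g ` B, (*) k ` ?Q)
      = orb (ginv ?n k * g)" if k: "k \<in> ?K" and g: "g \<in> carrier (GL ?n)" for k g
  proof -
    have kG: "k \<in> carrier (GL ?n)" using k K by blast
    have "orbit (K_group p q) (diag_action p q B Q1 Q2) ((*) g ` B, (*) k ` ?Q)
      = {((*) (x * g) ` B, (*) (x * k) ` ?Q) | x. x \<in> ?K}"
      unfolding orbit_def K_group_simps by (rule Collect_cong) (metis act[OF _ k g])
    also have "\<dots> = orb (ginv ?n k * g)"
    proof (intro equalityI subsetI)
      fix z assume "z \<in> {((*) (x * g) ` B, (*) (x * k) ` ?Q) | x. x \<in> ?K}"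
      then obtain x where x: "x \<in> ?K" "z = ((*) (x * g) ` B, (*) (x * k) ` ?Q)" by blast
      have "x * g = (x * k) * (ginv ?n k * g)" using x K(1) kG g by (auto simp: GL_assoc[where n="?n"] subset_iff)
      then show "z \<in> orb (ginv ?n k * g)" unfolding orb_def using x K(3)[OF x(1) k] by auto
    next
      fix z assume "z \<in> orb (ginv ?n k * g)"
      then obtain x where x: "x \<in> ?K" "z = ((*) (x * (ginv ?n k * g)) ` B, (*) x ` ?Q)"
        unfolding orb_def by blast
      have "x * (ginv ?n k * g) = (x * ginv ?n k) * g" "x = (x * ginv ?n k) * k"
        using x K(1) kG g by (auto simp: GL_assoc[where n="?n"] subset_iff)
      then show "z \<in> {((*) (x * g) ` B, (*) (x * k) ` ?Q) | x. x \<in> ?K}"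
        using x K(3)[OF x(1) K(4)[OF k]] by auto
    qed
    finally show ?thesis .
  qed
  have orbs: "orbits (K_group p q) ?E (diag_action p q B Q1 Q2) = orb ` carrier (GL ?n)"
  proof (intro equalityI subsetI)
    fix z assume "z \<in> orbits (K_group p q) ?E (diag_action p q B Q1 Q2)"
    then obtain g k where gk: "g \<in> carrier (GL ?n)" "k \<in> ?K"
      "z = orbit (K_group p q) (diag_action p q B Q1 Q2) ((*) g ` B, (*) k ` ?Q)"
      unfolding orbits_def E by blast
    then have "z = orb (ginv ?n k * g)" using orbit by blast
    moreover have "ginv ?n k * g \<in> carrier (GL ?n)" using gk K(1) by blast
    ultimately show "z \<in> orb ` carrier (GL ?n)" by blast
  next
    fix z assume "z \<in> orb ` carrier (GL ?n)"
    then obtain g where g: "g \<in> carrier (GL ?n)" "z = orb g" by blast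
    have "z = orbit (K_group p q) (diag_action p q B Q1 Q2) ((*) g ` B, (*) (1\<^sub>m ?n) ` ?Q)"
      using orbit[OF K(2) g(1)] g by simp
    then show "z \<in> orbits (K_group p q) ?E (diag_action p q B Q1 Q2)"
      unfolding orbits_def E using g(1) K(2) by blast
  qed
  have orb_eq: "orb g = orb s \<longleftrightarrow> (\<exists>h\<in>?Q. \<exists>b\<in>B. g = h * s * b)"
    if g: "g \<in> carrier (GL ?n)" and s: "s \<in> carrier (GL ?n)" for g s
  proof
    assume "orb g = orb s"
    moreover have "((*) g ` B, (*) (1\<^sub>m ?n) ` ?Q) \<in> orb g"
      unfolding orb_def using K(2) g by (metis (mono_tags, lifting) GL_l_one mem_Collect_eq)
    ultimately obtain k where k: "k \<in> ?K" "(*) g ` B = (*) (k * s) ` B" "(*) (1\<^sub>m ?n) ` ?Q = (*) k ` ?Q"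
      unfolding orb_def by auto
    have kG: "k \<in> carrier (GL ?n)" using k K by blast
    obtain h where "h \<in> ?Q" "k = 1\<^sub>m ?n * h" using left_coset_eq_iff[OF Qsub kG, of "1\<^sub>m ?n"] k(3) by auto
    then have "k \<in> ?Q" using Q(1) by (auto simp: subset_iff)
    moreover obtain b where "b \<in> B" "g = (k * s) * b"
      using left_coset_eq_iff[OF B g, of "k * s"] k(2) kG s by auto
    ultimately show "\<exists>h\<in>?Q. \<exists>b\<in>B. g = h * s * b" by blast
  next
    assume "\<exists>h\<in>?Q. \<exists>b\<in>B. g = h * s * b"
    then obtain h b where hb: "h \<in> ?Q" "b \<in> B" "g = h * s * b" by blast
    have hG: "h \<in> carrier (GL ?n)" and bG: "b \<in> carrier (GL ?n)" using hb Q(1) B'(1) by auto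
    have *: "(*) (k * g) ` B = (*) ((k * h) * s) ` B" "(*) k ` ?Q = (*) (k * h) ` ?Q"
      if k: "k \<in> ?K" for k
    proof -
      have kG: "k \<in> carrier (GL ?n)" using k K by blast
      have "k * g = ((k * h) * s) * b" using hb(3) kG hG s bG by (simp add: GL_assoc[where n="?n"])
      then show "(*) (k * g) ` B = (*) ((k * h) * s) ` B"
        using left_coset_eq_iff[OF B, of "k * g" "(k * h) * s"] hb kG hG s g by blast
      have "k = (k * h) * ginv ?n h" using kG hG by (simp add: GL_assoc[where n="?n"])
      then show "(*) k ` ?Q = (*) (k * h) ` ?Q"
        using left_coset_eq_iff[OF Qsub, of "k" "k * h"] kG hG Q(4)[OF hb(1)] by blast
    qed
    have hK: "h \<in> ?K" using hb QK by blast
    show "orb g = orb s"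
    proof (intro equalityI subsetI)
      fix z assume "z \<in> orb g"
      then obtain k where k: "k \<in> ?K" "z = ((*) (k * g) ` B, (*) k ` ?Q)" unfolding orb_def by blast
      then have "z = ((*) ((k * h) * s) ` B, (*) (k * h) ` ?Q)" using * by simp
      then show "z \<in> orb s" unfolding orb_def using K(3)[OF k(1) hK] by blast
    next
      fix z assume "z \<in> orb s"
      then obtain k where k: "k \<in> ?K" "z = ((*) (k * s) ` B, (*) k ` ?Q)" unfolding orb_def by blast
      have k': "k * ginv ?n h \<in> ?K" using K(3)[OF k(1) K(4)[OF hK]] .
      have "(k * ginv ?n h) * h = k" using k K(1) hG by (auto simp: GL_assoc[where n="?n"] subset_iff)
      then have "z = ((*) ((k * ginv ?n h) * g) ` B, (*) (k * ginv ?n h) ` ?Q)" using *[OF k'] k by simp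
      then show "z \<in> orb g" unfolding orb_def using k' by blast
    qed
  qed
  show ?thesis
  proof
    assume "finite (orbits (K_group p q) ?E (diag_action p q B Q1 Q2))"
    then obtain S where S: "S \<subseteq> carrier (GL ?n)" "finite S" "orb ` carrier (GL ?n) = orb ` S"
      unfolding orbs using finite_subset_image[of "orb ` carrier (GL ?n)" orb "carrier (GL ?n)"] by auto
    have "\<exists>h\<in>?Q. \<exists>s\<in>S. \<exists>b\<in>B. g = h * s * b" if g: "g \<in> carrier (GL ?n)" for g
    proof -
      obtain s where s: "s \<in> S" "orb g = orb s" using S(3) g by blast
      then show ?thesis using orb_eq[OF g, of s] S(1) by blast
    qed
    then show "finite_double_cosets ?n ?Q B" unfolding finite_double_cosets_def using S by blast
  next
    assume "finite_double_cosets ?n ?Q B"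
    then obtain S where S: "finite S" "S \<subseteq> carrier (GL ?n)"
      and g: "\<forall>g\<in>carrier (GL ?n). \<exists>h\<in>?Q. \<exists>s\<in>S. \<exists>b\<in>B. g = h * s * b"
      unfolding finite_double_cosets_def by blast
    have "orb ` carrier (GL ?n) \<subseteq> orb ` S"
    proof
      fix z assume "z \<in> orb ` carrier (GL ?n)"
      then obtain x where x: "x \<in> carrier (GL ?n)" "z = orb x" by blast
      then obtain h s b where hsb: "h \<in> ?Q" "s \<in> S" "b \<in> B" "x = h * s * b" using g by blast
      then have "orb x = orb s" using orb_eq[OF x(1), of s] S(2) by blast
      then show "z \<in> orb ` S" using x hsb by blast
    qed
    then show "finite (orbits (K_group p q) ?E (diag_action p q B Q1 Q2))"
      unfolding orbs using S(1) finite_surj by blast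
  qed
qed

section \<open>Matrices with prescribed zero pattern\<close>

lemma mat_mult_entry:
  assumes "A \<in> carrier_mat a n" "B \<in> carrier_mat n b" "i < a" "j < b"
  shows "(A * B) $$ (i, j) = (\<Sum>k<n. A $$ (i, k) * B $$ (k, j))"
  using assms by (auto simp: scalar_prod_def atLeast0LessThan)

lemma GL_mult_entry:
  assumes "A \<in> carrier (GL n)" "B \<in> carrier (GL n)" "i < n" "j < n"
  shows "(A * B) $$ (i, j) = (\<Sum>k<n. A $$ (i, k) * B $$ (k, j))"
  using mat_mult_entry assms by blast

lemma det_zero_iff_kernel:
  fixes A :: "complex mat"
  assumes A: "A \<in> carrier_mat n n"
  shows "det A = 0 \<longleftrightarrow> (\<exists>v. (\<exists>i<n. v i \<noteq> 0) \<and> (\<forall>i<n. (\<Sum>k<n. A $$ (i, k) * v k) = 0))"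
proof
  assume "det A = 0"
  then obtain w where w: "w \<in> carrier_vec n" "w \<noteq> 0\<^sub>v n" "A *\<^sub>v w = 0\<^sub>v n"
    using det_0_iff_vec_prod_zero[OF A] by blast
  have "\<exists>i<n. w $ i \<noteq> 0" using w(1,2) by (metis carrier_vecD eq_vecI index_zero_vec)
  moreover have "(\<Sum>k<n. A $$ (i, k) * w $ k) = 0" if "i < n" for i
  proof -
    have "(A *\<^sub>v w) $ i = (\<Sum>k<n. A $$ (i, k) * w $ k)"
      using A w(1) that by (auto simp: scalar_prod_def atLeast0LessThan)
    then show ?thesis using w(3) that by simp
  qed
  ultimately show "\<exists>v. (\<exists>i<n. v i \<noteq> 0) \<and> (\<forall>i<n. (\<Sum>k<n. A $$ (i, k) * v k) = 0)"
    by (intro exI[of _ "\<lambda>i. w $ i"]) blast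
next
  assume "\<exists>v. (\<exists>i<n. v i \<noteq> 0) \<and> (\<forall>i<n. (\<Sum>k<n. A $$ (i, k) * v k) = 0)"
  then obtain v where v: "\<exists>i<n. v i \<noteq> 0" "\<forall>i<n. (\<Sum>k<n. A $$ (i, k) * v k) = 0" by blast
  have "vec n v \<noteq> 0\<^sub>v n" using v(1) by (metis index_vec index_zero_vec(1))
  moreover have "A *\<^sub>v vec n v = 0\<^sub>v n"
    using A v(2) by (intro eq_vecI) (auto simp: scalar_prod_def atLeast0LessThan)
  ultimately show "det A = 0" using det_0_iff_vec_prod_zero[OF A] vec_carrier by blast
qed

lemma det_zero_iff_left_kernel:
  fixes A :: "complex mat"
  assumes A: "A \<in> carrier_mat n n"
  shows "det A = 0 \<longleftrightarrow> (\<exists>v. (\<exists>i<n. v i \<noteq> 0) \<and> (\<forall>k<n. (\<Sum>i<n. A $$ (i, k) * v i) = 0))"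
proof -
  have "det A = det (transpose_mat A)" using det_transpose[OF A] by simp
  moreover have "transpose_mat A \<in> carrier_mat n n" using A by simp
  moreover have "(\<Sum>k<n. transpose_mat A $$ (i, k) * v k) = (\<Sum>k<n. A $$ (k, i) * v k)"
    if "i < n" for i v
    using A that by (intro sum.cong) auto
  ultimately show ?thesis using det_zero_iff_kernel[of "transpose_mat A" n] by simp
qed

text \<open>For a preorder \<open>R\<close> this is the unit group of the incidence algebra of \<open>R\<close>. A total order gives the
  Borel subgroup of matrices that are triangular for this order, a total preorder gives a parabolic
  subgroup containing the diagonal matrices, and the intersections of such groups arise as well.\<close>

definition pat :: "(nat \<Rightarrow> nat \<Rightarrow> bool) \<Rightarrow> nat \<Rightarrow> complex mat set" where
  "pat R n = {A \<in> carrier (GL n). \<forall>i<n. \<forall>j<n. A $$ (i, j) \<noteq> 0 \<longrightarrow> R i j}"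

lemma pat_GL: "pat R n \<subseteq> carrier (GL n)"
  by (auto simp: pat_def)

lemma pat_D: "A \<in> pat R n \<Longrightarrow> i < n \<Longrightarrow> j < n \<Longrightarrow> \<not> R i j \<Longrightarrow> A $$ (i, j) = 0"
  by (auto simp: pat_def)

lemma pat_mono: "(\<And>i j. i < n \<Longrightarrow> j < n \<Longrightarrow> R i j \<Longrightarrow> R' i j) \<Longrightarrow> pat R n \<subseteq> pat R' n"
  unfolding pat_def by blast

text \<open>Fix a column \<open>j\<close> of the inverse. The indices \<open>k\<close> with \<open>R k j\<close> are closed downwards, so \<open>A\<close> is block
  triangular with respect to them and its block on the other indices, completed by the identity to
  the matrix \<open>A'\<close> below, is invertible. That block kills the part of column \<open>j\<close> of the inverse at the
  other indices, which is therefore zero.\<close>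

lemma pat_inv:
  assumes R: "reflp R" "transp R" and A: "A \<in> pat R n"
  shows "ginv n A \<in> pat R n"
proof -
  have AG: "A \<in> carrier (GL n)" using A pat_GL by blast
  let ?C = "ginv n A"
  have CG: "?C \<in> carrier (GL n)" using AG by simp
  have "R i j" if ij: "i < n" "j < n" "?C $$ (i, j) \<noteq> 0" for i j
  proof (rule ccontr)
    assume nR: "\<not> R i j"
    have zero: "A $$ (a, b) = 0" if "a < n" "b < n" "\<not> R a j" "R b j" for a b
      using pat_D[OF A that(1,2)] that R(2) unfolding transp_def by blast
    define A' where "A' = mat n n (\<lambda>(a, b). if \<not> R a j \<and> \<not> R b j then A $$ (a, b)
      else if a = b then 1 else 0)"
    have A'c: "A' \<in> carrier_mat n n" by (simp add: A'_def)
    have "det A' \<noteq> 0"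
    proof
      assume "det A' = 0"
      then obtain v where v: "\<exists>i<n. v i \<noteq> 0" "\<forall>k<n. (\<Sum>i<n. A' $$ (i, k) * v i) = 0"
        using det_zero_iff_left_kernel[OF A'c] by blast
      have v0: "v k = 0" if k: "k < n" "R k j" for k
      proof -
        have "(\<Sum>i<n. A' $$ (i, k) * v i) = (\<Sum>i<n. if i = k then v i else 0)"
          by (rule sum.cong) (use k in \<open>auto simp: A'_def\<close>)
        then show ?thesis using v(2) k by simp
      qed
      have "(\<Sum>i<n. A $$ (i, k) * v i) = 0" if k: "k < n" for k
      proof (cases "R k j")
        case True
        have "A $$ (i, k) * v i = 0" if i: "i < n" for i
          using v0[OF i] zero[OF i k _ True] by (cases "R i j") simp_all
        then show ?thesis by (intro sum.neutral) simp
      next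
        case False
        have "(\<Sum>i<n. A $$ (i, k) * v i) = (\<Sum>i<n. A' $$ (i, k) * v i)"
          by (rule sum.cong) (use k False v0 in \<open>auto simp: A'_def\<close>)
        then show ?thesis using v(2) k by simp
      qed
      then have "det A = 0" using det_zero_iff_left_kernel[of A n] v(1) AG by (auto simp: GL_mat)
      then show False using AG by (simp add: GL_carrier_iff)
    qed
    moreover have "det A' = 0"
    proof -
      let ?y = "\<lambda>k. if R k j then 0 else ?C $$ (k, j)"
      have "(\<Sum>k<n. A' $$ (a, k) * ?y k) = 0" if a: "a < n" for a
      proof (cases "R a j")
        case True
        then show ?thesis by (intro sum.neutral) (auto simp: A'_def a)
      next
        case False
        have "(\<Sum>k<n. A' $$ (a, k) * ?y k) = (\<Sum>k<n. A $$ (a, k) * ?C $$ (k, j))"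
          by (rule sum.cong) (use a False zero in \<open>auto simp: A'_def\<close>)
        also have "\<dots> = (A * ?C) $$ (a, j)" using GL_mult_entry[OF AG CG a ij(2)] by simp
        also have "\<dots> = 0" using AG a ij(2) False R(1) by (auto simp: reflp_def)
        finally show ?thesis .
      qed
      moreover have "\<exists>i<n. ?y i \<noteq> 0" using ij nR by auto
      ultimately show ?thesis unfolding det_zero_iff_kernel[OF A'c] by (intro exI[of _ ?y]) blast
    qed
    ultimately show False by blast
  qed
  then show ?thesis using CG by (auto simp: pat_def)
qed

lemma pat_mult:
  assumes R: "transp R" and A: "A \<in> pat R n" and B: "B \<in> pat R n"
  shows "A * B \<in> pat R n"
proof -
  have G: "A \<in> carrier (GL n)" "B \<in> carrier (GL n)" using A B pat_GL by auto
  have "R i j" if ij: "i < n" "j < n" "(A * B) $$ (i, j) \<noteq> 0" for i j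
  proof -
    have "(\<Sum>k<n. A $$ (i, k) * B $$ (k, j)) \<noteq> 0" using GL_mult_entry[OF G ij(1,2)] ij by simp
    then obtain k where "k < n" "A $$ (i, k) * B $$ (k, j) \<noteq> 0"
      by (meson lessThan_iff sum.neutral)
    then have "k < n" "R i k" "R k j" using pat_D[OF A ij(1)] pat_D[OF B _ ij(2)] by auto
    then show ?thesis using R transpD by fast
  qed
  then show ?thesis using G by (auto simp: pat_def)
qed

lemma pat_one: "reflp R \<Longrightarrow> 1\<^sub>m n \<in> pat R n"
  by (auto simp: pat_def reflp_def)

lemma subgroup_pat:
  assumes "reflp R" "transp R"
  shows "subgroup (pat R n) (GL n)"
  by (rule subgroup_GL_I) (use assms pat_GL pat_one pat_mult pat_inv in auto)

abbreviation UT :: "nat \<Rightarrow> complex mat set" where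
  "UT n \<equiv> pat (\<le>) n"

lemma refl_trans_key [simp]: "reflp (\<lambda>i j. r i \<le> (r j :: nat))" "transp (\<lambda>i j. r i \<le> (r j :: nat))"
  by (auto simp: reflp_def transp_def)

lemma refl_trans_le [simp]: "reflp ((\<le>) :: nat \<Rightarrow> nat \<Rightarrow> bool)" "transp ((\<le>) :: nat \<Rightarrow> nat \<Rightarrow> bool)"
  by (auto simp: reflp_def transp_def)

lemmas subgroup_UT = subgroup_pat[OF refl_trans_le]

subsection \<open>Elementary matrices\<close>

definition colmat :: "nat \<Rightarrow> nat \<Rightarrow> (nat \<Rightarrow> complex) \<Rightarrow> complex mat" where
  "colmat n a v = mat n n (\<lambda>(i, j). if j = a then v i else if i = j then 1 else 0)"

definition rowmat :: "nat \<Rightarrow> nat \<Rightarrow> (nat \<Rightarrow> complex) \<Rightarrow> complex mat" where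
  "rowmat n a w = mat n n (\<lambda>(i, j). if i = a then w j else if i = j then 1 else 0)"

lemma colmat_carrier [simp]: "colmat n a v \<in> carrier_mat n n"
  by (simp add: colmat_def)

lemma rowmat_carrier [simp]: "rowmat n a v \<in> carrier_mat n n"
  by (simp add: rowmat_def)

lemma colmat_mult:
  assumes "X \<in> carrier_mat n m" "a < n" "i < n" "j < m"
  shows "(colmat n a v * X) $$ (i, j) = (if i = a then 0 else X $$ (i, j)) + v i * X $$ (a, j)"
proof -
  have "(colmat n a v * X) $$ (i, j) = (\<Sum>k<n. colmat n a v $$ (i, k) * X $$ (k, j))"
    using mat_mult_entry[OF colmat_carrier assms(1,3,4)] .
  also have "\<dots> = (\<Sum>k<n. (if k = i then (if i = a then 0 else X $$ (i, j)) else 0)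
      + (if k = a then v i * X $$ (a, j) else 0))"
    by (rule sum.cong) (use assms in \<open>auto simp: colmat_def\<close>)
  also have "\<dots> = (if i = a then 0 else X $$ (i, j)) + v i * X $$ (a, j)"
    using assms by (simp add: sum.distrib)
  finally show ?thesis .
qed

lemma mult_rowmat:
  assumes "X \<in> carrier_mat m n" "a < n" "i < m" "j < n"
  shows "(X * rowmat n a w) $$ (i, j) = (if j = a then 0 else X $$ (i, j)) + X $$ (i, a) * w j"
proof -
  have "(X * rowmat n a w) $$ (i, j) = (\<Sum>k<n. X $$ (i, k) * rowmat n a w $$ (k, j))"
    using mat_mult_entry[OF assms(1) rowmat_carrier assms(3,4)] .
  also have "\<dots> = (\<Sum>k<n. (if k = j then (if j = a then 0 else X $$ (i, j)) else 0)
      + (if k = a then X $$ (i, a) * w j else 0))"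
    by (rule sum.cong) (use assms in \<open>auto simp: rowmat_def\<close>)
  also have "\<dots> = (if j = a then 0 else X $$ (i, j)) + X $$ (i, a) * w j"
    using assms by (simp add: sum.distrib)
  finally show ?thesis .
qed

lemma colmat_GL:
  assumes "a < n" "v a \<noteq> 0"
  shows "colmat n a v \<in> carrier (GL n)"
proof (rule GL_memI[of _ _ "colmat n a (\<lambda>i. if i = a then 1 / v a else - v i / v a)"])
  show "colmat n a v * colmat n a (\<lambda>i. if i = a then 1 / v a else - v i / v a) = 1\<^sub>m n"
  proof (rule eq_matI)
    fix i j assume "i < dim_row (1\<^sub>m n)" "j < dim_col (1\<^sub>m n)"
    then show "(colmat n a v * colmat n a (\<lambda>i. if i = a then 1 / v a else - v i / v a)) $$ (i, j) = 1\<^sub>m n $$ (i, j)"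
      using assms by (subst colmat_mult[where n = n and m = n]) (auto simp: colmat_def)
  qed (auto simp: colmat_def)
qed auto

lemma rowmat_GL:
  assumes "a < n" "w a \<noteq> 0"
  shows "rowmat n a w \<in> carrier (GL n)"
proof -
  have "rowmat n a w = transpose_mat (colmat n a w)"
    by (rule eq_matI) (auto simp: rowmat_def colmat_def)
  then show ?thesis using colmat_GL[of a n w, OF assms] det_transpose[OF colmat_carrier, of n a w]
    by (simp add: GL_carrier_iff)
qed

lemma colmat_pat:
  assumes "a < n" "v a \<noteq> 0" "reflp R" "\<And>i. i < n \<Longrightarrow> v i \<noteq> 0 \<Longrightarrow> R i a"
  shows "colmat n a v \<in> pat R n"
  unfolding pat_def
proof (intro CollectI conjI allI impI)
  show "colmat n a v \<in> carrier (GL n)" using colmat_GL[of a n v, OF assms(1,2)] .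
  fix i j assume "i < n" "j < n" "colmat n a v $$ (i, j) \<noteq> 0"
  then show "R i j" using assms(4)[of i] reflpD[OF assms(3), of i]
    by (cases "j = a"; cases "i = j") (simp_all add: colmat_def)
qed

lemma rowmat_pat:
  assumes "a < n" "w a \<noteq> 0" "reflp R" "\<And>j. j < n \<Longrightarrow> w j \<noteq> 0 \<Longrightarrow> R a j"
  shows "rowmat n a w \<in> pat R n"
  unfolding pat_def
proof (intro CollectI conjI allI impI)
  show "rowmat n a w \<in> carrier (GL n)" using rowmat_GL[of a n w, OF assms(1,2)] .
  fix i j assume "i < n" "j < n" "rowmat n a w $$ (i, j) \<noteq> 0"
  then show "R i j" using assms(4)[of j] reflpD[OF assms(3), of i]
    by (cases "i = a"; cases "i = j") (simp_all add: rowmat_def)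
qed

subsection \<open>Bruhat normal form of a rectangular matrix\<close>

lemma mat_regroup:
  assumes "d2 \<in> carrier_mat q q" "c2 \<in> carrier_mat q q" "Y \<in> carrier_mat q p"
    "c1 \<in> carrier_mat p p" "d1 \<in> carrier_mat p p"
  shows "d2 * (c2 * Y * c1) * d1 = (d2 * c2) * Y * (c1 * d1)"
proof -
  have "d2 * (c2 * Y * c1) = d2 * c2 * Y * c1"
    using assms assoc_mult_mat[of d2 q q "c2 * Y" p c1 p] assoc_mult_mat[of d2 q q c2 q Y p]
    by (metis mult_carrier_mat)
  moreover have "d2 * c2 * Y * c1 * d1 = (d2 * c2) * Y * (c1 * d1)"
    using assms assoc_mult_mat[of "d2 * c2 * Y" q p c1 p d1 p] by (metis mult_carrier_mat)
  ultimately show ?thesis by simp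
qed

lemma ex_minimal_key:
  fixes f :: "'a \<Rightarrow> nat"
  assumes "finite S" "S \<noteq> {}"
  shows "\<exists>x\<in>S. \<forall>y\<in>S. f x \<le> f y"
  using assms arg_min_if_finite[OF assms, of f] by (metis not_le)

lemma ex_maximal_key:
  fixes f :: "'a \<Rightarrow> nat"
  assumes "finite S" "S \<noteq> {}"
  shows "\<exists>x\<in>S. \<forall>y\<in>S. f y \<le> f x"
proof -
  have "Max (f ` S) \<in> f ` S" using assms by (intro Max_in) auto
  then obtain x where "x \<in> S" "f x = Max (f ` S)" by auto
  then show ?thesis using assms Max_ge[of "f ` S"] by (intro bexI[of _ x]) auto
qed

definition clean_col :: "nat \<Rightarrow> nat \<Rightarrow> complex mat \<Rightarrow> nat \<Rightarrow> bool" where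
  "clean_col q p Y j \<longleftrightarrow> (\<forall>i<q. Y $$ (i, j) \<noteq> 0 \<longrightarrow> Y $$ (i, j) = 1 \<and>
     (\<forall>i'<q. i' \<noteq> i \<longrightarrow> Y $$ (i', j) = 0) \<and> (\<forall>j'<p. j' \<noteq> j \<longrightarrow> Y $$ (i, j') = 0))"

definition partial_perm :: "nat \<Rightarrow> nat \<Rightarrow> complex mat \<Rightarrow> bool" where
  "partial_perm q p Y \<longleftrightarrow> Y \<in> carrier_mat q p \<and> (\<forall>j<p. clean_col q p Y j)"

text \<open>Gaussian elimination with a pivot whose use respects both orders: among the columns that are not yet
  clean choose the smallest, and in it the largest row with a nonzero entry. Clearing the pivot column
  then changes smaller rows only, clearing the pivot row changes larger columns only, and columns that
  are clean already stay clean.\<close>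

lemma bruhat_rectangular:
  fixes r1 r2 :: "nat \<Rightarrow> nat"
  assumes "Y \<in> carrier_mat q p" "inj_on r1 {..<p}" 
  shows "\<exists>c2\<in>pat (\<lambda>i j. r2 i \<le> r2 j) q. \<exists>c1\<in>pat (\<lambda>i j. r1 i \<le> r1 j) p. partial_perm q p (c2 * Y * c1)"
  using assms(1)
proof (induction "card {j. j < p \<and> \<not> clean_col q p Y j}" arbitrary: Y rule: less_induct)
  case less
  let ?D = "\<lambda>Y. {j. j < p \<and> \<not> clean_col q p Y j}"
  let ?P2 = "pat (\<lambda>i j. r2 i \<le> r2 j) q" and ?P1 = "pat (\<lambda>i j. r1 i \<le> r1 j) p"
  have Yc: "Y \<in> carrier_mat q p" by fact
  show ?case
  proof (cases "?D Y = {}")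
    case True
    have "1\<^sub>m q * Y * 1\<^sub>m p = Y" using Yc by simp
    then have "partial_perm q p (1\<^sub>m q * Y * 1\<^sub>m p)" using True Yc by (auto simp: partial_perm_def)
    then show ?thesis by (intro bexI[of _ "1\<^sub>m q"] bexI[of _ "1\<^sub>m p"] pat_one) simp_all
  next
    case False
    have fin: "finite (?D Y)" by simp
    obtain j where j: "j \<in> ?D Y" "\<forall>l\<in>?D Y. r1 j \<le> r1 l"
      using ex_minimal_key[OF fin False] by blast
    let ?I = "{i. i < q \<and> Y $$ (i, j) \<noteq> 0}"
    have "?I \<noteq> {}" using j(1) unfolding clean_col_def by auto
    then obtain i where i: "i \<in> ?I" "\<forall>k\<in>?I. r2 k \<le> r2 i"
      using ex_maximal_key[of ?I r2] by auto
    have jp: "j < p" and iq: "i < q" and Yij: "Y $$ (i, j) \<noteq> 0" using i j by auto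
    \<comment> \<open>A clean column has no nonzero entry in the pivot row.\<close>
    have clean_i: "Y $$ (i, l) = 0" if "l < p" "clean_col q p Y l" "l \<noteq> j" for l
    proof (rule ccontr)
      assume "Y $$ (i, l) \<noteq> 0"
      then have "Y $$ (i, j) = 0" using that iq jp unfolding clean_col_def by blast
      then show False using Yij by simp
    qed
    define c2 where "c2 = colmat q i (\<lambda>k. if k = i then 1 / Y $$ (i, j) else - Y $$ (k, j) / Y $$ (i, j))"
    define c1 where "c1 = rowmat p j (\<lambda>l. if l = j then 1 else - Y $$ (i, l) / Y $$ (i, j))"
    have c2: "c2 \<in> ?P2" unfolding c2_def
      by (rule colmat_pat) (use iq Yij i in \<open>auto split: if_splits\<close>)
    have r1: "r1 j \<le> r1 l" if "l < p" "Y $$ (i, l) \<noteq> 0" for l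
    proof (cases "clean_col q p Y l")
      case True
      then show ?thesis using clean_i[OF that(1) True] that(2) by (cases "l = j") auto
    next
      case False
      then show ?thesis using j(2) that(1) by auto
    qed
    have c1: "c1 \<in> ?P1" unfolding c1_def
      by (rule rowmat_pat) (use jp Yij r1 in \<open>auto split: if_splits\<close>)
    have cc: "c2 \<in> carrier_mat q q" "c1 \<in> carrier_mat p p" by (auto simp: c2_def c1_def)
    define Y' where "Y' = c2 * Y * c1"
    have Y'c: "Y' \<in> carrier_mat q p" unfolding Y'_def using cc Yc by auto
    \<comment> \<open>The result is the Schur complement of the pivot, with a \<open>1\<close> in the place of the pivot.\<close>
    have Y': "Y' $$ (k, l) = (if l = j then (if k = i then 1 else 0) else if k = i then 0
        else Y $$ (k, l) - Y $$ (k, j) * Y $$ (i, l) / Y $$ (i, j))" if "k < q" "l < p" for k l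
    proof -
      have Z: "(c2 * Y) $$ (k, m) = (if k = i then Y $$ (i, m) / Y $$ (i, j)
          else Y $$ (k, m) - Y $$ (k, j) * Y $$ (i, m) / Y $$ (i, j))" if "m < p" for m
        unfolding c2_def using colmat_mult[OF Yc iq \<open>k < q\<close> that] by auto
      have "Y' $$ (k, l) = (if l = j then 0 else (c2 * Y) $$ (k, l))
         + (c2 * Y) $$ (k, j) * (if l = j then 1 else - Y $$ (i, l) / Y $$ (i, j))"
        unfolding Y'_def c1_def by (rule mult_rowmat) (use that jp cc Yc in auto)
      then show ?thesis unfolding Z[OF that(2)] Z[OF jp] using Yij by auto
    qed
    have cj: "clean_col q p Y' j" unfolding clean_col_def using jp by (auto simp: Y')
    have cl: "clean_col q p Y' l" if l: "l < p" "clean_col q p Y l" "l \<noteq> j" for l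
      unfolding clean_col_def
    proof (intro allI impI)
      fix k assume k: "k < q" "Y' $$ (k, l) \<noteq> 0"
      have eq: "Y' $$ (k', l) = (if k' = i then 0 else Y $$ (k', l))" if "k' < q" for k'
        using Y'[OF that l(1)] clean_i[OF l] l by simp
      have ki: "k \<noteq> i" and Ykl: "Y $$ (k, l) \<noteq> 0" using k eq by (auto split: if_splits)
      note c = l(2)[unfolded clean_col_def, rule_format, OF k(1) Ykl]
      have "Y' $$ (k, j') = 0" if "j' < p" "j' \<noteq> l" for j'
      proof -
        have "Y $$ (k, j) = 0" using conjunct2[OF conjunct2[OF c]] jp l(3) by blast
        then show ?thesis using Y'[OF k(1) that(1)] ki c that by auto
      qed
      then show "Y' $$ (k, l) = 1 \<and> (\<forall>i'<q. i' \<noteq> k \<longrightarrow> Y' $$ (i', l) = 0) \<and> (\<forall>j'<p. j' \<noteq> l \<longrightarrow> Y' $$ (k, j') = 0)"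
        using eq c k(1) ki by auto
    qed
    have "?D Y' \<subset> ?D Y" using cl cj j(1) by blast
    then have "card (?D Y') < card (?D Y)" using fin psubset_card_mono by blast
    then obtain d2 d1 where d: "d2 \<in> ?P2" "d1 \<in> ?P1" "partial_perm q p (d2 * Y' * d1)"
      using less(1)[of Y'] Y'c by blast
    have dc: "d2 \<in> carrier_mat q q" "d1 \<in> carrier_mat p p" using d(1,2) by (auto simp: pat_def GL_carrier_iff)
    have "d2 * Y' * d1 = (d2 * c2) * Y * (c1 * d1)"
      unfolding Y'_def using mat_regroup[OF dc(1) cc(1) Yc cc(2) dc(2)] .
    moreover have "d2 * c2 \<in> ?P2" by (rule pat_mult) (use d c2 in simp_all)
    moreover have "c1 * d1 \<in> ?P1" by (rule pat_mult) (use d c1 in simp_all)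
    ultimately show ?thesis using d(3) by (intro bexI[of _ "d2 * c2"] bexI[of _ "c1 * d1"]) simp_all
  qed
qed

subsection \<open>Permutation, diagonal and block unipotent matrices\<close>

abbreviation iperm :: "(nat \<Rightarrow> nat) \<Rightarrow> nat \<Rightarrow> nat" where
  "iperm \<sigma> \<equiv> inv_into UNIV \<sigma>"

definition permmat :: "nat \<Rightarrow> (nat \<Rightarrow> nat) \<Rightarrow> complex mat" where
  "permmat n \<sigma> = mat n n (\<lambda>(i, j). if i = \<sigma> j then 1 else 0)"

definition dmat :: "nat \<Rightarrow> (nat \<Rightarrow> complex) \<Rightarrow> complex mat" where
  "dmat n t = mat n n (\<lambda>(i, j). if i = j then t i else 0)"

lemma permmat_carrier [simp]: "permmat n \<sigma> \<in> carrier_mat n n"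
  by (simp add: permmat_def)

lemma dmat_carrier [simp]: "dmat n t \<in> carrier_mat n n"
  by (simp add: dmat_def)

lemma mult_permmat:
  assumes "X \<in> carrier_mat m n" "\<sigma> permutes {..<n}" "i < m" "j < n"
  shows "(X * permmat n \<sigma>) $$ (i, j) = X $$ (i, \<sigma> j)"
proof -
  have s: "\<sigma> j < n" using permutes_in_image[OF assms(2), of j] assms(4) by simp
  have "(X * permmat n \<sigma>) $$ (i, j) = (\<Sum>k<n. X $$ (i, k) * permmat n \<sigma> $$ (k, j))"
    using mat_mult_entry[OF assms(1) permmat_carrier assms(3,4)] .
  also have "\<dots> = (\<Sum>k<n. if k = \<sigma> j then X $$ (i, k) else 0)"
    by (rule sum.cong) (use assms in \<open>auto simp: permmat_def\<close>)
  finally show ?thesis using s by simp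
qed

lemma permmat_mult:
  assumes "X \<in> carrier_mat n m" "\<sigma> permutes {..<n}" "i < n" "j < m"
  shows "(permmat n \<sigma> * X) $$ (\<sigma> i, j) = X $$ (i, j)"
proof -
  have s: "\<sigma> i < n" using permutes_in_image[OF assms(2), of i] assms(3) by simp
  have "(permmat n \<sigma> * X) $$ (\<sigma> i, j) = (\<Sum>k<n. permmat n \<sigma> $$ (\<sigma> i, k) * X $$ (k, j))"
    using mat_mult_entry[OF permmat_carrier assms(1) s assms(4)] .
  also have "\<dots> = (\<Sum>k<n. if k = i then X $$ (k, j) else 0)"
    by (rule sum.cong) (use assms s permutes_inj[OF assms(2)] in \<open>auto simp: permmat_def dest: injD\<close>)
  finally show ?thesis using assms by simp
qed

lemma permmat_GL:
  assumes "\<sigma> permutes {..<n}"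
  shows "permmat n \<sigma> \<in> carrier (GL n)"
proof (rule GL_memI[of _ _ "permmat n (iperm \<sigma>)"])
  show "permmat n \<sigma> * permmat n (iperm \<sigma>) = 1\<^sub>m n"
  proof (rule eq_matI)
    fix i j assume "i < dim_row (1\<^sub>m n)" "j < dim_col (1\<^sub>m n)"
    then have ij: "i < n" "j < n" by auto
    have s: "iperm \<sigma> j < n" using permutes_in_image[OF permutes_inv[OF assms], of j] ij by simp
    show "(permmat n \<sigma> * permmat n (iperm \<sigma>)) $$ (i, j) = 1\<^sub>m n $$ (i, j)"
      using mult_permmat[OF permmat_carrier permutes_inv[OF assms] ij, of \<sigma>] ij s permutes_inverses(1)[OF assms, of j]
      by (auto simp: permmat_def)
  qed (auto simp: permmat_def)
qed auto

lemma dmat_mult: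
  assumes "X \<in> carrier_mat n m" "i < n" "j < m"
  shows "(dmat n t * X) $$ (i, j) = t i * X $$ (i, j)"
proof -
  have "(dmat n t * X) $$ (i, j) = (\<Sum>k<n. dmat n t $$ (i, k) * X $$ (k, j))"
    using mat_mult_entry[OF dmat_carrier assms] .
  also have "\<dots> = (\<Sum>k<n. if k = i then t i * X $$ (k, j) else 0)"
    by (rule sum.cong) (use assms in \<open>auto simp: dmat_def\<close>)
  finally show ?thesis using assms by simp
qed

lemma mult_dmat:
  assumes "X \<in> carrier_mat m n" "i < m" "j < n"
  shows "(X * dmat n t) $$ (i, j) = X $$ (i, j) * t j"
proof -
  have "(X * dmat n t) $$ (i, j) = (\<Sum>k<n. X $$ (i, k) * dmat n t $$ (k, j))"
    using mat_mult_entry[OF assms(1) dmat_carrier assms(2,3)] .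
  also have "\<dots> = (\<Sum>k<n. if k = j then X $$ (i, k) * t j else 0)"
    by (rule sum.cong) (use assms in \<open>auto simp: dmat_def\<close>)
  finally show ?thesis using assms by simp
qed

lemma dmat_inverse:
  assumes "\<forall>i<n. t i \<noteq> 0"
  shows "dmat n t * dmat n (\<lambda>i. 1 / t i) = 1\<^sub>m n"
proof (rule eq_matI)
  fix i j assume "i < dim_row (1\<^sub>m n)" "j < dim_col (1\<^sub>m n)"
  then show "(dmat n t * dmat n (\<lambda>i. 1 / t i)) $$ (i, j) = 1\<^sub>m n $$ (i, j)"
    using assms dmat_mult[of "dmat n (\<lambda>i. 1 / t i)" n n i j t] by (auto simp: dmat_def)
qed (auto simp: dmat_def)

lemma dmat_pat:
  assumes "\<forall>i<n. t i \<noteq> 0" "reflp R"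
  shows "dmat n t \<in> pat R n"
  using GL_memI[OF dmat_carrier dmat_carrier dmat_inverse[OF assms(1)]] reflpD[OF assms(2)]
  by (auto simp: pat_def dmat_def)

lemma dmat_GL: "\<forall>i<n. t i \<noteq> 0 \<Longrightarrow> dmat n t \<in> carrier (GL n)"
  using GL_memI[OF dmat_carrier dmat_carrier dmat_inverse] by blast

lemma ginv_dmat:
  assumes "\<forall>i<n. t i \<noteq> 0"
  shows "ginv n (dmat n t) = dmat n (\<lambda>i. 1 / t i)"
proof (rule GL_inv_unique[OF dmat_GL[OF assms] dmat_carrier])
  have "dmat n (\<lambda>i. 1 / t i) * dmat n (\<lambda>i. 1 / (1 / t i)) = 1\<^sub>m n"
    using assms by (intro dmat_inverse) simp
  then show "dmat n (\<lambda>i. 1 / t i) * dmat n t = 1\<^sub>m n" by simp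
qed

text \<open>Conjugating by a permutation matrix permutes the total order that defines a Borel subgroup.\<close>

lemma permmat_conj:
  assumes s: "\<sigma> permutes {..<n}" and c: "c \<in> pat (\<lambda>i j. iperm \<sigma> i \<le> iperm \<sigma> j) n"
  shows "\<exists>b\<in>UT n. c * permmat n \<sigma> = permmat n \<sigma> * b"
proof -
  let ?w = "permmat n \<sigma>"
  have cG: "c \<in> carrier (GL n)" using c by (simp add: pat_def)
  have wG: "?w \<in> carrier (GL n)" using permmat_GL[OF s] .
  let ?b = "ginv n ?w * (c * ?w)"
  have bG: "?b \<in> carrier (GL n)" using cG wG by simp
  have eq: "c * ?w = ?w * ?b" using cG wG by simp
  have "?b $$ (i, j) = c $$ (\<sigma> i, \<sigma> j)" if ij: "i < n" "j < n" for i j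
  proof -
    have s': "\<sigma> i < n" using permutes_in_image[OF s, of i] ij by simp
    have "?b $$ (i, j) = (?w * ?b) $$ (\<sigma> i, j)"
      using permmat_mult[OF GL_mat[OF bG] s ij] by simp
    also have "\<dots> = (c * ?w) $$ (\<sigma> i, j)" using eq by simp
    also have "\<dots> = c $$ (\<sigma> i, \<sigma> j)" using mult_permmat[OF GL_mat[OF cG] s s' ij(2)] .
    finally show ?thesis .
  qed
  moreover have "\<sigma> i < n" if "i < n" for i using permutes_in_image[OF s, of i] that by simp
  moreover have "c $$ (\<sigma> i, \<sigma> j) = 0" if "i < n" "j < n" "\<not> i \<le> j" for i j
    using pat_D[OF c calculation(2)[OF that(1)] calculation(2)[OF that(2)]] that(3)
    by (simp add: permutes_inverses(2)[OF s])
  ultimately have "?b \<in> UT n" unfolding pat_def using bG by force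
  then show ?thesis using eq by blast
qed

lemma partial_perm_GL:
  assumes w: "partial_perm n n w" and G: "w \<in> carrier (GL n)"
  shows "\<exists>\<sigma>. \<sigma> permutes {..<n} \<and> w = permmat n \<sigma>"
proof -
  have ex: "\<exists>i<n. w $$ (i, j) \<noteq> 0" if j: "j < n" for j
  proof (rule ccontr)
    assume "\<not> (\<exists>i<n. w $$ (i, j) \<noteq> 0)"
    then have "(\<Sum>k<n. w $$ (i, k) * (if k = j then 1 else 0)) = 0" if "i < n" for i
      using that by (intro sum.neutral) auto
    then have "det w = 0" unfolding det_zero_iff_kernel[OF GL_mat[OF G]]
      using j by (intro exI[of _ "\<lambda>k. if k = j then 1 else 0"]) auto
    then show False using G by (simp add: GL_carrier_iff)
  qed
  define \<sigma> where "\<sigma> j = (if j < n then (SOME i. i < n \<and> w $$ (i, j) \<noteq> 0) else j)" for j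
  have \<sigma>: "\<sigma> j < n" "w $$ (\<sigma> j, j) \<noteq> 0" if "j < n" for j
    using someI_ex[OF ex[OF that]] that by (auto simp: \<sigma>_def)
  have cl: "w $$ (i, j) = 1 \<and> (\<forall>i'<n. i' \<noteq> i \<longrightarrow> w $$ (i', j) = 0) \<and> (\<forall>j'<n. j' \<noteq> j \<longrightarrow> w $$ (i, j') = 0)"
    if "i < n" "j < n" "w $$ (i, j) \<noteq> 0" for i j
    using w that unfolding partial_perm_def clean_col_def by blast
  have "inj_on \<sigma> {..<n}"
  proof (rule inj_onI)
    fix a b assume ab: "a \<in> {..<n}" "b \<in> {..<n}" "\<sigma> a = \<sigma> b"
    show "a = b"
    proof (rule ccontr)
      assume "a \<noteq> b"
      then have "w $$ (\<sigma> a, b) = 0" using cl[OF \<sigma>(1) _ \<sigma>(2), of a] ab by auto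
      then show False using \<sigma>(2)[of b] ab by simp
    qed
  qed
  moreover have "\<sigma> ` {..<n} \<subseteq> {..<n}" using \<sigma>(1) by auto
  ultimately have "bij_betw \<sigma> {..<n} {..<n}" by (simp add: bij_betw_def endo_inj_surj)
  then have p: "\<sigma> permutes {..<n}" by (intro bij_imp_permutes) (auto simp: \<sigma>_def)
  have "w = permmat n \<sigma>"
  proof (rule eq_matI)
    fix i j assume "i < dim_row (permmat n \<sigma>)" "j < dim_col (permmat n \<sigma>)"
    then have ij: "i < n" "j < n" by (auto simp: permmat_def)
    show "w $$ (i, j) = permmat n \<sigma> $$ (i, j)"
      using cl[OF \<sigma>(1)[OF ij(2)] ij(2) \<sigma>(2)[OF ij(2)]] ij by (auto simp: permmat_def)
  qed (use GL_mat[OF G] in \<open>auto simp: permmat_def\<close>)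
  then show ?thesis using p by blast
qed

text \<open>An invertible partial permutation matrix is a permutation matrix, so the elimination of a square
  invertible matrix is its Bruhat decomposition.\<close>

lemma bruhat:
  fixes r :: "nat \<Rightarrow> nat"
  assumes g: "g \<in> carrier (GL n)"
  shows "\<exists>a\<in>pat (\<lambda>i j. r i \<le> r j) n. \<exists>\<sigma>. \<sigma> permutes {..<n} \<and> (\<exists>b\<in>UT n. g = a * (permmat n \<sigma> * b))"
proof -
  obtain c2 c1 where c: "c2 \<in> pat (\<lambda>i j. r i \<le> r j) n" "c1 \<in> UT n" "partial_perm n n (c2 * g * c1)"
    using bruhat_rectangular[of g n n "\<lambda>i. i" r] GL_mat[OF g] by auto
  have G: "c2 \<in> carrier (GL n)" "c1 \<in> carrier (GL n)" using c by (auto simp: pat_def)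
  then obtain \<sigma> where s: "\<sigma> permutes {..<n}" "c2 * g * c1 = permmat n \<sigma>"
    using partial_perm_GL[OF c(3)] g by blast
  have "g = ginv n c2 * ((c2 * g * c1) * ginv n c1)" using G g by (simp add: GL_assoc[where n=n])
  then have "g = ginv n c2 * (permmat n \<sigma> * ginv n c1)" using s by simp
  moreover have "ginv n c2 \<in> pat (\<lambda>i j. r i \<le> r j) n" by (rule pat_inv) (use c in simp_all)
  moreover have "ginv n c1 \<in> UT n" by (rule pat_inv) (use c in simp_all)
  ultimately show ?thesis using s(1) by blast
qed

text \<open>The elements of the unipotent radical of the stabilizer of the second summand.\<close>

definition ub :: "nat \<Rightarrow> nat \<Rightarrow> complex mat \<Rightarrow> complex mat" where
  "ub p q Y = four_block_mat (1\<^sub>m p) (0\<^sub>m p q) Y (1\<^sub>m q)"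

lemma ub_GL: "Y \<in> carrier_mat q p \<Longrightarrow> ub p q Y \<in> carrier (GL (p + q))"
  unfolding GL_carrier_iff ub_def
  by (subst det_four_block_mat_upper_right_zero[of _ p _ q]) auto

lemma bd_ub:
  assumes "A \<in> carrier_mat p p" "D \<in> carrier_mat q q" "Y \<in> carrier_mat q p"
  shows "bd p q A D * ub p q Y = four_block_mat A (0\<^sub>m p q) (D * Y) D"
  unfolding ub_def using assms
  by (subst mult_four_block_mat[where ?nr1.0 = p and ?n1.0 = p and ?n2.0 = q and ?nr2.0 = q and ?nc1.0 = p and ?nc2.0 = q]) auto

lemma ub_bd:
  assumes "A \<in> carrier_mat p p" "D \<in> carrier_mat q q" "Y \<in> carrier_mat q p"
  shows "ub p q Y * bd p q A D = four_block_mat A (0\<^sub>m p q) (Y * A) D"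
  unfolding ub_def using assms
  by (subst mult_four_block_mat[where ?nr1.0 = p and ?n1.0 = p and ?n2.0 = q and ?nr2.0 = q and ?nc1.0 = p and ?nc2.0 = q]) auto

lemma bd_pat:
  assumes "c1 \<in> pat (\<lambda>i j. r i \<le> (r j :: nat)) p" "c2 \<in> pat (\<lambda>i j. r (p + i) \<le> r (p + j)) q"
  shows "bd p q c1 c2 \<in> pat (\<lambda>i j. r i \<le> r j) (p + q)"
proof -
  have G: "c1 \<in> carrier (GL p)" "c2 \<in> carrier (GL q)" using assms by (auto simp: pat_def)
  then have d: "dim_row c1 = p" "dim_col c1 = p" "dim_row c2 = q" "dim_col c2 = q"
    using GL_mat by blast+
  have "r i \<le> r j" if ij: "i < p + q" "j < p + q" "bd p q c1 c2 $$ (i, j) \<noteq> 0" for i j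
  proof (cases "i < p")
    case True
    then have "j < p" "c1 $$ (i, j) \<noteq> 0" using ij d by (auto split: if_splits)
    then show ?thesis using assms(1) True by (auto simp: pat_def)
  next
    case False
    then have "\<not> j < p" "c2 $$ (i - p, j - p) \<noteq> 0" using ij d by (auto split: if_splits)
    moreover have "i - p < q" "j - p < q" using False ij calculation(1) by auto
    ultimately have "r (p + (i - p)) \<le> r (p + (j - p))" using pat_D[OF assms(2)] by blast
    then show ?thesis using False \<open>\<not> j < p\<close> by simp
  qed
  then show ?thesis using bd_GL[OF G] by (simp add: pat_def)
qed

text \<open>Bruhat decomposition with respect to a Borel subgroup of the parabolic stabilizing the second
  summand: it factors through the two diagonal blocks and the unipotent radical.\<close>

lemma bruhat_block:
  assumes g: "g \<in> carrier (GL (p + q))"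
  shows "\<exists>A\<in>UT p. \<exists>D\<in>UT q. \<exists>Y\<in>carrier_mat q p. \<exists>\<sigma>. \<sigma> permutes {..<p + q} \<and>
    (\<exists>b\<in>UT (p + q). g = bd p q A D * (ub p q Y * permmat (p + q) \<sigma>) * b)"
proof -
  let ?n = "p + q"
  \<comment> \<open>The order that puts the second summand first: its triangular matrices are block lower triangular.\<close>
  define r where "r i = (if i < p then i + q else i - p)" for i
  obtain a \<sigma> b where a: "a \<in> pat (\<lambda>i j. r i \<le> r j) ?n" and s: "\<sigma> permutes {..<?n}" and b: "b \<in> UT ?n"
    and gab: "g = a * (permmat ?n \<sigma> * b)"
    using bruhat[OF g, of r] by blast
  have aG: "a \<in> carrier (GL ?n)" using a by (simp add: pat_def)
  have ac: "a \<in> carrier_mat ?n ?n" using GL_mat[OF aG] .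
  define A where "A = mat p p (\<lambda>(i, j). a $$ (i, j))"
  define C where "C = mat q p (\<lambda>(i, j). a $$ (i + p, j))"
  define D where "D = mat q q (\<lambda>(i, j). a $$ (i + p, j + p))"
  have ABCD: "a = four_block_mat A (0\<^sub>m p q) C D"
  proof (rule eq_matI)
    fix i j assume "i < dim_row (four_block_mat A (0\<^sub>m p q) C D)" "j < dim_col (four_block_mat A (0\<^sub>m p q) C D)"
    then have ij: "i < ?n" "j < ?n" by (auto simp: A_def D_def)
    have "a $$ (i, j) = 0" if "i < p" "\<not> j < p"
    proof -
      have "\<not> r i \<le> r j" using that ij by (auto simp: r_def)
      then show ?thesis using pat_D[OF a ij] by blast
    qed
    then show "a $$ (i, j) = four_block_mat A (0\<^sub>m p q) C D $$ (i, j)"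
      using ij by (auto simp: A_def C_def D_def)
  qed (use ac in \<open>auto simp: A_def D_def\<close>)
  have c: "A \<in> carrier_mat p p" "C \<in> carrier_mat q p" "D \<in> carrier_mat q q"
    by (auto simp: A_def C_def D_def)
  have "det a = det A * det D" unfolding ABCD
    by (rule det_four_block_mat_upper_right_zero) (use c in auto)
  then have G: "A \<in> carrier (GL p)" "D \<in> carrier (GL q)" using aG c by (auto simp: GL_carrier_iff)
  have rr: "i \<le> j" if "i < ?n" "j < ?n" "a $$ (i, j) \<noteq> 0" "(i < p) = (j < p)" for i j
  proof -
    have "r i \<le> r j" using a that by (auto simp: pat_def)
    then show ?thesis using that by (auto simp: r_def split: if_splits)
  qed
  have A: "A \<in> UT p" unfolding pat_def
  proof (intro CollectI conjI allI impI G(1))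
    fix i j assume "i < p" "j < p" "A $$ (i, j) \<noteq> 0"
    then show "i \<le> j" using rr[of i j] by (simp add: A_def)
  qed
  have D: "D \<in> UT q" unfolding pat_def
  proof (intro CollectI conjI allI impI G(2))
    fix i j assume "i < q" "j < q" "D $$ (i, j) \<noteq> 0"
    then show "i \<le> j" using rr[of "i + p" "j + p"] by (simp add: D_def)
  qed
  let ?Y = "ginv q D * C"
  have Dinv: "ginv q D \<in> carrier_mat q q" using G GL_mat by blast
  have Y: "?Y \<in> carrier_mat q p" using Dinv c by auto
  have "D * ?Y = C"
    using assoc_mult_mat[OF c(3) Dinv c(2)] G(2) c(2) by simp
  then have a_eq: "a = bd p q A D * ub p q ?Y" using bd_ub[OF c(1,3) Y] ABCD by simp
  have "g = bd p q A D * (ub p q ?Y * permmat ?n \<sigma>) * b"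
    unfolding gab a_eq using bd_GL[OF G] ub_GL[OF Y] permmat_GL[OF s] b
    by (simp add: GL_assoc[where n="?n"] pat_def)
  then show ?thesis using A D Y s b by blast
qed

text \<open>Block diagonal matrices that are triangular for the order induced by \<open>\<sigma>\<close> are absorbed by the upper
  triangular group after passing the permutation matrix; what remains of them are row and column
  operations on \<open>Y\<close>.\<close>

lemma conj_ub_perm:
  assumes s: "\<sigma> permutes {..<p + q}" and Y: "Y \<in> carrier_mat q p"
    and c1: "c1 \<in> pat (\<lambda>i j. iperm \<sigma> i \<le> iperm \<sigma> j) p"
    and c2: "c2 \<in> pat (\<lambda>i j. iperm \<sigma> (p + i) \<le> iperm \<sigma> (p + j)) q"
  shows "\<exists>b\<in>UT (p + q). ub p q Y * permmat (p + q) \<sigma>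
    = bd p q c1 (ginv q c2) * (ub p q (c2 * Y * c1) * permmat (p + q) \<sigma>) * b"
proof -
  let ?n = "p + q" and ?w = "permmat (p + q) \<sigma>" and ?c = "bd p q (ginv p c1) c2"
  have G: "c1 \<in> carrier (GL p)" "c2 \<in> carrier (GL q)" using c1 c2 by (auto simp: pat_def)
  have c1': "ginv p c1 \<in> pat (\<lambda>i j. iperm \<sigma> i \<le> iperm \<sigma> j) p" by (rule pat_inv) (use c1 in simp_all)
  obtain b where b: "b \<in> UT ?n" "?c * ?w = ?w * b"
    using permmat_conj[OF s bd_pat[OF c1' c2]] by blast
  have wG: "?w \<in> carrier (GL ?n)" using permmat_GL[OF s] .
  have cG: "?c \<in> carrier (GL ?n)" using G by auto
  have bG: "b \<in> carrier (GL ?n)" using b by (simp add: pat_def)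
  have Y': "c2 * Y * c1 \<in> carrier_mat q p" using GL_mat[OF G(1)] GL_mat[OF G(2)] Y by simp
  have c1m: "c1 \<in> carrier_mat p p" "ginv p c1 \<in> carrier_mat p p" using G GL_mat GL_inv_closed by blast+
  have c2m: "c2 \<in> carrier_mat q q" using G GL_mat by blast
  have "c2 * Y * c1 * ginv p c1 = c2 * Y"
    using assoc_mult_mat[of "c2 * Y" q p c1 p "ginv p c1" p] c1m c2m Y G by auto
  then have "?c * ub p q Y = ub p q (c2 * Y * c1) * ?c"
    using bd_ub[OF c1m(2) c2m Y] ub_bd[OF c1m(2) c2m Y'] by simp
  then have "?c * (ub p q Y * ?w) = ub p q (c2 * Y * c1) * ?w * b"
    using b(2) GL_assoc[OF cG ub_GL[OF Y] wG] GL_assoc[OF ub_GL[OF Y'] cG wG]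
      GL_assoc[OF ub_GL[OF Y'] wG bG] by simp
  moreover have "ub p q Y * ?w = ginv ?n ?c * (?c * (ub p q Y * ?w))"
    using cG ub_GL[OF Y] wG by simp
  moreover have "ginv ?n ?c = bd p q c1 (ginv q c2)" using G bd_inv[of "ginv p c1" p c2 q] by simp
  moreover have "bd p q c1 (ginv q c2) \<in> carrier (GL ?n)" using G by auto
  ultimately have "ub p q Y * ?w = bd p q c1 (ginv q c2) * (ub p q (c2 * Y * c1) * ?w) * b"
    using ub_GL[OF Y'] wG bG by (simp add: GL_assoc[where n="?n"])
  then show ?thesis using b(1) by blast
qed

text \<open>The representatives found in all cases with finitely many double cosets are built from matrices with
  entries \<open>0\<close> and \<open>1\<close> and from permutations.\<close>

definition zero_one :: "nat \<Rightarrow> nat \<Rightarrow> complex mat \<Rightarrow> bool" where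
  "zero_one q p Y \<longleftrightarrow> Y \<in> carrier_mat q p \<and> (\<forall>i<q. \<forall>j<p. Y $$ (i, j) \<in> {0, 1})"

lemma finite_zero_one: "finite {Y. zero_one q p Y}"
proof -
  have "{Y. zero_one q p Y} \<subseteq> (\<lambda>f. mat q p f) ` ({..<q} \<times> {..<p} \<rightarrow>\<^sub>E {0, 1})"
  proof
    fix Y assume "Y \<in> {Y. zero_one q p Y}"
    then have Y: "Y \<in> carrier_mat q p" "\<forall>i<q. \<forall>j<p. Y $$ (i, j) \<in> {0, 1}" by (auto simp: zero_one_def)
    let ?f = "restrict (\<lambda>ij. Y $$ ij) ({..<q} \<times> {..<p})"
    have "Y = mat q p ?f" by (rule eq_matI) (use Y(1) in auto)
    moreover have "?f \<in> {..<q} \<times> {..<p} \<rightarrow>\<^sub>E {0, 1}" using Y(2) by (auto simp: PiE_iff)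
    ultimately show "Y \<in> (\<lambda>f. mat q p f) ` ({..<q} \<times> {..<p} \<rightarrow>\<^sub>E {0, 1})" by blast
  qed
  then show ?thesis by (rule finite_subset) (intro finite_imageI finite_PiE; simp)
qed

definition unip_perms :: "nat \<Rightarrow> nat \<Rightarrow> complex mat set" where
  "unip_perms p q = (\<lambda>(Y, \<sigma>). ub p q Y * permmat (p + q) \<sigma>) ` ({Y. zero_one q p Y} \<times> {\<sigma>. \<sigma> permutes {..<p + q}})"

lemma finite_unip_perms: "finite (unip_perms p q)"
  unfolding unip_perms_def by (intro finite_imageI finite_cartesian_product finite_zero_one finite_permutations) simp

lemma unip_perms_GL: "unip_perms p q \<subseteq> carrier (GL (p + q))"
  unfolding unip_perms_def using ub_GL permmat_GL by (auto simp: zero_one_def)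

text \<open>After the Bruhat decomposition the triangular blocks \<open>A\<close>, \<open>D\<close> lie in \<open>H1\<close>, \<open>H2\<close> already, and row and
  column operations by elements of these groups may be used to normalize \<open>Y\<close>.\<close>

lemma finite_double_cosets_zero_one:
  assumes H1: "subgroup H1 (GL p)" "UT p \<subseteq> H1" and H2: "subgroup H2 (GL q)" "UT q \<subseteq> H2"
    and red: "\<And>\<sigma> Y. \<sigma> permutes {..<p + q} \<Longrightarrow> Y \<in> carrier_mat q p \<Longrightarrow>
      \<exists>c1\<in>H1 \<inter> pat (\<lambda>i j. iperm \<sigma> i \<le> iperm \<sigma> j) p.
      \<exists>c2\<in>H2 \<inter> pat (\<lambda>i j. iperm \<sigma> (p + i) \<le> iperm \<sigma> (p + j)) q. zero_one q p (c2 * Y * c1)"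
  shows "finite_double_cosets (p + q) (block_diag p q H1 H2) (UT (p + q))"
  unfolding finite_double_cosets_def
proof (intro exI[of _ "unip_perms p q"] conjI ballI finite_unip_perms unip_perms_GL)
  let ?n = "p + q"
  fix g assume g: "g \<in> carrier (GL ?n)"
  obtain A D Y \<sigma> b where A: "A \<in> UT p" and D: "D \<in> UT q" and Y: "Y \<in> carrier_mat q p"
    and s: "\<sigma> permutes {..<?n}" and b: "b \<in> UT ?n"
    and eq: "g = bd p q A D * (ub p q Y * permmat ?n \<sigma>) * b"
    using bruhat_block[OF g] by blast
  obtain c1 c2 where c1: "c1 \<in> H1" "c1 \<in> pat (\<lambda>i j. iperm \<sigma> i \<le> iperm \<sigma> j) p"
    and c2: "c2 \<in> H2" "c2 \<in> pat (\<lambda>i j. iperm \<sigma> (p + i) \<le> iperm \<sigma> (p + j)) q" and zo: "zero_one q p (c2 * Y * c1)"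
    using red[OF s Y] by blast
  let ?s = "ub p q (c2 * Y * c1) * permmat ?n \<sigma>"
  obtain b' where b': "b' \<in> UT ?n" "ub p q Y * permmat ?n \<sigma> = bd p q c1 (ginv q c2) * ?s * b'"
    using conj_ub_perm[OF s Y c1(2) c2(2)] by blast
  have sS: "?s \<in> unip_perms p q" unfolding unip_perms_def using zo s by auto
  then have sG: "?s \<in> carrier (GL ?n)" using unip_perms_GL by blast
  note H1' = subgroup_GL_D[OF H1(1)] and H2' = subgroup_GL_D[OF H2(1)]
  have bdin: "bd p q A D \<in> block_diag p q H1 H2" "bd p q c1 (ginv q c2) \<in> block_diag p q H1 H2"
    using A D H1(2) H2(2) c1 c2 H2'(4) by (auto intro!: block_diagI)
  have sub: "subgroup (block_diag p q H1 H2) (GL ?n)" using subgroup_block_diag H1 H2 by blast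
  note K = subgroup_GL_D[OF sub]
  have bG: "b \<in> carrier (GL ?n)" "b' \<in> carrier (GL ?n)" using b b' by (auto simp: pat_def)
  have "g = (bd p q A D * bd p q c1 (ginv q c2)) * ?s * (b' * b)"
    unfolding eq b'(2) using bdin K(1) sG bG by (simp add: GL_assoc[where n="?n"] subset_iff)
  then show "\<exists>h\<in>block_diag p q H1 H2. \<exists>s\<in>unip_perms p q. \<exists>b\<in>UT ?n. g = h * s * b"
    using K(3)[OF bdin] sS subgroup_GL_D(3)[OF subgroup_UT b'(1) b] by blast
qed

section \<open>The cases with finitely many orbits\<close>

subsection \<open>One-dimensional first summand\<close>

text \<open>Here \<open>Y\<close> is a single column, and the diagonal matrices in \<open>H2\<close> rescale its entries independently.\<close>

lemma finite_cosets_line: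
  assumes H2: "subgroup H2 (GL q)" "UT q \<subseteq> H2"
  shows "finite_double_cosets (1 + q) (block_diag 1 q (carrier (GL 1)) H2) (UT (1 + q))"
proof (rule finite_double_cosets_zero_one)
  show "subgroup (carrier (GL 1)) (GL 1)" using group.subgroup_self[OF group_GL] .
  show "UT 1 \<subseteq> carrier (GL 1)" using pat_GL .
  fix \<sigma> and Y :: "complex mat" assume s: "\<sigma> permutes {..<1 + q}" and Y: "Y \<in> carrier_mat q 1"
  define t where "t i = (if Y $$ (i, 0) = 0 then 1 else 1 / Y $$ (i, 0))" for i
  have t: "\<forall>i<q. t i \<noteq> 0" by (auto simp: t_def)
  have DY: "dmat q t * Y \<in> carrier_mat q 1" by (rule mult_carrier_mat[OF dmat_carrier Y])
  have "(dmat q t * Y * 1\<^sub>m 1) $$ (i, j) \<in> {0, 1}" if "i < q" "j < 1" for i j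
  proof -
    have "dmat q t * Y * 1\<^sub>m 1 = dmat q t * Y" by (rule right_mult_one_mat[OF DY])
    then show ?thesis using dmat_mult[OF Y that, of t] that by (auto simp: t_def)
  qed
  then have "zero_one q 1 (dmat q t * Y * 1\<^sub>m 1)" 
    unfolding zero_one_def using mult_carrier_mat[OF DY one_carrier_mat] by blast
  moreover have "1\<^sub>m 1 \<in> carrier (GL 1) \<inter> pat (\<lambda>i j. iperm \<sigma> i \<le> iperm \<sigma> j) 1"
    by (intro IntI pat_one) simp_all
  moreover have "dmat q t \<in> H2 \<inter> pat (\<lambda>i j. iperm \<sigma> (1 + i) \<le> iperm \<sigma> (1 + j)) q"
    using dmat_pat[OF t refl_trans_le(1)] H2(2) dmat_pat[OF t, of "\<lambda>i j. iperm \<sigma> (1 + i) \<le> iperm \<sigma> (1 + j)"]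
    by (auto simp: reflp_def)
  ultimately show "\<exists>c1\<in>carrier (GL 1) \<inter> pat (\<lambda>i j. iperm \<sigma> i \<le> iperm \<sigma> j) 1.
      \<exists>c2\<in>H2 \<inter> pat (\<lambda>i j. iperm \<sigma> (1 + i) \<le> iperm \<sigma> (1 + j)) q. zero_one q 1 (c2 * Y * c1)"
    by blast
qed (use H2 in auto)

subsection \<open>Two-dimensional first summand and a maximal parabolic\<close>

text \<open>The largest row of the set \<open>A\<close> with a nonzero entry in column \<open>a\<close> serves as the pivot, so that only
  rows of \<open>A\<close> below it in the order are changed.\<close>

lemma clear_block:
  fixes r :: "nat \<Rightarrow> nat"
  assumes Y: "Y \<in> carrier_mat q p" and a: "a < p"
  shows "\<exists>c\<in>pat (\<lambda>i j. r i \<le> r j \<and> (i = j \<or> (i \<in> A \<and> j \<in> A))) q. \<exists>s.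
    (\<forall>i<q. (c * Y) $$ (i, a) = (if i \<in> A then (if i = s \<and> (c * Y) $$ (i, a) \<noteq> 0 then 1 else 0) else Y $$ (i, a)))"
proof (cases "{i. i < q \<and> i \<in> A \<and> Y $$ (i, a) \<noteq> 0} = {}")
  case True
  have "1\<^sub>m q * Y = Y" using Y by simp
  moreover have "1\<^sub>m q \<in> pat (\<lambda>i j. r i \<le> r j \<and> (i = j \<or> (i \<in> A \<and> j \<in> A))) q"
    by (rule pat_one) (simp add: reflp_def)
  ultimately show ?thesis using True by (intro bexI[of _ "1\<^sub>m q"] exI[of _ q]) auto
next
  case False
  let ?I = "{i. i < q \<and> i \<in> A \<and> Y $$ (i, a) \<noteq> 0}"
  obtain s where s: "s \<in> ?I" "\<forall>k\<in>?I. r k \<le> r s"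
    using ex_maximal_key[of ?I r] False by auto
  define c where "c = colmat q s (\<lambda>k. if k = s then 1 / Y $$ (s, a)
    else if k \<in> A then - Y $$ (k, a) / Y $$ (s, a) else 0)"
  have c: "c \<in> pat (\<lambda>i j. r i \<le> r j \<and> (i = j \<or> (i \<in> A \<and> j \<in> A))) q"
    unfolding c_def by (rule colmat_pat) (use s in \<open>auto simp: reflp_def split: if_splits\<close>)
  have "(c * Y) $$ (i, a) = (if i \<in> A then (if i = s \<and> (c * Y) $$ (i, a) \<noteq> 0 then 1 else 0) else Y $$ (i, a))"
    if "i < q" for i
    unfolding c_def using colmat_mult[OF Y _ that a, of s] s that by auto
  then show ?thesis using c by blast
qed

lemma two_element_cases: "\<exists>a b. {a, b} = {0, 1 :: nat} \<and> a \<noteq> b \<and> r a \<le> (r b :: nat)"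
  by (cases "r 0 \<le> r 1") (force, metis insert_commute nat_le_linear zero_neq_one)

text \<open>Row operations that respect the two blocks of the maximal parabolic and the given total order
  leave at most one nonzero entry per block in the smaller column; adding a multiple of that column
  to the other one removes one of the two rows in which both columns could be nonzero, and then the
  remaining entries are independent under the diagonal torus.\<close>

lemma finite_cosets_plane:
  fixes m q :: nat
  defines "H2 \<equiv> pat (\<lambda>i j. j < m \<longrightarrow> i < m) q"
  shows "finite_double_cosets (2 + q) (block_diag 2 q (carrier (GL 2)) H2) (UT (2 + q))"
proof (rule finite_double_cosets_zero_one)
  show "subgroup (carrier (GL 2)) (GL 2)" using group.subgroup_self[OF group_GL] .
  show "UT 2 \<subseteq> carrier (GL 2)" using pat_GL .
  show H2sub: "subgroup H2 (GL q)" unfolding H2_def by (rule subgroup_pat) (auto simp: reflp_def transp_def)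
  show "UT q \<subseteq> H2" unfolding H2_def by (rule pat_mono) auto
  fix \<sigma> and Y :: "complex mat" assume s: "\<sigma> permutes {..<2 + q}" and Y: "Y \<in> carrier_mat q 2"
  define r where "r i = iperm \<sigma> (2 + i)" for i
  obtain a b where ab: "{a, b} = {0, 1 :: nat}" "a \<noteq> b" "iperm \<sigma> a \<le> iperm \<sigma> b"
    using two_element_cases by blast
  then have ab2: "a < 2" "b < 2" and ab_cases: "\<And>j. j < 2 \<Longrightarrow> j = a \<or> j = b"
    by (auto simp: doubleton_eq_iff)
  let ?P1 = "pat (\<lambda>i j. iperm \<sigma> i \<le> iperm \<sigma> j) 2" and ?P2 = "pat (\<lambda>i j. r i \<le> r j) q"
  obtain c s1 where c: "c \<in> pat (\<lambda>i j. r i \<le> r j \<and> (i = j \<or> (i \<in> {..<m} \<and> j \<in> {..<m}))) q"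
    and cY: "\<forall>i<q. (c * Y) $$ (i, a) = (if i \<in> {..<m} then (if i = s1 \<and> (c * Y) $$ (i, a) \<noteq> 0 then 1 else 0) else Y $$ (i, a))"
    using clear_block[OF Y ab2(1)] by blast
  have cG: "c \<in> carrier (GL q)" using c by (simp add: pat_def)
  have cYc: "c * Y \<in> carrier_mat q 2" using Y GL_mat[OF cG] by simp
  obtain d s2 where d: "d \<in> pat (\<lambda>i j. r i \<le> r j \<and> (i = j \<or> (i \<in> {m..} \<and> j \<in> {m..}))) q"
    and dY: "\<forall>i<q. (d * (c * Y)) $$ (i, a) = (if i \<in> {m..} then (if i = s2 \<and> (d * (c * Y)) $$ (i, a) \<noteq> 0 then 1 else 0) else (c * Y) $$ (i, a))"
    using clear_block[OF cYc ab2(1)] by blast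
  have dG: "d \<in> carrier (GL q)" using d by (simp add: pat_def)
  define Z where "Z = d * (c * Y)"
  have Zc: "Z \<in> carrier_mat q 2" unfolding Z_def using cYc GL_mat[OF dG] by simp
  have Za: "Z $$ (i, a) \<in> {0, 1}" "Z $$ (i, a) \<noteq> 0 \<Longrightarrow> i = s1 \<or> i = s2" if "i < q" for i
    using cY[rule_format, OF that] dY[rule_format, OF that] unfolding Z_def by (auto split: if_splits)
  have cd: "c \<in> H2 \<inter> ?P2" "d \<in> H2 \<inter> ?P2"
  proof -
    have P2: "pat (\<lambda>i j. r i \<le> r j \<and> (i = j \<or> (i \<in> A \<and> j \<in> A))) q \<subseteq> ?P2" for A
      by (rule pat_mono) blast
    have "pat (\<lambda>i j. r i \<le> r j \<and> (i = j \<or> (i \<in> {..<m} \<and> j \<in> {..<m}))) q \<subseteq> H2"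
      "pat (\<lambda>i j. r i \<le> r j \<and> (i = j \<or> (i \<in> {m..} \<and> j \<in> {m..}))) q \<subseteq> H2"
      unfolding H2_def by (rule pat_mono; auto)+
    then show "c \<in> H2 \<inter> ?P2" "d \<in> H2 \<inter> ?P2" using P2 c d by blast+
  qed
  \<comment> \<open>Column \<open>a\<close> of \<open>Z\<close> vanishes outside the two rows \<open>s1\<close>, \<open>s2\<close>. Subtracting \<open>x\<close> times this column
    from column \<open>b\<close>, where \<open>x\<close> is the entry in row \<open>e\<close>, clears column \<open>b\<close> in row \<open>e\<close>; so the other
    of the two rows, \<open>e'\<close>, is the only one in which both columns can still be nonzero.\<close>
  define e where "e = (if s2 < q \<and> Z $$ (s2, a) \<noteq> 0 then s2 else s1)"
  define x where "x = (if e < q \<and> Z $$ (e, a) \<noteq> 0 then Z $$ (e, b) else 0)"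
  define e' where "e' = (if e = s2 then s1 else s2)"
  define c1 where "c1 = rowmat 2 a (\<lambda>l. if l = a then 1 else - x)"
  have c1: "c1 \<in> ?P1" unfolding c1_def
  proof (rule rowmat_pat[OF ab2(1)])
    fix j assume "j < (2 :: nat)"
    then show "iperm \<sigma> a \<le> iperm \<sigma> j" using ab_cases ab(3) by blast
  qed auto
  have c1G: "c1 \<in> carrier (GL 2)" using c1 by (simp add: pat_def)
  define W where "W = Z * c1"
  have Wc: "W \<in> carrier_mat q 2" unfolding W_def using Zc GL_mat[OF c1G] by simp
  have W: "W $$ (i, a) = Z $$ (i, a)" "W $$ (i, b) = Z $$ (i, b) - x * Z $$ (i, a)" if "i < q" for i
    unfolding W_def c1_def using mult_rowmat[OF Zc ab2(1) that ab2(1)] mult_rowmat[OF Zc ab2(1) that ab2(2)] ab(2)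
    by auto
  have We: "W $$ (i, b) = 0" if "i < q" "Z $$ (i, a) \<noteq> 0" "i \<noteq> e'" for i
  proof -
    have "i = e" using Za(2)[OF that(1,2)] that by (auto simp: e_def e'_def split: if_splits)
    then show ?thesis using W(2)[OF that(1)] Za(1)[OF that(1)] that by (simp add: x_def)
  qed
  \<comment> \<open>The scaling \<open>y\<close> of column \<open>b\<close> normalizes its entry in row \<open>e'\<close>, and the scaling \<open>t2\<close> of the rows
    in which column \<open>a\<close> is zero normalizes the other entries of column \<open>b\<close>.\<close>
  define y where "y = (if e' < q \<and> W $$ (e', b) \<noteq> 0 then 1 / W $$ (e', b) else 1)"
  have y0: "y \<noteq> 0" by (simp add: y_def)
  define t1 where "t1 l = (if l = b then y else 1)" for l
  define t2 where "t2 i = (if Z $$ (i, a) \<noteq> 0 \<or> W $$ (i, b) = 0 then 1 else 1 / (W $$ (i, b) * y))" for i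
  have t1: "\<forall>l<2. t1 l \<noteq> 0" and t2: "\<forall>i<q. t2 i \<noteq> 0" using y0 by (auto simp: t1_def t2_def)
  have V: "(dmat q t2 * (W * dmat 2 t1)) $$ (i, j) \<in> {0, 1}" if ij: "i < q" "j < 2" for i j
  proof -
    have WD: "W * dmat 2 t1 \<in> carrier_mat q 2" using Wc by auto
    have e: "(dmat q t2 * (W * dmat 2 t1)) $$ (i, j) = t2 i * (W $$ (i, j) * t1 j)"
      using dmat_mult[OF WD ij] mult_dmat[OF Wc ij] by simp
    show ?thesis
    proof (cases "j = a")
      case True
      then show ?thesis using e W(1)[OF ij(1)] Za(1)[OF ij(1)] ab(2) by (auto simp: t1_def t2_def)
    next
      case False
      then have jb: "j = b" using ab_cases ij by blast
      show ?thesis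
      proof (cases "Z $$ (i, a) \<noteq> 0")
        case True
        show ?thesis
        proof (cases "i = e'")
          case True
          then show ?thesis using e jb \<open>Z $$ (i, a) \<noteq> 0\<close> ij by (auto simp: t1_def t2_def y_def)
        next
          case False
          then show ?thesis using e jb We[OF ij(1) True] by simp
        qed
      next
        case False
        then show ?thesis using e jb y0 by (auto simp: t1_def t2_def)
      qed
    qed
  qed
  let ?c1 = "c1 * dmat 2 t1" and ?c2 = "dmat q t2 * (d * c)"
  have dG': "dmat q t2 \<in> carrier_mat q q" "dmat 2 t1 \<in> carrier_mat 2 2" by auto
  have "?c2 * Y * ?c1 = dmat q t2 * (W * dmat 2 t1)"
  proof -
    have dm: "d \<in> carrier_mat q q" "c \<in> carrier_mat q q" "c1 \<in> carrier_mat 2 2"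
      using GL_mat dG cG c1G by blast+
    have "?c2 * Y = dmat q t2 * Z"
      unfolding Z_def using assoc_mult_mat[of "dmat q t2" q q "d * c" q Y 2] assoc_mult_mat[OF dm(1,2) Y] dm Y
      by simp
    moreover have "dmat q t2 * Z * ?c1 = dmat q t2 * (Z * ?c1)"
      by (rule assoc_mult_mat[OF dG'(1) Zc]) (use dm in auto)
    moreover have "Z * ?c1 = W * dmat 2 t1" unfolding W_def using assoc_mult_mat[OF Zc dm(3) dG'(2)] by simp
    ultimately show ?thesis by simp
  qed
  then have zo: "zero_one q 2 (?c2 * Y * ?c1)" 
    unfolding zero_one_def using V mult_carrier_mat[OF dG'(1) mult_carrier_mat[OF Wc dG'(2)]] by simp
  have c1in: "?c1 \<in> carrier (GL 2) \<inter> ?P1"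
  proof (intro IntI)
    have "dmat 2 t1 \<in> ?P1" by (rule dmat_pat[OF t1]) simp
    then show "?c1 \<in> ?P1" by (intro pat_mult[OF _ c1]) simp_all
    then show "?c1 \<in> carrier (GL 2)" by (simp add: pat_def)
  qed
  have c2in: "?c2 \<in> H2 \<inter> ?P2"
  proof (intro IntI)
    have "dmat q t2 \<in> H2" unfolding H2_def by (rule dmat_pat[OF t2]) (simp add: reflp_def)
    then show "?c2 \<in> H2" using cd subgroup_GL_D(3)[OF H2sub] by blast
    have "dmat q t2 \<in> ?P2" by (rule dmat_pat[OF t2]) simp
    moreover have "d * c \<in> ?P2" by (rule pat_mult) (use cd in simp_all)
    ultimately show "?c2 \<in> ?P2" by (rule pat_mult[rotated]) simp_all
  qed
  show "\<exists>c1\<in>carrier (GL 2) \<inter> pat (\<lambda>i j. iperm \<sigma> i \<le> iperm \<sigma> j) 2.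
      \<exists>c2\<in>H2 \<inter> pat (\<lambda>i j. iperm \<sigma> (2 + i) \<le> iperm \<sigma> (2 + j)) q. zero_one q 2 (c2 * Y * c1)"
    by (rule bexI[of _ ?c1], rule bexI[of _ ?c2], rule zo, rule c2in[unfolded r_def], rule c1in)
qed

subsection \<open>Mirabolic subgroups\<close>

text \<open>Finitely many orbits of the diagonal torus on the quotient of \<open>GL q\<close> by \<open>H\<close>.\<close>

definition torus_finite :: "nat \<Rightarrow> complex mat set \<Rightarrow> bool" where
  "torus_finite q H \<longleftrightarrow> (\<exists>S. finite S \<and> S \<subseteq> carrier (GL q) \<and>
    (\<forall>k\<in>carrier (GL q). \<exists>m\<in>H. \<exists>s\<in>S. \<exists>t. (\<forall>i<q. t i \<noteq> 0) \<and> k = m * s * dmat q t))"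

lemma torus_finite_conj:
  assumes f: "torus_finite q H" and H: "H \<subseteq> carrier (GL q)" and x: "x \<in> carrier (GL q)"
  shows "torus_finite q (conj_set q x H)"
proof -
  obtain S where S: "finite S" "S \<subseteq> carrier (GL q)"
    and *: "\<forall>k\<in>carrier (GL q). \<exists>m\<in>H. \<exists>s\<in>S. \<exists>t. (\<forall>i<q. t i \<noteq> 0) \<and> k = m * s * dmat q t"
    using f unfolding torus_finite_def by blast
  have "\<exists>m\<in>conj_set q x H. \<exists>s\<in>(*) x ` S. \<exists>t. (\<forall>i<q. t i \<noteq> 0) \<and> k = m * s * dmat q t"
    if k: "k \<in> carrier (GL q)" for k
  proof -
    have "ginv q x * k \<in> carrier (GL q)" using x k by auto
    then obtain m s t where mst: "m \<in> H" "s \<in> S" "\<forall>i<q. t i \<noteq> 0" "ginv q x * k = m * s * dmat q t"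
      using * by blast
    have G: "m \<in> carrier (GL q)" "s \<in> carrier (GL q)" "dmat q t \<in> carrier (GL q)"
      using mst H S dmat_GL by auto
    have "k = x * (ginv q x * k)" using x k by simp
    also have "\<dots> = (x * m * ginv q x) * (x * s) * dmat q t"
      unfolding mst(4) using G x by (simp add: GL_assoc[where n=q])
    finally show ?thesis using mst by (auto simp: conj_set_def)
  qed
  then show ?thesis unfolding torus_finite_def using S x
    by (intro exI[of _ "(*) x ` S"]) auto
qed

lemma torus_finite_GL: "torus_finite q (carrier (GL q))"
  unfolding torus_finite_def
proof (intro exI[of _ "{1\<^sub>m q}"] conjI ballI)
  fix k assume k: "k \<in> carrier (GL q)"
  have "dmat q (\<lambda>_. 1) = 1\<^sub>m q" by (rule eq_matI) (auto simp: dmat_def)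
  then show "\<exists>m\<in>carrier (GL q). \<exists>s\<in>{1\<^sub>m q}. \<exists>t. (\<forall>i<q. t i \<noteq> 0) \<and> k = m * s * dmat q t"
    using k by (intro bexI[of _ k] bexI[of _ "1\<^sub>m q"] exI[of _ "\<lambda>_. 1"]) auto
qed auto

text \<open>The map \<open>\<phi>\<close> is an invariant separating the cosets of \<open>H\<close>; it is enough that the torus can move its
  values into a finite set.\<close>

lemma torus_finite_criterion:
  assumes H: "subgroup H (GL q)" and f: "finite (F :: (nat \<Rightarrow> complex) set)"
    and inv: "\<And>k s. k \<in> carrier (GL q) \<Longrightarrow> s \<in> carrier (GL q) \<Longrightarrow> \<phi> k = \<phi> s \<Longrightarrow> k * ginv q s \<in> H"
    and red: "\<And>k. k \<in> carrier (GL q) \<Longrightarrow> \<exists>t. (\<forall>i<q. t i \<noteq> 0) \<and> \<phi> (k * dmat q t) \<in> F"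
  shows "torus_finite q H"
proof -
  define rep where "rep v = (SOME s. s \<in> carrier (GL q) \<and> \<phi> s = v)" for v
  have rep: "rep (\<phi> k) \<in> carrier (GL q)" "\<phi> (rep (\<phi> k)) = \<phi> k" if "k \<in> carrier (GL q)" for k
    unfolding rep_def by (rule someI2[of _ k]; use that in simp)+
  let ?S = "rep ` (F \<inter> \<phi> ` carrier (GL q))"
  have "\<exists>m\<in>H. \<exists>s\<in>?S. \<exists>t. (\<forall>i<q. t i \<noteq> 0) \<and> k = m * s * dmat q t" if k: "k \<in> carrier (GL q)" for k
  proof -
    obtain t where t: "\<forall>i<q. t i \<noteq> 0" "\<phi> (k * dmat q t) \<in> F" using red[OF k] by blast
    let ?k = "k * dmat q t" and ?t = "\<lambda>i. 1 / t i"
    have tG: "dmat q t \<in> carrier (GL q)" using dmat_GL[OF t(1)] .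
    have kG: "?k \<in> carrier (GL q)" using k tG by simp
    let ?s = "rep (\<phi> ?k)"
    have sG: "?s \<in> carrier (GL q)" using rep(1)[OF kG] .
    have m: "?k * ginv q ?s \<in> H" using inv[OF kG sG] rep(2)[OF kG] by simp
    have "k = (?k * ginv q ?s) * ?s * ginv q (dmat q t)"
      using kG sG k tG by (simp add: GL_assoc[where n=q])
    then have "k = (?k * ginv q ?s) * ?s * dmat q ?t" using ginv_dmat[OF t(1)] by simp
    moreover have "\<forall>i<q. ?t i \<noteq> 0" using t(1) by simp
    moreover have "?s \<in> ?S" by (rule imageI) (use t(2) kG in blast)
    ultimately show ?thesis using m
      by (intro bexI[of _ "?k * ginv q ?s"] bexI[of _ ?s] exI[of _ ?t] conjI)
  qed
  moreover have "?S \<subseteq> carrier (GL q)" using rep(1) by blast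
  ultimately show ?thesis unfolding torus_finite_def using f by (intro exI[of _ ?S]) simp
qed

lemma finite_zero_one_functions: "finite {v :: nat \<Rightarrow> complex. \<forall>i. (i < q \<longrightarrow> v i \<in> {0, 1}) \<and> (\<not> i < q \<longrightarrow> v i = 0)}"
proof -
  have "{v :: nat \<Rightarrow> complex. \<forall>i. (i < q \<longrightarrow> v i \<in> {0, 1}) \<and> (\<not> i < q \<longrightarrow> v i = 0)}
    \<subseteq> {v. \<forall>i. (i \<in> {..<q} \<longrightarrow> v i \<in> {0, 1}) \<and> (i \<notin> {..<q} \<longrightarrow> v i = 0)}" by auto
  then show ?thesis using finite_set_of_finite_funs[of "{..<q}" "{0, 1}" 0] finite_subset by blast
qed

text \<open>The coset of \<open>k\<close> modulo the stabilizer of the hyperplane spanned by the first \<open>q - 1\<close> unit vectors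
  is determined by the last row of \<open>k\<close>, which is the linear form defining the inverse image of the
  hyperplane. The torus rescales its entries to \<open>0\<close> and \<open>1\<close>.\<close>

lemma torus_finite_hyperplane:
  assumes q: "q \<ge> 1"
  shows "torus_finite q (pat (\<lambda>i j. j < q - 1 \<longrightarrow> i < q - 1) q)"
proof (rule torus_finite_criterion[where \<phi> = "\<lambda>k i. if i < q then k $$ (q - 1, i) else 0",
      OF _ finite_zero_one_functions[of q]])
  show "subgroup (pat (\<lambda>i j. j < q - 1 \<longrightarrow> i < q - 1) q) (GL q)"
    by (rule subgroup_pat) (auto simp: reflp_def transp_def)
next
  fix k s assume k: "k \<in> carrier (GL q)" and s: "s \<in> carrier (GL q)"
    and eq: "(\<lambda>i. if i < q then k $$ (q - 1, i) else 0) = (\<lambda>i. if i < q then s $$ (q - 1, i) else 0)"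
  have row: "k $$ (q - 1, i) = s $$ (q - 1, i)" if "i < q" for i using fun_cong[OF eq, of i] that by simp
  have "(k * ginv q s) $$ (q - 1, j) = 1\<^sub>m q $$ (q - 1, j)" if j: "j < q" for j
  proof -
    have "(k * ginv q s) $$ (q - 1, j) = (\<Sum>l<q. k $$ (q - 1, l) * ginv q s $$ (l, j))"
      using GL_mult_entry[OF k _ _ j] s q by simp
    also have "\<dots> = (\<Sum>l<q. s $$ (q - 1, l) * ginv q s $$ (l, j))" using row by simp
    also have "\<dots> = (s * ginv q s) $$ (q - 1, j)"
      by (rule GL_mult_entry[symmetric]) (use s q j in auto)
    finally show ?thesis using s by simp
  qed
  then have z: "(k * ginv q s) $$ (q - 1, j) = 0" if "j < q - 1" for j using that by simp
  show "k * ginv q s \<in> pat (\<lambda>i j. j < q - 1 \<longrightarrow> i < q - 1) q"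
    unfolding pat_def
  proof (intro CollectI conjI allI impI)
    fix i j assume a: "i < q" "j < q" "(k * ginv q s) $$ (i, j) \<noteq> 0" "j < q - 1"
    then have "i \<noteq> q - 1" using z by auto
    then show "i < q - 1" using a by simp
  qed (use k s in simp)
next
  fix k assume k: "k \<in> carrier (GL q)"
  define t where "t i = (if k $$ (q - 1, i) = 0 then 1 else 1 / k $$ (q - 1, i))" for i
  have "(k * dmat q t) $$ (q - 1, i) \<in> {0, 1}" if "i < q" for i
    using mult_dmat[OF GL_mat[OF k] _ that, of "q - 1" t] q by (auto simp: t_def)
  then show "\<exists>t. (\<forall>i<q. t i \<noteq> 0) \<and> (\<lambda>i. if i < q then (k * dmat q t) $$ (q - 1, i) else 0)
      \<in> {v. \<forall>i. (i < q \<longrightarrow> v i \<in> {0, 1}) \<and> (\<not> i < q \<longrightarrow> v i = 0)}"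
    by (intro exI[of _ t]) (auto simp: t_def)
qed

text \<open>The dual argument: the first column of the inverse of \<open>k\<close> spans the inverse image of the line, and
  determines the coset of \<open>k\<close>.\<close>

lemma torus_finite_line:
  assumes q: "q \<ge> 1"
  shows "torus_finite q (pat (\<lambda>i j. j < 1 \<longrightarrow> i < 1) q)"
proof (rule torus_finite_criterion[where \<phi> = "\<lambda>k i. if i < q then ginv q k $$ (i, 0) else 0",
      OF _ finite_zero_one_functions[of q]])
  show sub: "subgroup (pat (\<lambda>i j. j < 1 \<longrightarrow> i < 1) q) (GL q)"
    by (rule subgroup_pat) (auto simp: reflp_def transp_def)
  fix k s assume k: "k \<in> carrier (GL q)" and s: "s \<in> carrier (GL q)"
    and eq: "(\<lambda>i. if i < q then ginv q k $$ (i, 0) else 0) = (\<lambda>i. if i < q then ginv q s $$ (i, 0) else 0)"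
  have col: "ginv q k $$ (i, 0) = ginv q s $$ (i, 0)" if "i < q" for i using fun_cong[OF eq, of i] that by simp
  have "(k * ginv q s) $$ (i, 0) = 1\<^sub>m q $$ (i, 0)" if i: "i < q" for i
  proof -
    have "(k * ginv q s) $$ (i, 0) = (\<Sum>l<q. k $$ (i, l) * ginv q s $$ (l, 0))"
      using GL_mult_entry[OF k _ i] s q by simp
    also have "\<dots> = (\<Sum>l<q. k $$ (i, l) * ginv q k $$ (l, 0))" using col by simp
    also have "\<dots> = (k * ginv q k) $$ (i, 0)"
      by (rule GL_mult_entry[symmetric]) (use k q i in auto)
    finally show ?thesis using k by simp
  qed
  then have z: "(k * ginv q s) $$ (i, 0) = 0" if "0 < i" "i < q" for i using that by simp
  show "k * ginv q s \<in> pat (\<lambda>i j. j < 1 \<longrightarrow> i < 1) q"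
    unfolding pat_def using z k s by (auto intro: gr0I)
next
  fix k assume k: "k \<in> carrier (GL q)"
  define u where "u i = (if ginv q k $$ (i, 0) = 0 then 1 else 1 / ginv q k $$ (i, 0))" for i
  define t where "t i = 1 / u i" for i
  have u: "\<forall>i<q. u i \<noteq> 0" and t: "\<forall>i<q. t i \<noteq> 0" by (auto simp: u_def t_def)
  have "(\<lambda>i. 1 / t i) = u" by (simp add: t_def fun_eq_iff)
  then have "ginv q (dmat q t) = dmat q u" using ginv_dmat[OF t] by simp
  then have "ginv q (k * dmat q t) = dmat q u * ginv q k" using k dmat_GL[OF t] by simp
  then have "ginv q (k * dmat q t) $$ (i, 0) \<in> {0, 1}" if "i < q" for i
    using dmat_mult[of "ginv q k" q q i 0 u] GL_mat[OF GL_inv_closed[OF k]] that q by (auto simp: u_def)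
  then show "\<exists>t. (\<forall>i<q. t i \<noteq> 0) \<and> (\<lambda>i. if i < q then ginv q (k * dmat q t) $$ (i, 0) else 0)
      \<in> {v. \<forall>i. (i < q \<longrightarrow> v i \<in> {0, 1}) \<and> (\<not> i < q \<longrightarrow> v i = 0)}"
    using t by (intro exI[of _ t]) auto
qed

text \<open>A partial permutation matrix matches some rows with some columns. Scalings of the rows are balanced
  by the same scalings of the matched columns, and the other columns are zero.\<close>

lemma torus_transfer_left:
  assumes Y: "partial_perm q p Y" and t: "\<forall>i<q. t i \<noteq> 0"
  shows "\<exists>t1. (\<forall>j<p. t1 j \<noteq> 0) \<and> dmat q t * Y = Y * dmat p t1"
proof -
  have Yc: "Y \<in> carrier_mat q p" using Y by (simp add: partial_perm_def)
  define t1 where "t1 j = (if \<exists>i<q. Y $$ (i, j) \<noteq> 0 then t (SOME i. i < q \<and> Y $$ (i, j) \<noteq> 0) else 1)" for j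
  have t1: "t1 j = t i" if ij: "i < q" "j < p" "Y $$ (i, j) \<noteq> 0" for i j
  proof -
    have "(SOME i. i < q \<and> Y $$ (i, j) \<noteq> 0) = i"
    proof (rule some_equality)
      fix k assume "k < q \<and> Y $$ (k, j) \<noteq> 0"
      then show "k = i" using Y ij unfolding partial_perm_def clean_col_def by blast
    qed (use ij in simp)
    then show ?thesis using ij by (auto simp: t1_def)
  qed
  have "t1 j \<noteq> 0" if "j < p" for j
    using t1[OF _ that] t by (cases "\<exists>i<q. Y $$ (i, j) \<noteq> 0") (auto simp: t1_def)
  moreover have "dmat q t * Y = Y * dmat p t1"
  proof (rule eq_matI)
    fix i j assume "i < dim_row (Y * dmat p t1)" "j < dim_col (Y * dmat p t1)"
    then have ij: "i < q" "j < p" using Yc by (auto simp: dmat_def)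
    show "(dmat q t * Y) $$ (i, j) = (Y * dmat p t1) $$ (i, j)"
      unfolding dmat_mult[OF Yc ij] mult_dmat[OF Yc ij] using t1[OF ij] by (cases "Y $$ (i, j) = 0") auto
  qed (use Yc in \<open>auto simp: dmat_def\<close>)
  ultimately show ?thesis by blast
qed

lemma torus_transfer_right:
  assumes Y: "partial_perm q p Y" and t: "\<forall>j<p. t j \<noteq> 0"
  shows "\<exists>t2. (\<forall>i<q. t2 i \<noteq> 0) \<and> dmat q t2 * Y = Y * dmat p t"
proof -
  have Yc: "Y \<in> carrier_mat q p" using Y by (simp add: partial_perm_def)
  define t2 where "t2 i = (if \<exists>j<p. Y $$ (i, j) \<noteq> 0 then t (SOME j. j < p \<and> Y $$ (i, j) \<noteq> 0) else 1)" for i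
  have t2: "t2 i = t j" if ij: "i < q" "j < p" "Y $$ (i, j) \<noteq> 0" for i j
  proof -
    have "(SOME j. j < p \<and> Y $$ (i, j) \<noteq> 0) = j"
    proof (rule some_equality)
      fix k assume "k < p \<and> Y $$ (i, k) \<noteq> 0"
      then show "k = j" using Y ij unfolding partial_perm_def clean_col_def by blast
    qed (use ij in simp)
    then show ?thesis using ij by (auto simp: t2_def)
  qed
  have "t2 i \<noteq> 0" if "i < q" for i
    using t2[OF that] t by (cases "\<exists>j<p. Y $$ (i, j) \<noteq> 0") (auto simp: t2_def)
  moreover have "dmat q t2 * Y = Y * dmat p t"
  proof (rule eq_matI)
    fix i j assume "i < dim_row (Y * dmat p t)" "j < dim_col (Y * dmat p t)"
    then have ij: "i < q" "j < p" using Yc by (auto simp: dmat_def)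
    show "(dmat q t2 * Y) $$ (i, j) = (Y * dmat p t) $$ (i, j)"
      unfolding dmat_mult[OF Yc ij] mult_dmat[OF Yc ij] using t2[OF ij] by (cases "Y $$ (i, j) = 0") auto
  qed (use Yc in \<open>auto simp: dmat_def\<close>)
  ultimately show ?thesis by blast
qed

text \<open>With all of \<open>K\<close> available the rectangular Bruhat decomposition applies to \<open>Y\<close>; the resulting
  representatives are the clans that parametrize the \<open>K\<close>-orbits on the flag variety.\<close>

lemma K_normal_form:
  assumes g: "g \<in> carrier (GL (p + q))"
  shows "\<exists>k1\<in>carrier (GL p). \<exists>k2\<in>carrier (GL q). \<exists>Y \<sigma>. partial_perm q p Y \<and> \<sigma> permutes {..<p + q} \<and>
    (\<exists>b\<in>UT (p + q). g = bd p q k1 k2 * (ub p q Y * permmat (p + q) \<sigma>) * b)"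
proof -
  let ?n = "p + q"
  obtain A D Y \<sigma> b where A: "A \<in> UT p" and D: "D \<in> UT q" and Y: "Y \<in> carrier_mat q p"
    and s: "\<sigma> permutes {..<?n}" and b: "b \<in> UT ?n"
    and eq: "g = bd p q A D * (ub p q Y * permmat ?n \<sigma>) * b"
    using bruhat_block[OF g] by blast
  have "inj_on (iperm \<sigma>) {..<p}" using permutes_inj[OF permutes_inv[OF s]] inj_on_subset by blast
  then obtain c2 c1 where c2: "c2 \<in> pat (\<lambda>i j. iperm \<sigma> (p + i) \<le> iperm \<sigma> (p + j)) q"
    and c1: "c1 \<in> pat (\<lambda>i j. iperm \<sigma> i \<le> iperm \<sigma> j) p" and pp: "partial_perm q p (c2 * Y * c1)"
    using bruhat_rectangular[OF Y, of "iperm \<sigma>" "\<lambda>i. iperm \<sigma> (p + i)"] by blast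
  let ?Y = "c2 * Y * c1"
  obtain b' where b': "b' \<in> UT ?n" "ub p q Y * permmat ?n \<sigma>
      = bd p q c1 (ginv q c2) * (ub p q ?Y * permmat ?n \<sigma>) * b'"
    using conj_ub_perm[OF s Y c1 c2] by blast
  have G: "A \<in> carrier (GL p)" "D \<in> carrier (GL q)" "c1 \<in> carrier (GL p)" "c2 \<in> carrier (GL q)"
    using A D c1 c2 by (auto simp: pat_def)
  have bG: "b \<in> carrier (GL ?n)" "b' \<in> carrier (GL ?n)" using b b' by (auto simp: pat_def)
  have sG: "ub p q ?Y * permmat ?n \<sigma> \<in> carrier (GL ?n)"
    using ub_GL permmat_GL[OF s] pp by (auto simp: partial_perm_def)
  have bdG: "bd p q A D \<in> carrier (GL ?n)" "bd p q c1 (ginv q c2) \<in> carrier (GL ?n)" using G by auto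
  have "bd p q A D * bd p q c1 (ginv q c2) = bd p q (A * c1) (D * ginv q c2)"
    by (rule bd_mult) (use G GL_mat GL_inv_closed in blast)+
  moreover have "g = (bd p q A D * bd p q c1 (ginv q c2)) * (ub p q ?Y * permmat ?n \<sigma>) * (b' * b)"
    unfolding eq b'(2) using bdG sG bG by (simp add: GL_assoc[where n="?n"])
  ultimately have "g = bd p q (A * c1) (D * ginv q c2) * (ub p q ?Y * permmat ?n \<sigma>) * (b' * b)"
    by simp
  moreover have "b' * b \<in> UT ?n" using subgroup_GL_D(3)[OF subgroup_UT b'(1) b] .
  moreover have "A * c1 \<in> carrier (GL p)" "D * ginv q c2 \<in> carrier (GL q)" using G by auto
  ultimately show ?thesis using pp s by blast
qed

text \<open>The elements of the diagonal torus that commute with the unipotent factor stabilize the flag of the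
  representative.\<close>

lemma torus_absorb:
  assumes s: "\<sigma> permutes {..<p + q}" and Y: "Y \<in> carrier_mat q p"
    and t: "\<forall>i<p. t1 i \<noteq> 0" "\<forall>i<q. t2 i \<noteq> 0" and eq: "dmat q t2 * Y = Y * dmat p t1"
  shows "\<exists>b\<in>UT (p + q). bd p q (dmat p t1) (dmat q t2) * (ub p q Y * permmat (p + q) \<sigma>)
    = (ub p q Y * permmat (p + q) \<sigma>) * b"
proof -
  let ?n = "p + q" and ?D = "bd p q (dmat p t1) (dmat q t2)"
  have "?D \<in> pat (\<lambda>i j. iperm \<sigma> i \<le> iperm \<sigma> j) ?n"
    by (rule bd_pat; rule dmat_pat) (use t in simp_all)
  then obtain b where b: "b \<in> UT ?n" "?D * permmat ?n \<sigma> = permmat ?n \<sigma> * b"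
    using permmat_conj[OF s] by blast
  have G: "?D \<in> carrier (GL ?n)" "ub p q Y \<in> carrier (GL ?n)" "permmat ?n \<sigma> \<in> carrier (GL ?n)"
    "b \<in> carrier (GL ?n)"
    using bd_GL dmat_GL t ub_GL[OF Y] permmat_GL[OF s] b by (auto simp: pat_def)
  have "?D * ub p q Y = ub p q Y * ?D"
    using bd_ub[OF dmat_carrier dmat_carrier Y] ub_bd[OF dmat_carrier dmat_carrier Y] eq by simp
  then have "?D * (ub p q Y * permmat ?n \<sigma>) = (ub p q Y * permmat ?n \<sigma>) * b"
    using GL_assoc[OF G(1,2,3)] GL_assoc[OF G(2,1,3)] GL_assoc[OF G(2,3,4)] b(2) by simp
  then show ?thesis using b(1) by blast
qed

text \<open>The stabilizer of a clan representative contains a torus that projects onto the full diagonal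
  torus of either block, so a mirabolic subgroup of one block still has finitely many orbits.\<close>

lemma finite_cosets_torus:
  assumes H: "subgroup H1 (GL p)" "subgroup H2 (GL q)"
    and S1: "finite S1" "S1 \<subseteq> carrier (GL p)" and S2: "finite S2" "S2 \<subseteq> carrier (GL q)"
    and red: "\<And>k1 k2 Y. k1 \<in> carrier (GL p) \<Longrightarrow> k2 \<in> carrier (GL q) \<Longrightarrow> partial_perm q p Y \<Longrightarrow>
      \<exists>m1\<in>H1. \<exists>s1\<in>S1. \<exists>t1. \<exists>m2\<in>H2. \<exists>s2\<in>S2. \<exists>t2. (\<forall>i<p. t1 i \<noteq> 0) \<and> (\<forall>i<q. t2 i \<noteq> 0) \<and>
        k1 = m1 * s1 * dmat p t1 \<and> k2 = m2 * s2 * dmat q t2 \<and> dmat q t2 * Y = Y * dmat p t1"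
  shows "finite_double_cosets (p + q) (block_diag p q H1 H2) (UT (p + q))"
proof -
  let ?n = "p + q"
  let ?S = "(\<lambda>(s1, s2, u). bd p q s1 s2 * u) ` (S1 \<times> S2 \<times> unip_perms p q)"
  have "\<exists>h\<in>block_diag p q H1 H2. \<exists>s\<in>?S. \<exists>b\<in>UT ?n. g = h * s * b" if g: "g \<in> carrier (GL ?n)" for g
  proof -
    obtain k1 k2 Y \<sigma> b where k: "k1 \<in> carrier (GL p)" "k2 \<in> carrier (GL q)" and Y: "partial_perm q p Y"
      and s: "\<sigma> permutes {..<?n}" and b: "b \<in> UT ?n"
      and eq: "g = bd p q k1 k2 * (ub p q Y * permmat ?n \<sigma>) * b"
      using K_normal_form[OF g] by blast
    have Yc: "Y \<in> carrier_mat q p" using Y by (simp add: partial_perm_def)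
    obtain m1 s1 t1 m2 s2 t2 where m: "m1 \<in> H1" "s1 \<in> S1" "m2 \<in> H2" "s2 \<in> S2"
      and t: "\<forall>i<p. t1 i \<noteq> 0" "\<forall>i<q. t2 i \<noteq> 0"
      and ke: "k1 = m1 * s1 * dmat p t1" "k2 = m2 * s2 * dmat q t2" and tY: "dmat q t2 * Y = Y * dmat p t1"
      using red[OF k Y] by blast
    let ?u = "ub p q Y * permmat ?n \<sigma>" and ?D = "bd p q (dmat p t1) (dmat q t2)"
    obtain b' where b': "b' \<in> UT ?n" "?D * ?u = ?u * b'" using torus_absorb[OF s Yc t tY] by blast
    have G: "m1 \<in> carrier (GL p)" "s1 \<in> carrier (GL p)" "m2 \<in> carrier (GL q)" "s2 \<in> carrier (GL q)"
      using m S1 S2 subgroup_GL_D(1)[OF H(1)] subgroup_GL_D(1)[OF H(2)] by auto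
    have Gd: "dmat p t1 \<in> carrier (GL p)" "dmat q t2 \<in> carrier (GL q)" using dmat_GL t by auto
    have uG: "?u \<in> carrier (GL ?n)" using ub_GL[OF Yc] permmat_GL[OF s] by simp
    have bG: "b \<in> carrier (GL ?n)" "b' \<in> carrier (GL ?n)" using b b' by (auto simp: pat_def)
    have BG: "bd p q m1 m2 \<in> carrier (GL ?n)" "bd p q s1 s2 \<in> carrier (GL ?n)" "?D \<in> carrier (GL ?n)"
      using G Gd by auto
    have "bd p q k1 k2 = bd p q m1 m2 * bd p q s1 s2 * ?D"
      unfolding ke using G Gd bd_mult[of m1 p m2 q s1 s2]
        bd_mult[of "m1 * s1" p "m2 * s2" q "dmat p t1" "dmat q t2"] by (simp add: GL_mat)
    then have "g = bd p q m1 m2 * bd p q s1 s2 * ?D * ?u * b" using eq by simp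
    also have "\<dots> = bd p q m1 m2 * (bd p q s1 s2 * (?D * ?u)) * b"
      using BG uG by (simp add: GL_assoc[where n="?n"] del: GL_assoc)
    also have "\<dots> = bd p q m1 m2 * (bd p q s1 s2 * ?u) * (b' * b)"
      unfolding b'(2) using BG uG bG by (simp add: GL_assoc[where n="?n"])
    finally have "g = bd p q m1 m2 * (bd p q s1 s2 * ?u) * (b' * b)" .
    moreover have "?u \<in> unip_perms p q" unfolding unip_perms_def
    proof (rule image_eqI[of _ _ "(Y, \<sigma>)"])
      have "zero_one q p Y" using Y unfolding zero_one_def partial_perm_def clean_col_def by blast
      then show "(Y, \<sigma>) \<in> {Y. zero_one q p Y} \<times> {\<sigma>. \<sigma> permutes {..<?n}}" using s by simp
    qed simp
    then have "bd p q s1 s2 * ?u \<in> ?S" using m by (intro image_eqI[of _ _ "(s1, s2, ?u)"]) auto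
    moreover have "b' * b \<in> UT ?n" using subgroup_GL_D(3)[OF subgroup_UT b'(1) b] .
    ultimately show ?thesis using block_diagI[OF m(1,3)] by blast
  qed
  moreover have "finite ?S" using S1 S2 finite_unip_perms by auto
  moreover have "?S \<subseteq> carrier (GL ?n)" using S1 S2 unip_perms_GL by (auto simp: subset_iff)
  ultimately show ?thesis unfolding finite_double_cosets_def by (intro exI[of _ ?S]) simp
qed

lemma torus_factor:
  assumes "k \<in> carrier (GL q)" "\<forall>i<q. t i \<noteq> 0"
  shows "k = (k * ginv q (dmat q t)) * 1\<^sub>m q * dmat q t" "k * ginv q (dmat q t) \<in> carrier (GL q)"
  using assms dmat_GL[OF assms(2)] by (simp_all add: GL_assoc[where n=q])

lemma finite_cosets_mirabolic_right:
  assumes H2: "subgroup H2 (GL q)" "torus_finite q H2"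
  shows "finite_double_cosets (p + q) (block_diag p q (carrier (GL p)) H2) (UT (p + q))"
proof -
  obtain S where S: "finite S" "S \<subseteq> carrier (GL q)"
    and *: "\<forall>k\<in>carrier (GL q). \<exists>m\<in>H2. \<exists>s\<in>S. \<exists>t. (\<forall>i<q. t i \<noteq> 0) \<and> k = m * s * dmat q t"
    using H2(2) unfolding torus_finite_def by blast
  show ?thesis
  proof (rule finite_cosets_torus[OF group.subgroup_self[OF group_GL] H2(1), where ?S1.0 = "{1\<^sub>m p}" and ?S2.0 = S])
    fix k1 k2 Y assume k1: "k1 \<in> carrier (GL p)" and k2: "k2 \<in> carrier (GL q)" and Y: "partial_perm q p Y"
    obtain m2 s2 t2 where m2: "m2 \<in> H2" "s2 \<in> S" "\<forall>i<q. t2 i \<noteq> 0" "k2 = m2 * s2 * dmat q t2"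
      using * k2 by blast
    obtain t1 where t1: "\<forall>i<p. t1 i \<noteq> 0" "dmat q t2 * Y = Y * dmat p t1"
      using torus_transfer_left[OF Y m2(3)] by blast
    show "\<exists>m1\<in>carrier (GL p). \<exists>s1\<in>{1\<^sub>m p}. \<exists>t1. \<exists>m2\<in>H2. \<exists>s2\<in>S. \<exists>t2. (\<forall>i<p. t1 i \<noteq> 0) \<and> (\<forall>i<q. t2 i \<noteq> 0) \<and>
        k1 = m1 * s1 * dmat p t1 \<and> k2 = m2 * s2 * dmat q t2 \<and> dmat q t2 * Y = Y * dmat p t1"
      using torus_factor[OF k1 t1(1)] m2 t1 by blast
  qed (use S in auto)
qed

lemma finite_cosets_mirabolic_left:
  assumes H1: "subgroup H1 (GL p)" "torus_finite p H1"
  shows "finite_double_cosets (p + q) (block_diag p q H1 (carrier (GL q))) (UT (p + q))"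
proof -
  obtain S where S: "finite S" "S \<subseteq> carrier (GL p)"
    and *: "\<forall>k\<in>carrier (GL p). \<exists>m\<in>H1. \<exists>s\<in>S. \<exists>t. (\<forall>i<p. t i \<noteq> 0) \<and> k = m * s * dmat p t"
    using H1(2) unfolding torus_finite_def by blast
  show ?thesis
  proof (rule finite_cosets_torus[OF H1(1) group.subgroup_self[OF group_GL], where ?S1.0 = S and ?S2.0 = "{1\<^sub>m q}"])
    fix k1 k2 Y assume k1: "k1 \<in> carrier (GL p)" and k2: "k2 \<in> carrier (GL q)" and Y: "partial_perm q p Y"
    obtain m1 s1 t1 where m1: "m1 \<in> H1" "s1 \<in> S" "\<forall>i<p. t1 i \<noteq> 0" "k1 = m1 * s1 * dmat p t1"
      using * k1 by blast
    obtain t2 where t2: "\<forall>i<q. t2 i \<noteq> 0" "dmat q t2 * Y = Y * dmat p t1"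
      using torus_transfer_right[OF Y m1(3)] by blast
    show "\<exists>m1\<in>H1. \<exists>s1\<in>S. \<exists>t1. \<exists>m2\<in>carrier (GL q). \<exists>s2\<in>{1\<^sub>m q}. \<exists>t2. (\<forall>i<p. t1 i \<noteq> 0) \<and> (\<forall>i<q. t2 i \<noteq> 0) \<and>
        k1 = m1 * s1 * dmat p t1 \<and> k2 = m2 * s2 * dmat q t2 \<and> dmat q t2 * Y = Y * dmat p t1"
      using torus_factor[OF k2 t2(1)] m1 t2 by blast
  qed (use S in auto)
qed

section \<open>The cases with infinitely many orbits\<close>

text \<open>The columns of \<open>L \<zeta>\<close> span the successive steps of a flag in a space of dimension \<open>d\<close>. If \<open>h\<close> is a
  matrix vanishing outside \<open>R\<close> that maps the flag of \<open>\<eta>\<close> to the flag of \<open>\<zeta>\<close>, where \<open>b\<close> is the change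
  of the adapted basis, then the parameters agree. The matrix \<open>h\<close> stands for the restriction of an
  element of \<open>Q\<close> to a coordinate subspace.\<close>

definition rigid :: "nat \<Rightarrow> (nat \<Rightarrow> nat \<Rightarrow> bool) \<Rightarrow> (complex \<Rightarrow> nat \<Rightarrow> nat \<Rightarrow> complex) \<Rightarrow> bool" where
  "rigid d R L \<longleftrightarrow> (\<forall>\<zeta> \<eta> h b. (\<forall>r<d. \<forall>c<d. \<not> R r c \<longrightarrow> h r c = 0) \<longrightarrow>
     (\<forall>i<d. b i i \<noteq> 0) \<longrightarrow> (\<forall>i<d. \<forall>j<i. b i j = 0) \<longrightarrow>
     (\<forall>r<d. \<forall>j<d. (\<Sum>c<d. h r c * L \<eta> c j) = (\<Sum>i<d. L \<zeta> r i * b i j)) \<longrightarrow> \<zeta> = \<eta>)"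

lemma extend_to_permutation:
  assumes k: "inj_on \<kappa> {..<d}" "\<kappa> ` {..<d} \<subseteq> {..<n}"
  shows "\<exists>\<pi>. \<pi> permutes {..<n} \<and> (\<forall>c<d. \<pi> c = \<kappa> (c :: nat))"
proof -
  have dn: "d \<le> n" using card_inj_on_le[OF k] by simp
  have "card {d..<n} = card ({..<n} - \<kappa> ` {..<d})"
    using k dn by (simp add: card_Diff_subset card_image)
  then obtain f where f: "bij_betw f {d..<n} ({..<n} - \<kappa> ` {..<d})"
    using finite_same_card_bij[of "{d..<n}" "{..<n} - \<kappa> ` {..<d}"] by auto
  define \<pi> where "\<pi> c = (if c < d then \<kappa> c else if c < n then f c else c)" for c
  have "bij_betw \<pi> {..<d} (\<kappa> ` {..<d})"
    using bij_betw_cong[of "{..<d}" \<pi> \<kappa>] inj_on_imp_bij_betw[OF k(1)] by (auto simp: \<pi>_def)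
  moreover have "bij_betw \<pi> {d..<n} ({..<n} - \<kappa> ` {..<d})"
    using bij_betw_cong[of "{d..<n}" \<pi> f] f by (auto simp: \<pi>_def)
  ultimately have "bij_betw \<pi> ({..<d} \<union> {d..<n}) (\<kappa> ` {..<d} \<union> ({..<n} - \<kappa> ` {..<d}))"
    by (rule bij_betw_combine) auto
  moreover have "{..<d} \<union> {d..<n} = {..<n}" "\<kappa> ` {..<d} \<union> ({..<n} - \<kappa> ` {..<d}) = {..<n}"
    using dn k(2) by auto
  ultimately have "bij_betw \<pi> {..<n} {..<n}" by simp
  then have "\<pi> permutes {..<n}" using dn by (intro bij_imp_permutes) (auto simp: \<pi>_def)
  then show ?thesis by (intro exI[of _ \<pi>]) (auto simp: \<pi>_def)
qed

text \<open>The first \<open>d\<close> flag steps lie in a coordinate subspace of dimension \<open>d\<close>, so an element of \<open>H\<close>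
  relating two members of the family restricts to that subspace, where rigidity applies.\<close>

lemma infinite_double_cosets:
  assumes H: "subgroup H (GL n)"
    and k: "inj_on \<kappa> {..<d}" "\<kappa> ` {..<d} \<subseteq> {..<n}"
    and R: "\<And>A r c. A \<in> H \<Longrightarrow> r < d \<Longrightarrow> c < d \<Longrightarrow> \<not> R r c \<Longrightarrow> A $$ (\<kappa> r, \<kappa> c) = 0"
    and L: "\<And>\<zeta> i. i < d \<Longrightarrow> L \<zeta> i i = 1" "\<And>\<zeta> i j. i < j \<Longrightarrow> j < d \<Longrightarrow> L \<zeta> i j = 0"
    and rig: "rigid d R L"
  shows "\<not> finite_double_cosets n H (UT n)"
proof
  assume "finite_double_cosets n H (UT n)"
  then obtain S where S: "finite S" "S \<subseteq> carrier (GL n)"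
    and cov: "\<forall>g\<in>carrier (GL n). \<exists>h\<in>H. \<exists>s\<in>S. \<exists>b\<in>UT n. g = h * s * b"
    unfolding finite_double_cosets_def by blast
  have dn: "d \<le> n" using card_inj_on_le[OF k] by simp
  obtain \<pi> where \<pi>: "\<pi> permutes {..<n}" "\<forall>c<d. \<pi> c = \<kappa> c" using extend_to_permutation[OF k] by blast
  define M where "M \<zeta> = mat n n (\<lambda>(i, j). if i < d \<and> j < d then L \<zeta> i j else if i = j then 1 else 0)" for \<zeta>
  define g where "g \<zeta> = permmat n \<pi> * M \<zeta>" for \<zeta>
  have Mc: "M \<zeta> \<in> carrier_mat n n" for \<zeta> by (simp add: M_def)
  have MG: "M \<zeta> \<in> carrier (GL n)" for \<zeta>
  proof -
    have "det (M \<zeta>) = prod_list (diag_mat (M \<zeta>))"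
    proof (rule det_lower_triangular[OF _ Mc])
      fix i j assume "i < j" "j < n"
      then show "M \<zeta> $$ (i, j) = 0" using L(2) by (auto simp: M_def)
    qed
    also have "\<dots> = 1"
    proof -
      have "M \<zeta> $$ (i, i) = 1" if "i < n" for i using that L(1) by (auto simp: M_def)
      then have "set (diag_mat (M \<zeta>)) \<subseteq> {1}" using Mc[of \<zeta>] by (auto simp: diag_mat_def)
      moreover have "prod_list xs = 1" if "set xs \<subseteq> {1}" for xs :: "complex list"
        using that by (induction xs) auto
      ultimately show ?thesis by blast
    qed
    finally show ?thesis using Mc by (simp add: GL_carrier_iff)
  qed
  have gG: "g \<zeta> \<in> carrier (GL n)" for \<zeta> unfolding g_def using permmat_GL[OF \<pi>(1)] MG by simp
  have gent: "g \<zeta> $$ (\<pi> i, j) = M \<zeta> $$ (i, j)" if "i < n" "j < n" for \<zeta> i j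
    unfolding g_def using permmat_mult[OF Mc \<pi>(1) that] .
  define F where "F \<zeta> = (SOME s. s \<in> S \<and> (\<exists>h\<in>H. \<exists>b\<in>UT n. g \<zeta> = h * s * b))" for \<zeta>
  have F: "F \<zeta> \<in> S \<and> (\<exists>h\<in>H. \<exists>b\<in>UT n. g \<zeta> = h * F \<zeta> * b)" for \<zeta>
    unfolding F_def by (rule someI_ex) (use cov gG in blast)
  \<comment> \<open>Finitely many representatives cannot separate the members of a family indexed by the complex
    numbers.\<close>
  have "\<not> inj_on F UNIV"
  proof
    assume "inj_on F UNIV"
    moreover have "F ` UNIV \<subseteq> S" using F by blast
    ultimately have "finite (UNIV :: complex set)" using S(1) finite_subset finite_imageD by blast
    then show False using infinite_UNIV_char_0 by blast
  qed
  then obtain \<zeta> \<eta> where ne: "\<zeta> \<noteq> \<eta>" "F \<zeta> = F \<eta>" by (auto simp: inj_on_def)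
  obtain h b where hb: "h \<in> H" "b \<in> UT n" "g \<zeta> = h * F \<zeta> * b" using F by blast
  obtain h' b' where hb': "h' \<in> H" "b' \<in> UT n" "g \<eta> = h' * F \<zeta> * b'" using F ne(2) by metis
  have G: "h \<in> carrier (GL n)" "h' \<in> carrier (GL n)" "b \<in> carrier (GL n)" "b' \<in> carrier (GL n)"
    "F \<zeta> \<in> carrier (GL n)"
    using hb hb' subgroup_GL_D(1)[OF H] F S(2) by (auto simp: pat_def)
  define A where "A = h * ginv n h'"
  define \<beta> where "\<beta> = ginv n b * b'"
  have A: "A \<in> H" unfolding A_def using hb hb' subgroup_GL_D[OF H] by blast
  have \<beta>: "\<beta> \<in> UT n" unfolding \<beta>_def using hb hb' subgroup_GL_D[OF subgroup_UT] by blast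
  have AG: "A \<in> carrier (GL n)" and \<beta>G: "\<beta> \<in> carrier (GL n)" using G by (auto simp: A_def \<beta>_def)
  have eq: "A * g \<eta> = g \<zeta> * \<beta>"
    unfolding A_def \<beta>_def hb(3) hb'(3) using G by (simp add: GL_assoc[where n=n])
  have ent: "(\<Sum>c<d. A $$ (\<kappa> r, \<kappa> c) * L \<eta> c j) = (\<Sum>i<d. L \<zeta> r i * \<beta> $$ (i, j))" if rj: "r < d" "j < d" for r j
  proof -
    have rn: "r < n" "j < n" using rj dn by auto
    have \<pi>r: "\<pi> r < n" using permutes_in_image[OF \<pi>(1), of r] rn by simp
    have "(A * g \<eta>) $$ (\<pi> r, j) = (\<Sum>k<n. A $$ (\<pi> r, k) * g \<eta> $$ (k, j))"
      by (rule GL_mult_entry[OF AG gG \<pi>r rn(2)])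
    also have "\<dots> = (\<Sum>c<n. A $$ (\<pi> r, \<pi> c) * g \<eta> $$ (\<pi> c, j))"
      using sum.permute[OF \<pi>(1), of "\<lambda>k. A $$ (\<pi> r, k) * g \<eta> $$ (k, j)"] by (simp add: o_def)
    also have "\<dots> = (\<Sum>c<n. A $$ (\<pi> r, \<pi> c) * M \<eta> $$ (c, j))" using gent rn by simp
    also have "\<dots> = (\<Sum>c<d. A $$ (\<pi> r, \<pi> c) * M \<eta> $$ (c, j))"
      by (rule sum.mono_neutral_right) (use dn rj in \<open>auto simp: M_def\<close>)
    also have "\<dots> = (\<Sum>c<d. A $$ (\<kappa> r, \<kappa> c) * L \<eta> c j)"
      by (rule sum.cong) (use dn rj \<pi>(2) in \<open>auto simp: M_def\<close>)
    finally have l: "(A * g \<eta>) $$ (\<pi> r, j) = (\<Sum>c<d. A $$ (\<kappa> r, \<kappa> c) * L \<eta> c j)" .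
    have "(g \<zeta> * \<beta>) $$ (\<pi> r, j) = (\<Sum>k<n. g \<zeta> $$ (\<pi> r, k) * \<beta> $$ (k, j))"
      by (rule GL_mult_entry[OF gG \<beta>G \<pi>r rn(2)])
    also have "\<dots> = (\<Sum>k<n. M \<zeta> $$ (r, k) * \<beta> $$ (k, j))" using gent rn by simp
    also have "\<dots> = (\<Sum>k<d. M \<zeta> $$ (r, k) * \<beta> $$ (k, j))"
      by (rule sum.mono_neutral_right) (use dn rj in \<open>auto simp: M_def\<close>)
    also have "\<dots> = (\<Sum>k<d. L \<zeta> r k * \<beta> $$ (k, j))"
      by (rule sum.cong) (use dn rj in \<open>auto simp: M_def\<close>)
    finally show ?thesis using l eq by simp
  qed
  have diag: "\<beta> $$ (i, i) \<noteq> 0" if "i < d" for i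
  proof
    assume z: "\<beta> $$ (i, i) = 0"
    have ut: "upper_triangular \<beta>" using pat_D[OF \<beta>] GL_mat[OF \<beta>G] by auto
    have "det \<beta> \<noteq> 0" using \<beta>G by (simp add: GL_carrier_iff)
    then have "prod_list (diag_mat \<beta>) \<noteq> 0" using det_upper_triangular[OF ut GL_mat[OF \<beta>G]] by simp
    moreover have "0 \<in> set (diag_mat \<beta>)"
      using z that dn GL_mat[OF \<beta>G] by (auto simp: diag_mat_def image_iff intro!: bexI[of _ i])
    ultimately show False by (simp add: prod_list_zero_iff)
  qed
  have "\<zeta> = \<eta>"
    using rig[unfolded rigid_def, rule_format, of "\<lambda>r c. A $$ (\<kappa> r, \<kappa> c)" "\<lambda>i j. \<beta> $$ (i, j)" \<eta> \<zeta>]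
      R[OF A] diag pat_D[OF \<beta>] dn ent by auto
  then show False using ne(1) by simp
qed

lemma lessThan_numerals:
  "{..<4} = {0, 1, 2, 3 :: nat}" "{..<5} = {0, 1, 2, 3, 4 :: nat}" "{..<7} = {0, 1, 2, 3, 4, 5, 6 :: nat}"
  by auto

text \<open>With respect to a basis \<open>v\<close>, \<open>x\<close>, \<open>u\<close>, \<open>w\<close>, with \<open>v\<close>, \<open>u\<close> in the first summand and \<open>x\<close>, \<open>w\<close> in the
  second, the first three columns are \<open>v + x\<close>, \<open>x + u + w\<close> and \<open>u + \<zeta> w\<close>.\<close>

definition fam_lines :: "complex \<Rightarrow> nat \<Rightarrow> nat \<Rightarrow> complex" where
  "fam_lines \<zeta> i j = (if i = j \<or> (i, j) \<in> {(1, 0), (2, 1), (3, 1)} then 1 else if (i, j) = (3, 2) then \<zeta> else 0)"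

text \<open>The pattern says that \<open>h\<close> preserves both summands and the lines spanned by \<open>u\<close> and \<open>w\<close>. As \<open>v + x\<close>
  is an eigenvector, \<open>v\<close> and \<open>x\<close> are eigenvectors for the same eigenvalue, and the second step of
  the flag forces the same eigenvalue on \<open>u\<close> and \<open>w\<close>. So \<open>h\<close> is a scalar, and the third step
  determines \<open>\<zeta>\<close>.\<close>

lemma rigid_lines: "rigid 4 (\<lambda>r c. (r \<in> {0, 2} \<longleftrightarrow> c \<in> {0, 2}) \<and> (r, c) \<noteq> (0, 2) \<and> (r, c) \<noteq> (1, 3)) fam_lines"
  unfolding rigid_def
proof (intro allI impI)
  fix \<zeta> \<eta> :: complex and h b :: "nat \<Rightarrow> nat \<Rightarrow> complex"
  assume h: "\<forall>r<4. \<forall>c<4. \<not> ((r \<in> {0, 2} \<longleftrightarrow> c \<in> {0, 2}) \<and> (r, c) \<noteq> (0, 2) \<and> (r, c) \<noteq> (1, 3)) \<longrightarrow> h r c = 0"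
    and b: "\<forall>i<4. b i i \<noteq> 0" "\<forall>i<4. \<forall>j<i. b i j = 0"
    and eq: "\<forall>r<4. \<forall>j<4. (\<Sum>c<4. h r c * fam_lines \<eta> c j) = (\<Sum>i<4. fam_lines \<zeta> r i * b i j)"
  have h0: "h r c = 0" if "\<not> ((r \<in> {0, 2} \<longleftrightarrow> c \<in> {0, 2}) \<and> (r, c) \<noteq> (0, 2) \<and> (r, c) \<noteq> (1, 3))"
    "r < 4" "c < 4" for r c
    using h that by blast
  have b0: "b i j = 0" if "j < i" "i < 4" for i j using b(2) that by blast
  note e = eq[rule_format, unfolded lessThan_numerals]
  show "\<zeta> = \<eta>"
    using e[of 0 0] e[of 1 0] e[of 0 1] e[of 1 1] e[of 2 1] e[of 3 1]
      e[of 0 2] e[of 1 2] e[of 2 2] e[of 3 2] e[of 3 0] e[of 2 0] b(1)[rule_format, of 0]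
    by (simp add: fam_lines_def h0 b0)
qed

text \<open>With respect to a basis \<open>w\<^sub>3\<close>, \<open>w\<^sub>2\<close>, \<open>w\<^sub>1\<close> of one summand and \<open>u\<^sub>1\<close>, \<open>u\<^sub>2\<close> of the other, the first
  four columns are \<open>w\<^sub>3 + u\<^sub>1\<close>, \<open>w\<^sub>2 + u\<^sub>2\<close>, \<open>w\<^sub>1 + u\<^sub>1 + u\<^sub>2\<close> and \<open>u\<^sub>1 + \<zeta> u\<^sub>2\<close>.\<close>

definition fam_flag :: "complex \<Rightarrow> nat \<Rightarrow> nat \<Rightarrow> complex" where
  "fam_flag \<zeta> i j = (if i = j \<or> (i, j) \<in> {(3, 0), (4, 1), (3, 2), (4, 2)} then 1 else if (i, j) = (4, 3) then \<zeta> else 0)"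

text \<open>The pattern says that \<open>h\<close> preserves both summands and the flag spanned by \<open>w\<^sub>1\<close>, then \<open>w\<^sub>2\<close>, then
  \<open>w\<^sub>3\<close>. The first three steps of the family make \<open>w\<^sub>3\<close>, \<open>w\<^sub>2\<close>, \<open>w\<^sub>1\<close>, \<open>u\<^sub>1\<close>, \<open>u\<^sub>2\<close> and \<open>u\<^sub>1 + u\<^sub>2\<close>
  eigenvectors, so \<open>h\<close> is a scalar on the span of \<open>u\<^sub>1\<close> and \<open>u\<^sub>2\<close>.\<close>

lemma rigid_flag: "rigid 5 (\<lambda>r c. (3 \<le> r \<and> 3 \<le> c) \<or> (r < 3 \<and> c < 3 \<and> c \<le> r)) fam_flag"
  unfolding rigid_def
proof (intro allI impI)
  fix \<zeta> \<eta> :: complex and h b :: "nat \<Rightarrow> nat \<Rightarrow> complex"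
  assume h: "\<forall>r<5. \<forall>c<5. \<not> ((3 \<le> r \<and> 3 \<le> c) \<or> (r < 3 \<and> c < 3 \<and> c \<le> r)) \<longrightarrow> h r c = 0"
    and b: "\<forall>i<5. b i i \<noteq> 0" "\<forall>i<5. \<forall>j<i. b i j = 0"
    and eq: "\<forall>r<5. \<forall>j<5. (\<Sum>c<5. h r c * fam_flag \<eta> c j) = (\<Sum>i<5. fam_flag \<zeta> r i * b i j)"
  have h0: "h r c = 0" if "\<not> ((3 \<le> r \<and> 3 \<le> c) \<or> (r < 3 \<and> c < 3 \<and> c \<le> r))" "r < 5" "c < 5" for r c
    using h that by blast
  have b0: "b i j = 0" if "j < i" "i < 5" for i j using b(2) that by blast
  note e = eq[rule_format, unfolded lessThan_numerals]
  show "\<zeta> = \<eta>"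
    using e[of 0 0] e[of 1 0] e[of 2 0] e[of 3 0] e[of 4 0] e[of 0 1] e[of 1 1] e[of 2 1] e[of 3 1] e[of 4 1]
      e[of 0 2] e[of 1 2] e[of 2 2] e[of 3 2] e[of 4 2] e[of 0 3] e[of 1 3] e[of 2 3] e[of 3 3] e[of 4 3]
      b(1)[rule_format, of 0] b(1)[rule_format, of 3]
    by (simp add: fam_flag_def h0 b0)
qed

text \<open>With respect to a basis \<open>b\<^sub>1\<close>, \<open>b\<^sub>2\<close>, \<open>a\<^sub>1\<close>, \<open>a\<^sub>2\<close> of one summand and \<open>u\<^sub>3\<close>, \<open>u\<^sub>1\<close>, \<open>u\<^sub>2\<close> of the other, the
  first six columns are \<open>b\<^sub>1 + u\<^sub>1\<close>, \<open>b\<^sub>2 + u\<^sub>2\<close>, \<open>a\<^sub>1 + u\<^sub>3\<close>, \<open>a\<^sub>2 + u\<^sub>2\<close>, \<open>u\<^sub>1 + u\<^sub>2 + u\<^sub>3\<close> and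
  \<open>u\<^sub>1 + \<zeta> u\<^sub>2\<close>.\<close>

definition fam_plane :: "complex \<Rightarrow> nat \<Rightarrow> nat \<Rightarrow> complex" where
  "fam_plane \<zeta> i j = (if i = j \<or> (i, j) \<in> {(5, 0), (6, 1), (4, 2), (6, 3), (5, 4), (6, 4)} then 1
    else if (i, j) = (6, 5) then \<zeta> else 0)"

text \<open>The pattern says that \<open>h\<close> preserves both summands and the plane spanned by \<open>a\<^sub>1\<close>, \<open>a\<^sub>2\<close>. The first four
  steps of the family make \<open>u\<^sub>1\<close>, \<open>u\<^sub>2\<close>, \<open>u\<^sub>3\<close> eigenvectors, and the fifth makes their eigenvalues
  equal. The columns of the equation are evaluated one after the other.\<close>

lemma rigid_plane: "rigid 7 (\<lambda>r c. (4 \<le> r \<and> 4 \<le> c) \<or> (r < 4 \<and> c < 4 \<and> (r < 2 \<longrightarrow> c < 2))) fam_plane"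
  unfolding rigid_def
proof (intro allI impI)
  fix \<zeta> \<eta> :: complex and h b :: "nat \<Rightarrow> nat \<Rightarrow> complex"
  assume h: "\<forall>r<7. \<forall>c<7. \<not> ((4 \<le> r \<and> 4 \<le> c) \<or> (r < 4 \<and> c < 4 \<and> (r < 2 \<longrightarrow> c < 2))) \<longrightarrow> h r c = 0"
    and b: "\<forall>i<7. b i i \<noteq> 0" "\<forall>i<7. \<forall>j<i. b i j = 0"
    and eq: "\<forall>r<7. \<forall>j<7. (\<Sum>c<7. h r c * fam_plane \<eta> c j) = (\<Sum>i<7. fam_plane \<zeta> r i * b i j)"
  have h0: "h r c = 0" if "\<not> ((4 \<le> r \<and> 4 \<le> c) \<or> (r < 4 \<and> c < 4 \<and> (r < 2 \<longrightarrow> c < 2)))" "r < 7" "c < 7" for r c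
    using h that by blast
  have b0: "b i j = 0" if "j < i" "i < 7" for i j using b(2) that by blast
  note e = eq[rule_format, unfolded lessThan_numerals]
  have c0: "h 0 0 = b 0 0" "h 1 0 = 0" "h 2 0 = 0" "h 3 0 = 0" "h 4 5 = 0" "h 5 5 = b 0 0" "h 6 5 = 0"
    using e[of 0 0] e[of 1 0] e[of 2 0] e[of 3 0] e[of 4 0] e[of 5 0] e[of 6 0]
    by (simp_all add: fam_plane_def h0 b0)
  have c1: "h 0 1 = b 0 1" "h 1 1 = b 1 1" "h 2 1 = 0" "h 3 1 = 0" "h 4 6 = 0" "h 5 6 = b 0 1" "h 6 6 = b 1 1"
    using e[of 0 1] e[of 1 1] e[of 2 1] e[of 3 1] e[of 4 1] e[of 5 1] e[of 6 1]
    by (simp_all add: fam_plane_def h0 b0)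
  have c2: "b 0 2 = 0" "b 1 2 = 0" "h 2 2 = b 2 2" "h 3 2 = 0" "h 4 4 = b 2 2" "h 5 4 = 0" "h 6 4 = 0"
    using e[of 0 2] e[of 1 2] e[of 2 2] e[of 3 2] e[of 4 2] e[of 5 2] e[of 6 2]
    by (simp_all add: fam_plane_def h0 b0)
  have c3: "b 0 3 = 0" "b 1 3 = 0" "b 0 1 = 0" "b 2 3 = 0" "h 6 6 = b 3 3"
    using e[of 0 3] e[of 1 3] e[of 2 3] e[of 3 3] e[of 4 3] e[of 5 3] e[of 6 3]
    by (simp_all add: fam_plane_def h0 b0 c0[simplified] c1[simplified] c2[simplified])
  have c4: "b 0 0 = b 2 2" "b 1 1 = b 2 2"
    using e[of 0 4] e[of 1 4] e[of 2 4] e[of 3 4] e[of 4 4] e[of 5 4] e[of 6 4]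
    by (simp_all add: fam_plane_def h0 b0 c0[simplified] c1[simplified] c2[simplified] c3[simplified])
  have "b 0 5 = 0" "b 1 5 = 0" "b 2 5 = 0" "b 3 5 = 0" "b 4 5 = 0" "b 0 0 = b 5 5" "b 1 1 * \<eta> = \<zeta> * b 5 5"
    using e[of 0 5] e[of 1 5] e[of 2 5] e[of 3 5] e[of 4 5] e[of 5 5] e[of 6 5]
    by (simp_all add: fam_plane_def h0 b0 c0[simplified] c1[simplified] c2[simplified] c3[simplified] c4[simplified])
  then show "\<zeta> = \<eta>" using c0 c1 c4 b(1) by auto
qed

text \<open>The stabilizer of those steps of the standard flag whose dimensions lie in \<open>I\<close>.\<close>

definition std_parabolic :: "nat \<Rightarrow> nat set \<Rightarrow> complex mat set" where
  "std_parabolic n I = pat (\<lambda>i j. \<forall>k\<in>I. j < k \<longrightarrow> i < k) n"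

lemma subgroup_std_parabolic: "subgroup (std_parabolic n I) (GL n)"
  unfolding std_parabolic_def by (rule subgroup_pat) (auto simp: reflp_def transp_def)

lemma UT_std_parabolic: "UT n \<subseteq> std_parabolic n I"
  unfolding std_parabolic_def by (rule pat_mono) auto

lemma std_parabolic_GL: "std_parabolic n I \<subseteq> carrier (GL n)"
  unfolding std_parabolic_def by (rule pat_GL)

lemma std_parabolic_antimono: "J \<subseteq> I \<Longrightarrow> std_parabolic n I \<subseteq> std_parabolic n J"
  unfolding std_parabolic_def by (rule pat_mono) blast

lemma std_parabolic_zero:
  "A \<in> std_parabolic n I \<Longrightarrow> k \<in> I \<Longrightarrow> j < k \<Longrightarrow> k \<le> i \<Longrightarrow> i < n \<Longrightarrow> A $$ (i, j) = 0"
  unfolding std_parabolic_def by (erule pat_D) auto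

lemma block_diag_entry:
  assumes "A \<in> block_diag p q S T" "S \<subseteq> carrier (GL p)" "T \<subseteq> carrier (GL q)"
  shows "\<exists>X\<in>S. \<exists>D\<in>T. \<forall>i<p + q. \<forall>j<p + q. A $$ (i, j) = (if i < p then if j < p then X $$ (i, j) else 0
    else if j < p then 0 else D $$ (i - p, j - p))"
proof -
  obtain X D where XD: "X \<in> S" "D \<in> T" "A = bd p q X D" using assms(1) by (auto simp: block_diag_def)
  have "X \<in> carrier_mat p p" "D \<in> carrier_mat q q" using XD assms(2,3) by auto
  then show ?thesis using XD by (intro bexI[of _ X] bexI[of _ D]) auto
qed

text \<open>In either summand take a unit vector of the stabilized step (\<open>u\<close> and \<open>w\<close>) and one outside of it
  (\<open>v\<close> and \<open>x\<close>).\<close>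

lemma infinite_two_proper:
  assumes i: "i \<in> I" "0 < i" "i < p" and j: "j \<in> J" "0 < j" "j < q"
  shows "\<not> finite_double_cosets (p + q) (block_diag p q (std_parabolic p I) (std_parabolic q J)) (UT (p + q))"
proof (rule infinite_double_cosets[OF subgroup_block_diag[OF subgroup_std_parabolic subgroup_std_parabolic] _ _ _ _ _ rigid_lines])
  define \<kappa> where "\<kappa> c = [i, p + j, 0, p] ! c" for c
  have k: "\<kappa> 0 = i" "\<kappa> 1 = p + j" "\<kappa> 2 = 0" "\<kappa> 3 = p" by (simp_all add: \<kappa>_def)
  show "inj_on \<kappa> {..<4}" unfolding lessThan_numerals using i j by (auto simp: k[simplified])
  show "\<kappa> ` {..<4} \<subseteq> {..<p + q}" unfolding lessThan_numerals using i j by (auto simp: k[simplified])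
  fix A and r c :: nat assume A: "A \<in> block_diag p q (std_parabolic p I) (std_parabolic q J)" and rc: "r < 4" "c < 4"
    and R: "\<not> ((r \<in> {0, 2} \<longleftrightarrow> c \<in> {0, 2}) \<and> (r, c) \<noteq> (0, 2) \<and> (r, c) \<noteq> (1, 3))"
  obtain X D where X: "X \<in> std_parabolic p I" and D: "D \<in> std_parabolic q J"
    and ent: "\<And>i j. i < p + q \<Longrightarrow> j < p + q \<Longrightarrow> A $$ (i, j) = (if i < p then if j < p then X $$ (i, j) else 0
    else if j < p then 0 else D $$ (i - p, j - p))"
    using block_diag_entry[OF A std_parabolic_GL std_parabolic_GL] by blast
  have z: "X $$ (i, 0) = 0" "D $$ (j, 0) = 0"
    using std_parabolic_zero[OF X i(1)] std_parabolic_zero[OF D j(1)] i j by auto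
  have "r \<in> {0, 1, 2, 3}" "c \<in> {0, 1, 2, 3}" using rc by auto
  then show "A $$ (\<kappa> r, \<kappa> c) = 0" using R i j z by (auto simp: k[simplified] ent)
qed (auto simp: fam_lines_def)

text \<open>The unit vectors \<open>w\<^sub>1\<close>, \<open>w\<^sub>2\<close>, \<open>w\<^sub>3\<close> are taken from the three layers of the two stabilized steps.\<close>

lemma infinite_two_step_right:
  assumes p: "2 \<le> p" and j: "j1 \<in> J" "j2 \<in> J" "0 < j1" "j1 < j2" "j2 < q"
  shows "\<not> finite_double_cosets (p + q) (block_diag p q (carrier (GL p)) (std_parabolic q J)) (UT (p + q))"
proof (rule infinite_double_cosets[OF subgroup_block_diag[OF group.subgroup_self[OF group_GL] subgroup_std_parabolic] _ _ _ _ _ rigid_flag])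
  define \<kappa> where "\<kappa> c = [p + j2, p + j1, p, 0, 1] ! c" for c
  have k: "\<kappa> 0 = p + j2" "\<kappa> 1 = p + j1" "\<kappa> 2 = p" "\<kappa> 3 = 0" "\<kappa> 4 = 1" by (simp_all add: \<kappa>_def)
  show "inj_on \<kappa> {..<5}" unfolding lessThan_numerals using p j by (auto simp: k[simplified])
  show "\<kappa> ` {..<5} \<subseteq> {..<p + q}" unfolding lessThan_numerals using p j by (auto simp: k[simplified])
  fix A and r c :: nat assume A: "A \<in> block_diag p q (carrier (GL p)) (std_parabolic q J)" and rc: "r < 5" "c < 5"
    and R: "\<not> ((3 \<le> r \<and> 3 \<le> c) \<or> (r < 3 \<and> c < 3 \<and> c \<le> r))"
  obtain X D where D: "D \<in> std_parabolic q J"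
    and ent: "\<And>i j. i < p + q \<Longrightarrow> j < p + q \<Longrightarrow> A $$ (i, j) = (if i < p then if j < p then X $$ (i, j) else 0
    else if j < p then 0 else D $$ (i - p, j - p))"
    using block_diag_entry[OF A subset_refl std_parabolic_GL] by blast
  have z: "D $$ (j1, 0) = 0" "D $$ (j2, 0) = 0" "D $$ (j2, j1) = 0"
    using std_parabolic_zero[OF D j(1)] std_parabolic_zero[OF D j(2)] j by auto
  have "r \<in> {0, 1, 2, 3, 4}" "c \<in> {0, 1, 2, 3, 4}" using rc by auto
  then show "A $$ (\<kappa> r, \<kappa> c) = 0" using R p j z by (auto simp: k[simplified] ent)
qed (auto simp: fam_flag_def)

lemma infinite_two_step_left:
  assumes q: "2 \<le> q" and j: "j1 \<in> J" "j2 \<in> J" "0 < j1" "j1 < j2" "j2 < p"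
  shows "\<not> finite_double_cosets (p + q) (block_diag p q (std_parabolic p J) (carrier (GL q))) (UT (p + q))"
proof (rule infinite_double_cosets[OF subgroup_block_diag[OF subgroup_std_parabolic group.subgroup_self[OF group_GL]] _ _ _ _ _ rigid_flag])
  define \<kappa> where "\<kappa> c = [j2, j1, 0, p, p + 1] ! c" for c
  have k: "\<kappa> 0 = j2" "\<kappa> 1 = j1" "\<kappa> 2 = 0" "\<kappa> 3 = p" "\<kappa> 4 = p + 1" by (simp_all add: \<kappa>_def)
  show "inj_on \<kappa> {..<5}" unfolding lessThan_numerals using q j by (auto simp: k[simplified])
  show "\<kappa> ` {..<5} \<subseteq> {..<p + q}" unfolding lessThan_numerals using q j by (auto simp: k[simplified])
  fix A and r c :: nat assume A: "A \<in> block_diag p q (std_parabolic p J) (carrier (GL q))" and rc: "r < 5" "c < 5"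
    and R: "\<not> ((3 \<le> r \<and> 3 \<le> c) \<or> (r < 3 \<and> c < 3 \<and> c \<le> r))"
  obtain X D where X: "X \<in> std_parabolic p J"
    and ent: "\<And>i j. i < p + q \<Longrightarrow> j < p + q \<Longrightarrow> A $$ (i, j) = (if i < p then if j < p then X $$ (i, j) else 0
    else if j < p then 0 else D $$ (i - p, j - p))"
    using block_diag_entry[OF A std_parabolic_GL subset_refl] by blast
  have z: "X $$ (j1, 0) = 0" "X $$ (j2, 0) = 0" "X $$ (j2, j1) = 0"
    using std_parabolic_zero[OF X j(1)] std_parabolic_zero[OF X j(2)] j by auto
  have "r \<in> {0, 1, 2, 3, 4}" "c \<in> {0, 1, 2, 3, 4}" using rc by auto
  then show "A $$ (\<kappa> r, \<kappa> c) = 0" using R q j z by (auto simp: k[simplified] ent)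
qed (auto simp: fam_flag_def)

text \<open>Two unit vectors \<open>a\<^sub>1\<close>, \<open>a\<^sub>2\<close> are taken from the stabilized step and two, \<open>b\<^sub>1\<close>, \<open>b\<^sub>2\<close>, from outside of
  it, which is where dimension and codimension at least \<open>2\<close> enter.\<close>

lemma infinite_middle_right:
  assumes p: "3 \<le> p" and m: "m \<in> J" "2 \<le> m" "m + 2 \<le> q"
  shows "\<not> finite_double_cosets (p + q) (block_diag p q (carrier (GL p)) (std_parabolic q J)) (UT (p + q))"
proof (rule infinite_double_cosets[OF subgroup_block_diag[OF group.subgroup_self[OF group_GL] subgroup_std_parabolic] _ _ _ _ _ rigid_plane])
  define \<kappa> where "\<kappa> c = [p + m, p + m + 1, p, p + 1, 0, 1, 2] ! c" for c
  have k: "\<kappa> 0 = p + m" "\<kappa> 1 = p + m + 1" "\<kappa> 2 = p" "\<kappa> 3 = p + 1" "\<kappa> 4 = 0" "\<kappa> 5 = 1" "\<kappa> 6 = 2"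
    by (simp_all add: \<kappa>_def)
  show "inj_on \<kappa> {..<7}" unfolding lessThan_numerals using p m by (auto simp: k[simplified])
  show "\<kappa> ` {..<7} \<subseteq> {..<p + q}" unfolding lessThan_numerals using p m by (auto simp: k[simplified])
  fix A and r c :: nat assume A: "A \<in> block_diag p q (carrier (GL p)) (std_parabolic q J)" and rc: "r < 7" "c < 7"
    and R: "\<not> ((4 \<le> r \<and> 4 \<le> c) \<or> (r < 4 \<and> c < 4 \<and> (r < 2 \<longrightarrow> c < 2)))"
  obtain X D where D: "D \<in> std_parabolic q J"
    and ent: "\<And>i j. i < p + q \<Longrightarrow> j < p + q \<Longrightarrow> A $$ (i, j) = (if i < p then if j < p then X $$ (i, j) else 0
    else if j < p then 0 else D $$ (i - p, j - p))"
    using block_diag_entry[OF A subset_refl std_parabolic_GL] by blast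
  have z: "D $$ (m, 0) = 0" "D $$ (Suc m, 0) = 0" "D $$ (m, Suc 0) = 0" "D $$ (Suc m, Suc 0) = 0"
    using std_parabolic_zero[OF D m(1)] m by auto
  have "r \<in> {0, 1, 2, 3, 4, 5, 6}" "c \<in> {0, 1, 2, 3, 4, 5, 6}" using rc by auto
  then show "A $$ (\<kappa> r, \<kappa> c) = 0" using R p m z by (auto simp: k[simplified] ent)
qed (auto simp: fam_plane_def)

lemma infinite_middle_left:
  assumes q: "3 \<le> q" and m: "m \<in> J" "2 \<le> m" "m + 2 \<le> p"
  shows "\<not> finite_double_cosets (p + q) (block_diag p q (std_parabolic p J) (carrier (GL q))) (UT (p + q))"
proof (rule infinite_double_cosets[OF subgroup_block_diag[OF subgroup_std_parabolic group.subgroup_self[OF group_GL]] _ _ _ _ _ rigid_plane])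
  define \<kappa> where "\<kappa> c = [m, m + 1, 0, 1, p, p + 1, p + 2] ! c" for c
  have k: "\<kappa> 0 = m" "\<kappa> 1 = m + 1" "\<kappa> 2 = 0" "\<kappa> 3 = 1" "\<kappa> 4 = p" "\<kappa> 5 = p + 1" "\<kappa> 6 = p + 2"
    by (simp_all add: \<kappa>_def)
  show "inj_on \<kappa> {..<7}" unfolding lessThan_numerals using q m by (auto simp: k[simplified])
  show "\<kappa> ` {..<7} \<subseteq> {..<p + q}" unfolding lessThan_numerals using q m by (auto simp: k[simplified])
  fix A and r c :: nat assume A: "A \<in> block_diag p q (std_parabolic p J) (carrier (GL q))" and rc: "r < 7" "c < 7"
    and R: "\<not> ((4 \<le> r \<and> 4 \<le> c) \<or> (r < 4 \<and> c < 4 \<and> (r < 2 \<longrightarrow> c < 2)))"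
  obtain X D where X: "X \<in> std_parabolic p J"
    and ent: "\<And>i j. i < p + q \<Longrightarrow> j < p + q \<Longrightarrow> A $$ (i, j) = (if i < p then if j < p then X $$ (i, j) else 0
    else if j < p then 0 else D $$ (i - p, j - p))"
    using block_diag_entry[OF A std_parabolic_GL subset_refl] by blast
  have z: "X $$ (m, 0) = 0" "X $$ (Suc m, 0) = 0" "X $$ (m, Suc 0) = 0" "X $$ (Suc m, Suc 0) = 0"
    using std_parabolic_zero[OF X m(1)] m by auto
  have "r \<in> {0, 1, 2, 3, 4, 5, 6}" "c \<in> {0, 1, 2, 3, 4, 5, 6}" using rc by auto
  then show "A $$ (\<kappa> r, \<kappa> c) = 0" using R q m z by (auto simp: k[simplified] ent)
qed (auto simp: fam_plane_def)

section \<open>Linear subspaces\<close>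

definition lin :: "nat \<Rightarrow> complex vec set \<Rightarrow> bool" where
  "lin n W \<longleftrightarrow> W \<subseteq> carrier_vec n \<and> 0\<^sub>v n \<in> W \<and> (\<forall>v\<in>W. \<forall>w\<in>W. v + w \<in> W) \<and> (\<forall>c. \<forall>v\<in>W. c \<cdot>\<^sub>v v \<in> W)"

definition cspace :: "nat \<Rightarrow> nat \<Rightarrow> complex vec set" where
  "cspace n m = {v \<in> carrier_vec n. \<forall>i<n. m \<le> i \<longrightarrow> v $ i = 0}"

lemma lin_cspace: "lin n (cspace n m)"
  by (auto simp: lin_def cspace_def)

lemma lin_carrier: "lin n (carrier_vec n)"
  by (auto simp: lin_def)

lemma lin_vec: "lin n W \<Longrightarrow> v \<in> W \<Longrightarrow> v \<in> carrier_vec n"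
  by (auto simp: lin_def)

lemma lin_sum:
  fixes k :: nat
  assumes W: "lin n W" and f: "\<And>j. j < k \<Longrightarrow> f j \<in> W"
  shows "vec n (\<lambda>a. \<Sum>j<k. c j * f j $ a) \<in> W"
  using f
proof (induction k)
  case 0
  have "vec n (\<lambda>a. \<Sum>j<0. c j * f j $ a) = 0\<^sub>v n" by auto
  then show ?case using W by (simp add: lin_def)
next
  case (Suc k)
  have "vec n (\<lambda>a. \<Sum>j<Suc k. c j * f j $ a) = vec n (\<lambda>a. \<Sum>j<k. c j * f j $ a) + c k \<cdot>\<^sub>v f k"
    using lin_vec[OF W Suc.prems[of k]] by auto
  then show ?case using Suc W by (simp add: lin_def)
qed

lemma matvec_entry:
  assumes "A \<in> carrier_mat m n" "v \<in> carrier_vec n" "i < m"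
  shows "(A *\<^sub>v v) $ i = (\<Sum>k<n. A $$ (i, k) * v $ k)"
  using assms by (auto simp: scalar_prod_def atLeast0LessThan)

lemma matvec_unit:
  fixes A :: "complex mat"
  assumes "A \<in> carrier_mat m n" "j < n" "i < m"
  shows "(A *\<^sub>v unit_vec n j) $ i = A $$ (i, j)"
proof -
  have "(A *\<^sub>v unit_vec n j) $ i = (\<Sum>k<n. if k = j then A $$ (i, k) else 0)"
    unfolding matvec_entry[OF assms(1) unit_vec_carrier assms(3)]
    by (rule sum.cong) (use assms in \<open>auto simp: unit_vec_def\<close>)
  then show ?thesis using assms by simp
qed

lemma GL_matvec_cancel [simp]:
  assumes "A \<in> carrier (GL n)" "v \<in> carrier_vec n"
  shows "ginv n A *\<^sub>v (A *\<^sub>v v) = v" "A *\<^sub>v (ginv n A *\<^sub>v v) = v"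
  using assoc_mult_mat_vec[of "ginv n A" n n A n v] assoc_mult_mat_vec[of A n n "ginv n A" n v] assms
  by (auto simp: GL_mat)

lemma GL_matvec_nonzero:
  assumes "A \<in> carrier (GL n)" "v \<in> carrier_vec n" "v \<noteq> 0\<^sub>v n"
  shows "A *\<^sub>v v \<noteq> 0\<^sub>v n"
proof
  assume "A *\<^sub>v v = 0\<^sub>v n"
  then have "ginv n A *\<^sub>v (0\<^sub>v n) = v" using GL_matvec_cancel(1)[OF assms(1,2)] by simp
  moreover have "ginv n A *\<^sub>v (0\<^sub>v n) = 0\<^sub>v n"
    using GL_mat[OF GL_inv_closed[OF assms(1)]] by (intro eq_vecI) (auto simp: scalar_prod_def)
  ultimately show False using assms(3) by simp
qed

lemma lin_image:
  assumes W: "lin n W" and g: "g \<in> carrier_mat n n"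
  shows "lin n ((\<lambda>v. g *\<^sub>v v) ` W)"
  unfolding lin_def
proof (intro conjI ballI allI)
  show "(\<lambda>v. g *\<^sub>v v) ` W \<subseteq> carrier_vec n"
    using mult_mat_vec_carrier[OF g] lin_vec[OF W] by blast
  have "g *\<^sub>v 0\<^sub>v n = 0\<^sub>v n" using g by (intro eq_vecI) (auto simp: scalar_prod_def)
  then show "0\<^sub>v n \<in> (\<lambda>v. g *\<^sub>v v) ` W" using W by (metis image_eqI lin_def)
  fix v w assume "v \<in> (\<lambda>v. g *\<^sub>v v) ` W" "w \<in> (\<lambda>v. g *\<^sub>v v) ` W"
  then obtain x y where xy: "x \<in> W" "y \<in> W" "v = g *\<^sub>v x" "w = g *\<^sub>v y" by blast
  have "v + w = g *\<^sub>v (x + y)" using xy mult_add_distrib_mat_vec[OF g] lin_vec[OF W] by simp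
  then show "v + w \<in> (\<lambda>v. g *\<^sub>v v) ` W" using xy W by (auto simp: lin_def)
next
  fix c v assume "v \<in> (\<lambda>v. g *\<^sub>v v) ` W"
  then obtain x where x: "x \<in> W" "v = g *\<^sub>v x" by blast
  have "c \<cdot>\<^sub>v v = g *\<^sub>v (c \<cdot>\<^sub>v x)" using x mult_mat_vec[OF g] lin_vec[OF W] by simp
  then show "c \<cdot>\<^sub>v v \<in> (\<lambda>v. g *\<^sub>v v) ` W" using x W by (auto simp: lin_def)
qed

text \<open>The positions of the last nonzero entries of the vectors of a subspace. They determine the
  dimension, and comparing them replaces dimension arguments.\<close>

definition lead :: "nat \<Rightarrow> complex vec set \<Rightarrow> nat set" where
  "lead n W = {i. i < n \<and> (\<exists>v\<in>W. v $ i \<noteq> 0 \<and> (\<forall>k<n. i < k \<longrightarrow> v $ k = 0))}"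

lemma finite_lead [simp]: "finite (lead n W)"
  by (simp add: lead_def)

lemma lead_mono: "U \<subseteq> W \<Longrightarrow> lead n U \<subseteq> lead n W"
  unfolding lead_def by blast

text \<open>Given a vector of \<open>W\<close>, subtracting multiples of vectors of \<open>U\<close> removes its nonzero entries from the
  last one on.\<close>

lemma lin_eq_lead:
  assumes U: "lin n U" and W: "lin n W" and UW: "U \<subseteq> W" and l: "lead n W \<subseteq> lead n U"
  shows "U = W"
proof -
  have *: "v \<in> U" if "m \<le> n" "v \<in> W" "\<forall>k<n. m \<le> k \<longrightarrow> v $ k = 0" for m v
    using that
  proof (induction m arbitrary: v)
    case 0
    then have "v = 0\<^sub>v n" using lin_vec[OF W] by (intro eq_vecI) auto
    then show ?case using U by (simp add: lin_def)
  next
    case (Suc m)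
    have vc: "v \<in> carrier_vec n" using lin_vec[OF W Suc.prems(2)] .
    show ?case
    proof (cases "v $ m = 0")
      case True
      then have "\<forall>k<n. m \<le> k \<longrightarrow> v $ k = 0" using Suc.prems(3) by (metis le_antisym not_less_eq_eq)
      then show ?thesis using Suc by simp
    next
      case False
      then have "m \<in> lead n W" using Suc.prems by (auto simp: lead_def)
      then have "m \<in> lead n U" using l by blast
      then obtain u where u: "u \<in> U" "u $ m \<noteq> 0" "\<forall>k<n. m < k \<longrightarrow> u $ k = 0" by (auto simp: lead_def)
      have uc: "u \<in> carrier_vec n" using lin_vec[OF U u(1)] .
      let ?c = "v $ m / u $ m"
      let ?v = "v + (- ?c) \<cdot>\<^sub>v u"
      have "?v \<in> W" using W Suc.prems(2) u(1) UW by (auto simp: lin_def)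
      moreover have "?v $ k = 0" if k: "k < n" "m \<le> k" for k
      proof (cases "k = m")
        case True
        then show ?thesis using uc vc k u(2) by simp
      next
        case False
        then show ?thesis using uc vc k u(3) Suc.prems(3) by simp
      qed
      ultimately have "?v \<in> U" using Suc by simp
      then have "?v + ?c \<cdot>\<^sub>v u \<in> U" using U u(1) by (simp add: lin_def)
      moreover have "?v + ?c \<cdot>\<^sub>v u = v" using uc vc by auto
      ultimately show ?thesis by simp
    qed
  qed
  have "W \<subseteq> U" using *[of n] by auto
  then show ?thesis using UW by blast
qed

text \<open>Strict inclusion lowers the number of leading positions, so a subspace that has as few of them as
  \<open>P\<close> permits is minimal.\<close>

lemma minimal_subspace:
  assumes "lin n W" "P W"
  shows "\<exists>U. lin n U \<and> P U \<and> U \<subseteq> W \<and> (\<forall>X. lin n X \<and> P X \<and> X \<subseteq> U \<longrightarrow> X = U)"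
proof -
  let ?S = "\<lambda>U. lin n U \<and> P U \<and> U \<subseteq> W"
  obtain U where U: "?S U" "\<forall>X. ?S X \<longrightarrow> card (lead n U) \<le> card (lead n X)"
    using ex_has_least_nat[of ?S W "\<lambda>U. card (lead n U)"] assms by blast
  have "X = U" if X: "lin n X" "P X" "X \<subseteq> U" for X
  proof -
    have "card (lead n U) \<le> card (lead n X)" using U X by blast
    then have "lead n X = lead n U" using lead_mono[OF X(3)] card_seteq[OF finite_lead] by blast
    then show ?thesis using lin_eq_lead[OF X(1) _ X(3)] U by blast
  qed
  then show ?thesis using U(1) by blast
qed

text \<open>Vectors of \<open>W\<close> with the possible leading positions, completed by unit vectors at the other
  positions, form a triangular matrix; permuting its columns moves a coordinate subspace onto \<open>W\<close>.\<close>

lemma lin_cspace_image: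
  assumes W: "lin n W"
  shows "\<exists>g\<in>carrier (GL n). \<exists>m\<le>n. W = (\<lambda>v. g *\<^sub>v v) ` cspace n m"
proof -
  let ?L = "lead n W"
  define w where "w i = (SOME v. v \<in> W \<and> v $ i \<noteq> 0 \<and> (\<forall>k<n. i < k \<longrightarrow> v $ k = 0))" for i
  have w: "w i \<in> W \<and> w i $ i \<noteq> 0 \<and> (\<forall>k<n. i < k \<longrightarrow> w i $ k = 0)" if "i \<in> ?L" for i
    unfolding w_def by (rule someI_ex) (use that in \<open>auto simp: lead_def\<close>)
  define C where "C = mat n n (\<lambda>(a, i). if i \<in> ?L then w i $ a else if a = i then 1 else 0)"
  have Cc: "C \<in> carrier_mat n n" by (simp add: C_def)
  have "upper_triangular C" using w by (auto simp: C_def)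
  then have "det C = prod_list (diag_mat C)" by (rule det_upper_triangular[OF _ Cc])
  moreover have "0 \<notin> set (diag_mat C)" using w by (auto simp: diag_mat_def C_def)
  ultimately have CG: "C \<in> carrier (GL n)" using Cc by (simp add: GL_carrier_iff prod_list_zero_iff)
  define m where "m = card ?L"
  have Ln: "?L \<subseteq> {..<n}" by (auto simp: lead_def)
  obtain \<kappa> where \<kappa>: "bij_betw \<kappa> {..<m} ?L"
    using ex_bij_betw_nat_finite[OF finite_lead[of n W]] unfolding m_def atLeast0LessThan by blast
  then have "inj_on \<kappa> {..<m}" "\<kappa> ` {..<m} = ?L" by (auto simp: bij_betw_def)
  then obtain \<sigma> where \<sigma>: "\<sigma> permutes {..<n}" "\<forall>c<m. \<sigma> c = \<kappa> c"
    using extend_to_permutation[of \<kappa> m n] Ln by auto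
  have mn: "m \<le> n" using card_mono[OF _ Ln] by (simp add: m_def)
  let ?g = "C * permmat n \<sigma>"
  have gG: "?g \<in> carrier (GL n)" using CG permmat_GL[OF \<sigma>(1)] by simp
  have \<sigma>L: "\<sigma> j \<in> ?L" if "j < m" for j using \<sigma>(2) \<open>\<kappa> ` {..<m} = ?L\<close> that by auto
  have g: "?g $$ (a, j) = w (\<sigma> j) $ a" if "a < n" "j < m" for a j
  proof -
    have "?g $$ (a, j) = C $$ (a, \<sigma> j)" using mult_permmat[OF Cc \<sigma>(1) that(1)] that mn by simp
    then show ?thesis using \<sigma>L[OF that(2)] that Ln by (auto simp: C_def)
  qed
  let ?U = "(\<lambda>v. ?g *\<^sub>v v) ` cspace n m"
  have U: "lin n ?U" using lin_image[OF lin_cspace] gG by blast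
  have UW: "?U \<subseteq> W"
  proof
    fix x assume "x \<in> ?U"
    then obtain v where v: "v \<in> cspace n m" "x = ?g *\<^sub>v v" by blast
    have vc: "v \<in> carrier_vec n" using v by (simp add: cspace_def)
    have "x = vec n (\<lambda>a. \<Sum>j<m. v $ j * w (\<sigma> j) $ a)"
    proof (rule eq_vecI)
      fix a assume "a < dim_vec (vec n (\<lambda>a. \<Sum>j<m. v $ j * w (\<sigma> j) $ a))"
      then have a: "a < n" by simp
      have "x $ a = (\<Sum>k<n. ?g $$ (a, k) * v $ k)"
        unfolding v(2) by (rule matvec_entry[OF GL_mat[OF gG] vc a])
      also have "\<dots> = (\<Sum>k<m. ?g $$ (a, k) * v $ k)"
        by (rule sum.mono_neutral_right) (use mn v in \<open>auto simp: cspace_def\<close>)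
      also have "\<dots> = (\<Sum>j<m. v $ j * w (\<sigma> j) $ a)"
        by (rule sum.cong) (use g a in auto)
      finally show "x $ a = vec n (\<lambda>a. \<Sum>j<m. v $ j * w (\<sigma> j) $ a) $ a" using a by simp
    qed (use v GL_mat[OF gG] in auto)
    moreover have "vec n (\<lambda>a. \<Sum>j<m. v $ j * w (\<sigma> j) $ a) \<in> W"
      by (rule lin_sum[OF W]) (use w \<sigma>L in blast)
    ultimately show "x \<in> W" by simp
  qed
  have "?L \<subseteq> lead n ?U"
  proof
    fix i assume i: "i \<in> ?L"
    then have "i \<in> \<kappa> ` {..<m}" using \<open>\<kappa> ` {..<m} = ?L\<close> by simp
    then obtain j where j: "j < m" "\<sigma> j = i" using \<sigma>(2) by auto
    have wc: "w i \<in> carrier_vec n" using lin_vec[OF W] w[OF i] by blast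
    have "?g *\<^sub>v unit_vec n j = w i"
    proof (rule eq_vecI)
      fix a assume "a < dim_vec (w i)"
      then have a: "a < n" using wc by simp
      show "(?g *\<^sub>v unit_vec n j) $ a = w i $ a"
        using matvec_unit[OF GL_mat[OF gG] _ a, of j] g[OF a j(1)] j mn by simp
    qed (use carrier_vecD[OF wc] carrier_matD[OF GL_mat[OF gG]] in simp)
    moreover have "unit_vec n j \<in> cspace n m" using j mn by (auto simp: cspace_def unit_vec_def)
    ultimately have "w i \<in> ?U" by (metis image_eqI)
    then show "i \<in> lead n ?U" using w[OF i] i by (auto simp: lead_def)
  qed
  then have "?U = W" using lin_eq_lead[OF U W UW] by blast
  then show ?thesis using gG mn by blast
qed

text \<open>Moving \<open>W\<close> to a coordinate subspace turns the restriction of \<open>Z\<close> into the upper left block of a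
  matrix, which has an eigenvalue because the complex numbers are algebraically closed.\<close>

lemma eigenvector_in_subspace:
  assumes W: "lin n W" "W \<noteq> {0\<^sub>v n}" and Z: "Z \<in> carrier_mat n n" and st: "\<forall>v\<in>W. Z *\<^sub>v v \<in> W"
  shows "\<exists>v\<in>W. v \<noteq> 0\<^sub>v n \<and> (\<exists>c. Z *\<^sub>v v = c \<cdot>\<^sub>v v)"
proof -
  obtain g m where g: "g \<in> carrier (GL n)" and m: "m \<le> n" and Wg: "W = (\<lambda>v. g *\<^sub>v v) ` cspace n m"
    using lin_cspace_image[OF W(1)] by blast
  note gm = GL_mat[OF g] and gim = GL_mat[OF GL_inv_closed[OF g]]
  have g0: "g *\<^sub>v 0\<^sub>v n = 0\<^sub>v n" using gm by (intro eq_vecI) (auto simp: scalar_prod_def)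
  have m0: "m > 0"
  proof (rule ccontr)
    assume "\<not> m > 0"
    then have "cspace n m = {0\<^sub>v n}" by (auto simp: cspace_def)
    then show False using W(2) Wg g0 by simp
  qed
  define T where "T = ginv n g * Z * g"
  have Tc: "T \<in> carrier_mat n n" unfolding T_def using gm gim Z by simp
  have gT: "g *\<^sub>v (T *\<^sub>v v) = Z *\<^sub>v (g *\<^sub>v v)" if v: "v \<in> carrier_vec n" for v
  proof -
    have "T *\<^sub>v v = ginv n g *\<^sub>v (Z *\<^sub>v (g *\<^sub>v v))"
      unfolding T_def using gm gim Z v by (simp add: assoc_mult_mat_vec[of _ n n _ n])
    then show ?thesis using g Z v gm by simp
  qed
  have T0: "T $$ (i, j) = 0" if ij: "j < m" "m \<le> i" "i < n" for i j
  proof -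
    have "unit_vec n j \<in> cspace n m" using ij m by (auto simp: cspace_def unit_vec_def)
    then have "Z *\<^sub>v (g *\<^sub>v unit_vec n j) \<in> W" using st Wg by blast
    then obtain v where v: "v \<in> cspace n m" "Z *\<^sub>v (g *\<^sub>v unit_vec n j) = g *\<^sub>v v" using Wg by blast
    have vc: "v \<in> carrier_vec n" using v by (simp add: cspace_def)
    have "g *\<^sub>v (T *\<^sub>v unit_vec n j) = g *\<^sub>v v" using gT[of "unit_vec n j"] v by simp
    then have "T *\<^sub>v unit_vec n j = v"
      using GL_matvec_cancel(1)[OF g] vc Tc by (metis mult_mat_vec_carrier unit_vec_carrier)
    then show ?thesis using matvec_unit[OF Tc _ ij(3), of j] ij m v by (auto simp: cspace_def)
  qed
  define M where "M = mat m m (\<lambda>(i, j). T $$ (i, j))"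
  have Mc: "M \<in> carrier_mat m m" by (simp add: M_def)
  obtain c u where u: "u \<in> carrier_vec m" "u \<noteq> 0\<^sub>v m" "M *\<^sub>v u = c \<cdot>\<^sub>v u"
    using spectrum_non_empty[OF Mc m0] Mc unfolding spectrum_def eigenvalue_def eigenvector_def by auto
  define v where "v = vec n (\<lambda>i. if i < m then u $ i else 0)"
  have vc: "v \<in> carrier_vec n" by (simp add: v_def)
  have vE: "v \<in> cspace n m" by (auto simp: cspace_def v_def)
  have v0: "v \<noteq> 0\<^sub>v n"
  proof
    assume "v = 0\<^sub>v n"
    have "u $ i = 0" if "i < m" for i
    proof -
      have "v $ i = u $ i" using that m by (simp add: v_def)
      then show ?thesis using \<open>v = 0\<^sub>v n\<close> that m by simp
    qed
    then have "u = 0\<^sub>v m" using u(1) by (intro eq_vecI) auto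
    then show False using u(2) by simp
  qed
  have "T *\<^sub>v v = c \<cdot>\<^sub>v v"
  proof (rule eq_vecI)
    fix i assume "i < dim_vec (c \<cdot>\<^sub>v v)"
    then have i: "i < n" by (simp add: v_def)
    have "(T *\<^sub>v v) $ i = (\<Sum>k<n. T $$ (i, k) * v $ k)" by (rule matvec_entry[OF Tc vc i])
    also have "\<dots> = (\<Sum>k<m. T $$ (i, k) * v $ k)"
      by (rule sum.mono_neutral_right) (use m in \<open>auto simp: v_def\<close>)
    finally have s: "(T *\<^sub>v v) $ i = (\<Sum>k<m. T $$ (i, k) * u $ k)" using m by (simp add: v_def)
    show "(T *\<^sub>v v) $ i = (c \<cdot>\<^sub>v v) $ i"
    proof (cases "i < m")
      case True
      have "(\<Sum>k<m. T $$ (i, k) * u $ k) = (\<Sum>k<m. M $$ (i, k) * u $ k)" using True by (simp add: M_def)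
      also have "\<dots> = (M *\<^sub>v u) $ i" using matvec_entry[OF Mc u(1) True] by simp
      finally show ?thesis using s u True i by (simp add: v_def)
    next
      case False
      then show ?thesis using s T0 i by (simp add: v_def)
    qed
  qed (use Tc in \<open>auto simp: v_def\<close>)
  then have "Z *\<^sub>v (g *\<^sub>v v) = c \<cdot>\<^sub>v (g *\<^sub>v v)" using gT[OF vc] mult_mat_vec[OF gm vc] by simp
  moreover have "g *\<^sub>v v \<in> W" using Wg vE by blast
  ultimately show ?thesis using GL_matvec_nonzero[OF g vc v0] by blast
qed

subsection \<open>Comparison with abstract vector spaces\<close>

lemma subspace_iff_lin: "subspace class_ring W (module_vec TYPE(complex) n) \<longleftrightarrow> lin n W"
proof
  assume "subspace class_ring W (module_vec TYPE(complex) n)"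
  then have "submodule class_ring W (module_vec TYPE(complex) n)" by (simp add: subspace_def)
  then show "lin n W" unfolding submodule_def lin_def by (simp add: module_vec_simps class_ring_simps)
next
  assume "lin n W"
  then have "submodule class_ring W (module_vec TYPE(complex) n)"
    unfolding submodule_def lin_def using vec_module by (auto simp: module_vec_simps class_ring_simps)
  then show "subspace class_ring W (module_vec TYPE(complex) n)"
    using vec_vs by (simp add: subspace_def)
qed

text \<open>Padding by zeros followed by \<open>g\<close> is an isomorphism from the space of vectors of length \<open>m\<close>.\<close>

lemma dim_cspace_image:
  assumes g: "g \<in> carrier (GL n)" and m: "m \<le> n"
  shows "vectorspace.dim class_ring (module_vec TYPE(complex) n\<lparr>carrier := (\<lambda>v. g *\<^sub>v v) ` cspace n m\<rparr>) = m"
proof -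
  let ?W = "(\<lambda>v. g *\<^sub>v v) ` cspace n m"
  let ?K = "class_ring :: complex ring"
  let ?VW = "module_vec TYPE(complex) n\<lparr>carrier := ?W\<rparr>" and ?VM = "module_vec TYPE(complex) m"
  note gm = GL_mat[OF g]
  have "lin n ?W" using lin_image[OF lin_cspace gm] .
  then have "subspace ?K ?W (module_vec TYPE(complex) n)" using subspace_iff_lin by blast
  then have vW: "vectorspace ?K ?VW" using vectorspace.subspace_is_vs[OF vec_vs] by blast
  have vM: "vectorspace ?K ?VM" by (rule vec_vs)
  define e where "e u = vec n (\<lambda>i. if i < m then u $ i else 0 :: complex)" for u
  define T where "T u = g *\<^sub>v e u" for u
  have ec: "e u \<in> cspace n m" for u by (auto simp: e_def cspace_def)
  have ev: "e u \<in> carrier_vec n" for u by (simp add: e_def)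
  have "T \<in> module_hom ?K ?VM ?VW"
  proof -
    have "T (u + v) = T u + T v" if "u \<in> carrier_vec m" "v \<in> carrier_vec m" for u v
    proof -
      have "e (u + v) = e u + e v" using that by (auto simp: e_def)
      then show ?thesis unfolding T_def using mult_add_distrib_mat_vec[OF gm ev ev] by simp
    qed
    moreover have "T (c \<cdot>\<^sub>v u) = c \<cdot>\<^sub>v T u" if "u \<in> carrier_vec m" for u c
    proof -
      have "e (c \<cdot>\<^sub>v u) = c \<cdot>\<^sub>v e u" using that by (auto simp: e_def)
      then show ?thesis unfolding T_def using mult_mat_vec[OF gm ev] by simp
    qed
    moreover have "T u \<in> ?W" for u unfolding T_def using ec by blast
    ultimately show ?thesis unfolding module_hom_def by (auto simp: module_vec_simps)
  qed
  then have lm: "linear_map ?K ?VM ?VW T"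
    unfolding linear_map_def mod_hom_def mod_hom_axioms_def using vM vW by (simp add: vectorspace_def)
  have e_inj: "u = v" if "u \<in> carrier_vec m" "v \<in> carrier_vec m" "e u = e v" for u v
  proof (rule eq_vecI)
    fix i assume "i < dim_vec v"
    then have i: "i < m" using that by simp
    have "e u $ i = e v $ i" using that by simp
    then show "u $ i = v $ i" using i m by (simp add: e_def)
  qed (use that in simp)
  have "inj_on T (carrier ?VM)"
  proof (rule inj_onI)
    fix u v assume uv: "u \<in> carrier ?VM" "v \<in> carrier ?VM" "T u = T v"
    then have "e u = e v" unfolding T_def using GL_matvec_cancel(1)[OF g ev] by metis
    then show "u = v" using e_inj uv by (simp add: module_vec_simps)
  qed
  moreover have "T ` carrier ?VM = carrier ?VW"
  proof -
    have "v \<in> e ` carrier_vec m" if "v \<in> cspace n m" for v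
    proof (rule image_eqI)
      show "v = e (vec m (\<lambda>i. v $ i))" using that m by (intro eq_vecI) (auto simp: e_def cspace_def)
    qed simp
    then have "e ` carrier_vec m = cspace n m" using ec by blast
    then show ?thesis unfolding T_def by (simp add: module_vec_simps image_image[symmetric, of "\<lambda>v. g *\<^sub>v v" e])
  qed
  ultimately have "vectorspace.dim ?K ?VM = vectorspace.dim ?K ?VW"
    using linear_map.dim_eq[OF lm] vec_space.fin_dim by blast
  then show ?thesis using vec_space.dim_is_n[of m] by metis
qed

section \<open>The Zariski topology\<close>

text \<open>Agreement with a polynomial is required on \<open>GL n\<close> only, so that functions may be rewritten by
  identities that hold for matrices of the right size.\<close>

definition poly_on :: "nat \<Rightarrow> (complex mat \<Rightarrow> complex) \<Rightarrow> bool" where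
  "poly_on n f \<longleftrightarrow> (\<exists>p\<in>poly_fun n. \<forall>A\<in>carrier (GL n). f A = p A)"

lemma poly_on_const [simp]: "poly_on n (\<lambda>_. c)"
  unfolding poly_on_def by (rule bexI[OF _ poly_fun.const[of c]]) simp

lemma poly_on_coord: "i < n \<Longrightarrow> j < n \<Longrightarrow> poly_on n (\<lambda>A. A $$ (i, j))"
  unfolding poly_on_def by (rule bexI[OF _ poly_fun.coord[of i n j]]) simp_all

lemma poly_on_add: "poly_on n f \<Longrightarrow> poly_on n g \<Longrightarrow> poly_on n (\<lambda>A. f A + g A)"
proof -
  assume "poly_on n f" "poly_on n g"
  then obtain p r where "p \<in> poly_fun n" "\<forall>A\<in>carrier (GL n). f A = p A"
    "r \<in> poly_fun n" "\<forall>A\<in>carrier (GL n). g A = r A" unfolding poly_on_def by blast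
  then show ?thesis unfolding poly_on_def
    by (intro bexI[of _ "\<lambda>A. p A + r A"] poly_fun.add) simp_all
qed

lemma poly_on_mult: "poly_on n f \<Longrightarrow> poly_on n g \<Longrightarrow> poly_on n (\<lambda>A. f A * g A)"
proof -
  assume "poly_on n f" "poly_on n g"
  then obtain p r where "p \<in> poly_fun n" "\<forall>A\<in>carrier (GL n). f A = p A"
    "r \<in> poly_fun n" "\<forall>A\<in>carrier (GL n). g A = r A" unfolding poly_on_def by blast
  then show ?thesis unfolding poly_on_def
    by (intro bexI[of _ "\<lambda>A. p A * r A"] poly_fun.mult) simp_all
qed

lemma poly_on_diff: "poly_on n f \<Longrightarrow> poly_on n g \<Longrightarrow> poly_on n (\<lambda>A. f A - g A)"
  using poly_on_add[OF _ poly_on_mult[OF poly_on_const[of n "-1"]], of f g] by simp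

lemma poly_on_sum: "(\<And>i. i \<in> I \<Longrightarrow> poly_on n (f i)) \<Longrightarrow> poly_on n (\<lambda>A. \<Sum>i\<in>I. f i A)"
  by (induction I rule: infinite_finite_induct) (auto intro: poly_on_add)

lemma poly_on_prod: "(\<And>i. i \<in> I \<Longrightarrow> poly_on n (f i)) \<Longrightarrow> poly_on n (\<lambda>A. \<Prod>i\<in>I. f i A)"
  by (induction I rule: infinite_finite_induct) (auto intro: poly_on_mult)

lemma poly_on_cong: "poly_on n f \<Longrightarrow> (\<And>A. A \<in> carrier (GL n) \<Longrightarrow> g A = f A) \<Longrightarrow> poly_on n g"
  unfolding poly_on_def by (erule bexE, rule bexI) simp_all

lemma poly_on_det:
  assumes "\<And>i j. i < m \<Longrightarrow> j < m \<Longrightarrow> poly_on n (\<lambda>A. F A i j)"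
  shows "poly_on n (\<lambda>A. det (mat m m (\<lambda>(i, j). F A i j)))"
proof -
  have "poly_on n (\<lambda>A. \<Sum>p\<in>{p. p permutes {0..<m}}. signof p * (\<Prod>i\<in>{0..<m}. F A i (p i)))"
    by (intro poly_on_sum poly_on_mult poly_on_const poly_on_prod assms) (auto simp: permutes_in_image)
  moreover have "det (mat m m (\<lambda>(i, j). F A i j))
      = (\<Sum>p\<in>{p. p permutes {0..<m}}. signof p * (\<Prod>i\<in>{0..<m}. F A i (p i)))" for A
    unfolding det_def by (auto intro!: sum.cong prod.cong simp: permutes_in_image)
  ultimately show ?thesis by simp
qed

lemma closedin_polys:
  assumes "\<And>i. i \<in> I \<Longrightarrow> poly_on n (f i)"
  shows "closedin (zariski n) {A \<in> carrier (GL n). \<forall>i\<in>I. f i A = 0}"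
proof -
  have "\<forall>i\<in>I. \<exists>p. p \<in> poly_fun n \<and> (\<forall>A\<in>carrier (GL n). f i A = p A)"
    using assms unfolding poly_on_def by blast
  then obtain P where P: "\<forall>i\<in>I. P i \<in> poly_fun n \<and> (\<forall>A\<in>carrier (GL n). f i A = P i A)"
    by metis
  show ?thesis unfolding closedin_zariski using P by (intro exI[of _ "P ` I"]) auto
qed

definition polymap :: "nat \<Rightarrow> nat \<Rightarrow> (complex mat \<Rightarrow> complex mat) \<Rightarrow> bool" where
  "polymap n m F \<longleftrightarrow> (\<forall>A\<in>carrier (GL n). F A \<in> carrier_mat m m) \<and>
     (\<forall>i<m. \<forall>j<m. poly_on n (\<lambda>A. F A $$ (i, j)))"

lemma polymap_const: "X \<in> carrier_mat m m \<Longrightarrow> polymap n m (\<lambda>_. X)"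
  by (simp add: polymap_def)

lemma polymap_id: "polymap n n (\<lambda>A. A)"
  by (auto simp: polymap_def poly_on_coord)

lemma polymap_mult:
  assumes F: "polymap n m F" and G: "polymap n m G"
  shows "polymap n m (\<lambda>A. F A * G A)"
  unfolding polymap_def
proof (intro conjI ballI allI impI)
  fix A assume "A \<in> carrier (GL n)"
  then show "F A * G A \<in> carrier_mat m m" using F G unfolding polymap_def by (metis mult_carrier_mat)
next
  fix i j assume ij: "i < m" "j < m"
  have "poly_on n (\<lambda>A. \<Sum>k<m. F A $$ (i, k) * G A $$ (k, j))"
    using F G ij unfolding polymap_def by (intro poly_on_sum poly_on_mult) auto
  then show "poly_on n (\<lambda>A. (F A * G A) $$ (i, j))"
  proof (rule poly_on_cong)
    fix A assume "A \<in> carrier (GL n)"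
    then show "(F A * G A) $$ (i, j) = (\<Sum>k<m. F A $$ (i, k) * G A $$ (k, j))"
      using F G ij by (intro mat_mult_entry) (auto simp: polymap_def)
  qed
qed

text \<open>The adjugate is polynomial in the entries and takes the place of the inverse, from which it differs
  by the factor \<open>det A\<close>.\<close>

lemma polymap_adj: "polymap n n adj_mat"
  unfolding polymap_def
proof (intro conjI ballI allI impI)
  fix A assume "A \<in> carrier (GL n)"
  then show "adj_mat A \<in> carrier_mat n n" using adj_mat(1) by blast
next
  fix i j assume ij: "i < n" "j < n"
  let ?D = "\<lambda>A. mat (n - 1) (n - 1) (\<lambda>(a, b). A $$ (if a < j then a else Suc a, if b < i then b else Suc b))"
  have "poly_on n (\<lambda>A. (- 1) ^ (j + i) * det (?D A))"
    by (intro poly_on_mult poly_on_const poly_on_det poly_on_coord) (use ij in auto)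
  then show "poly_on n (\<lambda>A. adj_mat A $$ (i, j))"
  proof (rule poly_on_cong)
    fix A assume "A \<in> carrier (GL n)"
    then have "A \<in> carrier_mat n n" by blast
    then show "adj_mat A $$ (i, j) = (- 1) ^ (j + i) * det (?D A)"
      using ij by (simp add: adj_mat_def cofactor_def mat_delete_def)
  qed
qed

lemma closedin_matvec_eq:
  assumes F: "polymap n n F" and G: "polymap n n G" and W: "W \<subseteq> carrier_vec n"
  shows "closedin (zariski n) {A \<in> carrier (GL n). \<forall>w\<in>W. F A *\<^sub>v w = c \<cdot>\<^sub>v (G A *\<^sub>v w)}"
proof -
  let ?f = "\<lambda>(w, i) A. (\<Sum>k<n. F A $$ (i, k) * w $ k) - c * (\<Sum>k<n. G A $$ (i, k) * w $ k)"
  have "closedin (zariski n) {A \<in> carrier (GL n). \<forall>wi\<in>W \<times> {..<n}. ?f wi A = 0}"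
  proof (rule closedin_polys)
    fix wi assume "wi \<in> W \<times> {..<n}"
    then obtain w i where wi: "wi = (w, i)" "w \<in> W" "i < n" by auto
    show "poly_on n (?f wi)" unfolding wi(1) split_conv
      by (intro poly_on_diff poly_on_sum poly_on_mult poly_on_const) (use F G wi in \<open>auto simp: polymap_def\<close>)
  qed
  also have "{A \<in> carrier (GL n). \<forall>wi\<in>W \<times> {..<n}. ?f wi A = 0}
      = {A \<in> carrier (GL n). \<forall>w\<in>W. F A *\<^sub>v w = c \<cdot>\<^sub>v (G A *\<^sub>v w)}"
  proof (rule Collect_cong, rule conj_cong[OF refl])
    fix A assume A: "A \<in> carrier (GL n)"
    have c: "F A \<in> carrier_mat n n" "G A \<in> carrier_mat n n" using F G A by (auto simp: polymap_def)
    have "F A *\<^sub>v w = c \<cdot>\<^sub>v (G A *\<^sub>v w) \<longleftrightarrow> (\<forall>i<n. ?f (w, i) A = 0)" if "w \<in> W" for w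
    proof -
      have wc: "w \<in> carrier_vec n" using that W by blast
      have "F A *\<^sub>v w = c \<cdot>\<^sub>v (G A *\<^sub>v w) \<longleftrightarrow> (\<forall>i<n. (F A *\<^sub>v w) $ i = c * (G A *\<^sub>v w) $ i)"
        using c by (auto simp: vec_eq_iff simp del: index_mult_mat_vec)
      then show ?thesis using matvec_entry[OF c(1) wc] matvec_entry[OF c(2) wc] by simp
    qed
    then show "(\<forall>wi\<in>W \<times> {..<n}. ?f wi A = 0) \<longleftrightarrow> (\<forall>w\<in>W. F A *\<^sub>v w = c \<cdot>\<^sub>v (G A *\<^sub>v w))"
      by auto
  qed
  finally show ?thesis .
qed

text \<open>The finitely many level sets are closed and disjoint, so only one of them is nonempty.\<close>

lemma connected_finite_valued:
  assumes con: "connectedin (zariski n) H" and fin: "finite (f ` H)"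
    and cl: "\<And>c. \<exists>D. closedin (zariski n) D \<and> {h \<in> H. f h = c} = H \<inter> D"
    and ab: "a \<in> H" "b \<in> H"
  shows "f a = f b"
proof (rule ccontr)
  assume ne: "f a \<noteq> f b"
  have "\<exists>D. \<forall>c. closedin (zariski n) (D c) \<and> {h \<in> H. f h = c} = H \<inter> D c"
    by (rule choice) (use cl in simp)
  then obtain D where "\<forall>c. closedin (zariski n) (D c) \<and> {h \<in> H. f h = c} = H \<inter> D c" by (rule exE)
  then have D: "closedin (zariski n) (D c)" "{h \<in> H. f h = c} = H \<inter> D c" for c by simp_all
  have mem: "h \<in> D c \<longleftrightarrow> f h = c" if "h \<in> H" for h c using D(2)[of c] that by blast
  let ?E = "\<Union>(D ` (f ` H - {f a}))"
  have "closedin (zariski n) ?E" using D(1) fin by (intro closedin_Union) auto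
  moreover have "closedin (zariski n) (D (f a))" using D(1) .
  moreover have "H \<subseteq> D (f a) \<union> ?E"
  proof
    fix h assume h: "h \<in> H"
    have "h \<in> D (f h)" using mem[OF h, of "f h"] by simp
    then show "h \<in> D (f a) \<union> ?E" using h by (cases "f h = f a") auto
  qed
  moreover have "D (f a) \<inter> ?E \<inter> H = {}"
  proof -
    have False if h: "h \<in> H" "h \<in> D (f a)" "c \<noteq> f a" "h \<in> D c" for h c
      using mem[OF h(1), of "f a"] mem[OF h(1), of c] h(2-4) by simp
    then show ?thesis by blast
  qed
  moreover have "D (f a) \<inter> H \<noteq> {}" using mem[OF ab(1), of "f a"] ab by blast
  moreover have "?E \<inter> H \<noteq> {}"
  proof -
    have "b \<in> D (f b)" "f b \<in> f ` H - {f a}" using mem[OF ab(2)] ab ne by auto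
    then have "b \<in> ?E" by (rule UN_I[rotated])
    then show ?thesis using ab by blast
  qed
  ultimately have "\<exists>E1 E2. closedin (zariski n) E1 \<and> closedin (zariski n) E2 \<and> H \<subseteq> E1 \<union> E2 \<and>
      E1 \<inter> E2 \<inter> H = {} \<and> E1 \<inter> H \<noteq> {} \<and> E2 \<inter> H \<noteq> {}"
    by (intro exI[of _ "D (f a)"] exI[of _ ?E] conjI)
  then show False by (rule notE[OF con[unfolded connectedin_closedin, THEN conjunct2]])
qed

lemma poly_fun_comp:
  assumes F: "polymap n m F" and f: "f \<in> poly_fun m"
  shows "poly_on n (\<lambda>A. f (F A))"
  using f
proof induction
  case (coord i j)
  then show ?case using F by (simp add: polymap_def)
next
  case (add f g)
  then show ?case by (intro poly_on_add)
next
  case (mult f g)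
  then show ?case by (intro poly_on_mult)
qed (rule poly_on_const)

lemma connected_image:
  assumes con: "connectedin (zariski n) H" and F: "polymap n m F"
    and H: "\<And>A. A \<in> H \<Longrightarrow> F A \<in> carrier (GL m)"
  shows "connectedin (zariski m) (F ` H)"
  unfolding connectedin_closedin
proof (intro conjI notI)
  show "F ` H \<subseteq> topspace (zariski m)" unfolding topspace_zariski using H by (rule image_subsetI)
  assume "\<exists>E1 E2. closedin (zariski m) E1 \<and> closedin (zariski m) E2 \<and> F ` H \<subseteq> E1 \<union> E2 \<and>
    E1 \<inter> E2 \<inter> F ` H = {} \<and> E1 \<inter> F ` H \<noteq> {} \<and> E2 \<inter> F ` H \<noteq> {}"
  then obtain E1 E2 where E: "closedin (zariski m) E1" "closedin (zariski m) E2" "F ` H \<subseteq> E1 \<union> E2"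
    "E1 \<inter> E2 \<inter> F ` H = {}" "E1 \<inter> F ` H \<noteq> {}" "E2 \<inter> F ` H \<noteq> {}" by (elim exE conjE)
  have HG: "H \<subseteq> carrier (GL n)" using connectedin_subset_topspace[OF con] by (simp add: topspace_zariski)
  have pre: "\<exists>D. closedin (zariski n) D \<and> H \<inter> D = {A \<in> H. F A \<in> E}" if cE: "closedin (zariski m) E" for E
  proof -
    obtain \<F> where \<F>: "\<F> \<subseteq> poly_fun m" "E = {A \<in> carrier (GL m). \<forall>f\<in>\<F>. f A = 0}"
      using cE unfolding closedin_zariski by blast
    have "closedin (zariski n) {A \<in> carrier (GL n). \<forall>f\<in>\<F>. f (F A) = 0}"
    proof (rule closedin_polys)
      fix f assume "f \<in> \<F>"
      then show "poly_on n (\<lambda>A. f (F A))" using \<F>(1) by (intro poly_fun_comp[OF F]) blast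
    qed
    moreover have "H \<inter> {A \<in> carrier (GL n). \<forall>f\<in>\<F>. f (F A) = 0} = {A \<in> H. F A \<in> E}"
    proof (intro equalityI subsetI)
      fix A assume "A \<in> H \<inter> {A \<in> carrier (GL n). \<forall>f\<in>\<F>. f (F A) = 0}"
      then show "A \<in> {A \<in> H. F A \<in> E}" unfolding \<F>(2) using H[of A] by simp
    next
      fix A assume "A \<in> {A \<in> H. F A \<in> E}"
      then show "A \<in> H \<inter> {A \<in> carrier (GL n). \<forall>f\<in>\<F>. f (F A) = 0}" unfolding \<F>(2) using HG by auto
    qed
    ultimately show ?thesis by (intro exI conjI)
  qed
  obtain D1 where D1: "closedin (zariski n) D1" "H \<inter> D1 = {A \<in> H. F A \<in> E1}" using pre[OF E(1)] by blast
  obtain D2 where D2: "closedin (zariski n) D2" "H \<inter> D2 = {A \<in> H. F A \<in> E2}" using pre[OF E(2)] by blast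
  have "H \<subseteq> D1 \<union> D2" "D1 \<inter> D2 \<inter> H = {}" "D1 \<inter> H \<noteq> {}" "D2 \<inter> H \<noteq> {}"
  proof -
    have m1: "A \<in> D1 \<longleftrightarrow> F A \<in> E1" and m2: "A \<in> D2 \<longleftrightarrow> F A \<in> E2" if "A \<in> H" for A
      using D1(2) D2(2) that by blast+
    show "H \<subseteq> D1 \<union> D2" using m1 m2 E(3) by blast
    show "D1 \<inter> D2 \<inter> H = {}" using m1 m2 E(4) by blast
    show "D1 \<inter> H \<noteq> {}" using m1 E(5) by blast
    show "D2 \<inter> H \<noteq> {}" using m2 E(6) by blast
  qed
  then have "\<exists>E1 E2. closedin (zariski n) E1 \<and> closedin (zariski n) E2 \<and> H \<subseteq> E1 \<union> E2 \<and>
      E1 \<inter> E2 \<inter> H = {} \<and> E1 \<inter> H \<noteq> {} \<and> E2 \<inter> H \<noteq> {}"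
    using D1(1) D2(1) by (intro exI[of _ D1] exI[of _ D2] conjI)
  then show False by (rule notE[OF con[unfolded connectedin_closedin, THEN conjunct2]])
qed

lemma polymap_conj:
  assumes "x \<in> carrier_mat n n" "y \<in> carrier_mat n n"
  shows "polymap n n (\<lambda>A. x * A * y)"
  by (intro polymap_mult polymap_const polymap_id assms)

text \<open>On the line through the identity and \<open>A\<close> a polynomial function is a polynomial in one variable; it
  vanishes identically or at finitely many points.\<close>

lemma poly_fun_line:
  assumes "f \<in> poly_fun n" and A: "A \<in> carrier_mat n n"
  shows "\<exists>p :: complex poly. \<forall>t. f (mat n n (\<lambda>(i, j). (1 - t) * (if i = j then 1 else 0) + t * A $$ (i, j))) = poly p t"
  using assms(1)
proof induction
  case (const c)
  show ?case by (intro exI[of _ "[:c:]"]) simp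
next
  case (coord i j)
  then show ?case
    by (intro exI[of _ "[:if i = j then 1 else 0, A $$ (i, j) - (if i = j then 1 else 0):]"]) (simp add: algebra_simps)
next
  case (add f g)
  then obtain p r where "\<forall>t. f (mat n n (\<lambda>(i, j). (1 - t) * (if i = j then 1 else 0) + t * A $$ (i, j))) = poly p t"
    "\<forall>t. g (mat n n (\<lambda>(i, j). (1 - t) * (if i = j then 1 else 0) + t * A $$ (i, j))) = poly r t" by blast
  then show ?case by (intro exI[of _ "p + r"]) simp
next
  case (mult f g)
  then obtain p r where "\<forall>t. f (mat n n (\<lambda>(i, j). (1 - t) * (if i = j then 1 else 0) + t * A $$ (i, j))) = poly p t"
    "\<forall>t. g (mat n n (\<lambda>(i, j). (1 - t) * (if i = j then 1 else 0) + t * A $$ (i, j))) = poly r t" by blast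
  then show ?case by (intro exI[of _ "p * r"]) simp
qed

section \<open>The Lie--Kolchin theorem\<close>

lemma GL_matvec_assoc:
  "A \<in> carrier (GL n) \<Longrightarrow> B \<in> carrier (GL n) \<Longrightarrow> v \<in> carrier_vec n \<Longrightarrow> (A * B) *\<^sub>v v = A *\<^sub>v (B *\<^sub>v v)"
  by (rule assoc_mult_mat_vec) auto

lemma GL_matvec_smult:
  "A \<in> carrier (GL n) \<Longrightarrow> v \<in> carrier_vec n \<Longrightarrow> A *\<^sub>v (c \<cdot>\<^sub>v v) = c \<cdot>\<^sub>v (A *\<^sub>v v)"
  by (rule mult_mat_vec) auto

lemma GL_matvec_closed:
  "A \<in> carrier (GL n) \<Longrightarrow> v \<in> carrier_vec n \<Longrightarrow> A *\<^sub>v v \<in> carrier_vec n"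
  by (rule mult_mat_vec_carrier) auto

lemma smult_vec_cancel:
  fixes v :: "complex vec"
  assumes "c \<cdot>\<^sub>v v = d \<cdot>\<^sub>v v" "v \<in> carrier_vec n" "v \<noteq> 0\<^sub>v n"
  shows "c = d"
proof -
  obtain i where i: "i < n" "v $ i \<noteq> 0" using assms(2,3) by (metis carrier_vecD eq_vecI index_zero_vec)
  have "(c \<cdot>\<^sub>v v) $ i = (d \<cdot>\<^sub>v v) $ i" using assms(1) by simp
  then show ?thesis using i assms(2) by simp
qed

definition eigvals :: "nat \<Rightarrow> complex mat \<Rightarrow> complex set" where
  "eigvals n x = {c. \<exists>v\<in>carrier_vec n. v \<noteq> 0\<^sub>v n \<and> x *\<^sub>v v = c \<cdot>\<^sub>v v}"

lemma finite_eigvals: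
  assumes "x \<in> carrier_mat n n"
  shows "finite (eigvals n x)"
proof -
  have "eigvals n x = spectrum x"
    using assms unfolding eigvals_def spectrum_def eigenvalue_def eigenvector_def by auto
  then show ?thesis using card_finite_spectrum(1)[OF assms] by simp
qed

definition acts_on :: "nat \<Rightarrow> complex mat set \<Rightarrow> complex vec set \<Rightarrow> bool" where
  "acts_on n H W \<longleftrightarrow> lin n W \<and> (\<forall>h\<in>H. \<forall>w\<in>W. h *\<^sub>v w \<in> W)"

definition irreducible_on :: "nat \<Rightarrow> complex mat set \<Rightarrow> complex vec set \<Rightarrow> bool" where
  "irreducible_on n H W \<longleftrightarrow> acts_on n H W \<and> W \<noteq> {0\<^sub>v n} \<and>
     (\<forall>U. acts_on n H U \<and> U \<noteq> {0\<^sub>v n} \<and> U \<subseteq> W \<longrightarrow> U = W)"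

definition scalar_on :: "complex vec set \<Rightarrow> complex mat \<Rightarrow> bool" where
  "scalar_on W x \<longleftrightarrow> (\<exists>c. \<forall>w\<in>W. x *\<^sub>v w = c \<cdot>\<^sub>v w)"

lemma lin_nonzero: "lin n W \<Longrightarrow> W \<noteq> {0\<^sub>v n} \<Longrightarrow> \<exists>w\<in>W. w \<noteq> 0\<^sub>v n"
  unfolding lin_def by blast

text \<open>On a minimal invariant subspace every element is a scalar, because its eigenspaces there are
  invariant under the commuting elements.\<close>

lemma common_eigenvector:
  assumes W: "acts_on n N W" "W \<noteq> {0\<^sub>v n}" and N: "N \<subseteq> carrier (GL n)"
    and comm: "\<And>x z w. x \<in> N \<Longrightarrow> z \<in> N \<Longrightarrow> w \<in> W \<Longrightarrow> x *\<^sub>v (z *\<^sub>v w) = z *\<^sub>v (x *\<^sub>v w)"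
  shows "\<exists>v\<in>W. v \<noteq> 0\<^sub>v n \<and> (\<forall>x\<in>N. \<exists>c. x *\<^sub>v v = c \<cdot>\<^sub>v v)"
proof -
  let ?P = "\<lambda>U. (\<forall>h\<in>N. \<forall>w\<in>U. h *\<^sub>v w \<in> U) \<and> U \<noteq> {0\<^sub>v n}"
  have "lin n W" "?P W" using W by (auto simp: acts_on_def)
  then have "\<exists>U. lin n U \<and> ?P U \<and> U \<subseteq> W \<and> (\<forall>X. lin n X \<and> ?P X \<and> X \<subseteq> U \<longrightarrow> X = U)"
    by (rule minimal_subspace)
  then obtain U where *: "lin n U \<and> ?P U \<and> U \<subseteq> W \<and> (\<forall>X. lin n X \<and> ?P X \<and> X \<subseteq> U \<longrightarrow> X = U)"
    by (rule exE)
  have U: "lin n U" "?P U" "U \<subseteq> W" and min: "\<forall>X. lin n X \<and> ?P X \<and> X \<subseteq> U \<longrightarrow> X = U"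
    using * by simp_all
  have sc: "\<exists>c. \<forall>w\<in>U. x *\<^sub>v w = c \<cdot>\<^sub>v w" if x: "x \<in> N" for x
  proof -
    have xG: "x \<in> carrier (GL n)" using x N by blast
    obtain u c where u: "u \<in> U" "u \<noteq> 0\<^sub>v n" "x *\<^sub>v u = c \<cdot>\<^sub>v u"
      using eigenvector_in_subspace[OF U(1) _ GL_mat[OF xG]] U(2) x by blast
    let ?X = "{w \<in> U. x *\<^sub>v w = c \<cdot>\<^sub>v w}"
    have "lin n ?X" unfolding lin_def
    proof (intro conjI ballI allI)
      show "?X \<subseteq> carrier_vec n" using lin_vec[OF U(1)] by blast
      have "x *\<^sub>v 0\<^sub>v n = c \<cdot>\<^sub>v 0\<^sub>v n" using GL_mat[OF xG] by (intro eq_vecI) (auto simp: scalar_prod_def)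
      then show "0\<^sub>v n \<in> ?X" using U(1) by (simp add: lin_def)
      fix v w assume vw: "v \<in> ?X" "w \<in> ?X"
      then have c': "v \<in> carrier_vec n" "w \<in> carrier_vec n" using lin_vec[OF U(1)] by auto
      have "x *\<^sub>v (v + w) = c \<cdot>\<^sub>v (v + w)"
        using vw mult_add_distrib_mat_vec[OF GL_mat[OF xG] c'] smult_add_distrib_vec[OF c'] by simp
      then show "v + w \<in> ?X" using vw U(1) by (simp add: lin_def)
    next
      fix a v assume v: "v \<in> ?X"
      then have c': "v \<in> carrier_vec n" using lin_vec[OF U(1)] by auto
      have "x *\<^sub>v (a \<cdot>\<^sub>v v) = c \<cdot>\<^sub>v (a \<cdot>\<^sub>v v)"
        using v GL_matvec_smult[OF xG c'] by (simp add: smult_smult_assoc mult.commute)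
      then show "a \<cdot>\<^sub>v v \<in> ?X" using v U(1) by (simp add: lin_def)
    qed
    moreover have "?P ?X"
    proof (intro conjI ballI)
      fix h w assume h: "h \<in> N" and w: "w \<in> ?X"
      then have hw: "h *\<^sub>v w \<in> U" using U(2) by blast
      have wc: "w \<in> carrier_vec n" using w lin_vec[OF U(1)] by blast
      have hG: "h \<in> carrier (GL n)" using h N by blast
      have "x *\<^sub>v (h *\<^sub>v w) = h *\<^sub>v (x *\<^sub>v w)" using comm[OF x h] w U(3) by blast
      also have "\<dots> = c \<cdot>\<^sub>v (h *\<^sub>v w)" using w GL_matvec_smult[OF hG wc] by simp
      finally show "h *\<^sub>v w \<in> ?X" using hw by simp
    next
      show "?X \<noteq> {0\<^sub>v n}" using u by blast
    qed
    ultimately have "?X = U" using min by blast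
    then show ?thesis by blast
  qed
  obtain v where "v \<in> U" "v \<noteq> 0\<^sub>v n" using lin_nonzero[OF U(1)] U(2) by blast
  then show ?thesis using sc U(3) by blast
qed

text \<open>The weights of a commuting normal subgroup on an irreducible module are permuted by \<open>H\<close>; there
  are finitely many of them, so a connected \<open>H\<close> fixes each weight.\<close>

lemma scalar_of_commuting:
  assumes H: "subgroup H (GL n)" and con: "connectedin (zariski n) H" and irr: "irreducible_on n H W"
    and N: "N \<subseteq> H" and norm: "\<And>g x. g \<in> H \<Longrightarrow> x \<in> N \<Longrightarrow> ginv n g * x * g \<in> N"
    and comm: "\<And>x z w. x \<in> N \<Longrightarrow> z \<in> N \<Longrightarrow> w \<in> W \<Longrightarrow> x *\<^sub>v (z *\<^sub>v w) = z *\<^sub>v (x *\<^sub>v w)"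
    and x: "x \<in> N"
  shows "scalar_on W x"
proof -
  note H' = subgroup_GL_D[OF H]
  have W: "lin n W" "W \<noteq> {0\<^sub>v n}" and HW: "\<And>h w. h \<in> H \<Longrightarrow> w \<in> W \<Longrightarrow> h *\<^sub>v w \<in> W"
    and min: "\<And>U. acts_on n H U \<Longrightarrow> U \<noteq> {0\<^sub>v n} \<Longrightarrow> U \<subseteq> W \<Longrightarrow> U = W"
    using irr unfolding irreducible_on_def acts_on_def by blast+
  have NG: "N \<subseteq> carrier (GL n)" using N H' by blast
  have "acts_on n N W" unfolding acts_on_def using W HW N by blast
  then obtain v where v: "v \<in> W" "v \<noteq> 0\<^sub>v n" "\<forall>x\<in>N. \<exists>c. x *\<^sub>v v = c \<cdot>\<^sub>v v"
    using common_eigenvector[OF _ W(2) NG comm] by blast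
  have vc: "v \<in> carrier_vec n" using lin_vec[OF W(1) v(1)] .
  define \<chi> where "\<chi> x = (SOME c. x *\<^sub>v v = c \<cdot>\<^sub>v v)" for x
  have \<chi>: "y *\<^sub>v v = \<chi> y \<cdot>\<^sub>v v" if "y \<in> N" for y
    unfolding \<chi>_def by (rule someI_ex) (use v(3) that in simp)
  have xG: "x \<in> carrier (GL n)" using x NG by blast
  define f where "f g = \<chi> (ginv n g * x * g)" for g
  have fx: "x *\<^sub>v (g *\<^sub>v v) = f g \<cdot>\<^sub>v (g *\<^sub>v v)" if g: "g \<in> H" for g
  proof -
    have gG: "g \<in> carrier (GL n)" using g H' by blast
    let ?y = "ginv n g * x * g"
    have y: "?y \<in> N" using norm[OF g x] .
    then have yG: "?y \<in> carrier (GL n)" using NG by blast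
    have "x *\<^sub>v (g *\<^sub>v v) = (x * g) *\<^sub>v v" using GL_matvec_assoc[OF xG gG vc] by simp
    also have "x * g = g * ?y" using xG gG by (simp add: GL_assoc[where n=n])
    also have "(g * ?y) *\<^sub>v v = g *\<^sub>v (?y *\<^sub>v v)" using GL_matvec_assoc[OF gG yG vc] .
    also have "\<dots> = f g \<cdot>\<^sub>v (g *\<^sub>v v)" unfolding \<chi>[OF y] f_def using GL_matvec_smult[OF gG vc] .
    finally show ?thesis .
  qed
  have gv: "g *\<^sub>v v \<in> carrier_vec n" "g *\<^sub>v v \<noteq> 0\<^sub>v n" if "g \<in> H" for g
    using GL_matvec_closed[OF _ vc] GL_matvec_nonzero[OF _ vc v(2)] that H' by blast+
  have fin: "finite (f ` H)"
  proof (rule finite_subset[OF _ finite_eigvals[OF GL_mat[OF xG]]])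
    show "f ` H \<subseteq> eigvals n x" using fx gv unfolding eigvals_def by blast
  qed
  \<comment> \<open>The condition \<open>x (g v) = c (g v)\<close> is polynomial in \<open>g\<close>, so the level sets are closed.\<close>
  have lev: "\<exists>D. closedin (zariski n) D \<and> {h \<in> H. f h = c} = H \<inter> D" for c
  proof (intro exI conjI)
    show "closedin (zariski n) {A \<in> carrier (GL n). \<forall>w\<in>{v}. (x * A) *\<^sub>v w = c \<cdot>\<^sub>v (A *\<^sub>v w)}"
      by (rule closedin_matvec_eq[OF polymap_mult[OF polymap_const[OF GL_mat[OF xG]] polymap_id] polymap_id])
        (use vc in simp)
    have "f h = c \<longleftrightarrow> (x * h) *\<^sub>v v = c \<cdot>\<^sub>v (h *\<^sub>v v)" if h: "h \<in> H" for h
    proof -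
      have hG: "h \<in> carrier (GL n)" using h H' by blast
      have "(x * h) *\<^sub>v v = f h \<cdot>\<^sub>v (h *\<^sub>v v)" using fx[OF h] GL_matvec_assoc[OF xG hG vc] by simp
      then show ?thesis using smult_vec_cancel[OF _ gv[OF h]] by auto
    qed
    then show "{h \<in> H. f h = c} = H \<inter> {A \<in> carrier (GL n). \<forall>w\<in>{v}. (x * A) *\<^sub>v w = c \<cdot>\<^sub>v (A *\<^sub>v w)}"
      using H'(1) by blast
  qed
  have const: "f g = f (1\<^sub>m n)" if "g \<in> H" for g
    using connected_finite_valued[OF con fin lev that H'(2)] .
  let ?c = "f (1\<^sub>m n)"
  let ?U = "{w \<in> W. \<forall>g\<in>H. x *\<^sub>v (g *\<^sub>v w) = ?c \<cdot>\<^sub>v (g *\<^sub>v w)}"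
  have "acts_on n H ?U" unfolding acts_on_def lin_def
  proof (intro conjI ballI allI)
    show "?U \<subseteq> carrier_vec n" using lin_vec[OF W(1)] by blast
    have z: "g *\<^sub>v 0\<^sub>v n = 0\<^sub>v n" if "g \<in> carrier (GL n)" for g
      using GL_mat[OF that] by (intro eq_vecI) (auto simp: scalar_prod_def)
    show "0\<^sub>v n \<in> ?U" using W(1) z H'(1) xG by (auto simp: lin_def subset_iff)
    fix a b assume ab: "a \<in> ?U" "b \<in> ?U"
    then have c': "a \<in> carrier_vec n" "b \<in> carrier_vec n" using lin_vec[OF W(1)] by auto
    have "x *\<^sub>v (g *\<^sub>v (a + b)) = ?c \<cdot>\<^sub>v (g *\<^sub>v (a + b))" if g: "g \<in> H" for g
    proof -
      have gG: "g \<in> carrier (GL n)" using g H' by blast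
      note d = GL_matvec_closed[OF gG c'(1)] GL_matvec_closed[OF gG c'(2)]
      show ?thesis
        using ab g mult_add_distrib_mat_vec[OF GL_mat[OF gG] c'] mult_add_distrib_mat_vec[OF GL_mat[OF xG] d]
          smult_add_distrib_vec[OF d] by simp
    qed
    then show "a + b \<in> ?U" using ab W(1) by (simp add: lin_def)
  next
    fix k a assume a: "a \<in> ?U"
    then have c': "a \<in> carrier_vec n" using lin_vec[OF W(1)] by auto
    have "x *\<^sub>v (g *\<^sub>v (k \<cdot>\<^sub>v a)) = ?c \<cdot>\<^sub>v (g *\<^sub>v (k \<cdot>\<^sub>v a))" if g: "g \<in> H" for g
    proof -
      have gG: "g \<in> carrier (GL n)" using g H' by blast
      show ?thesis using a g GL_matvec_smult[OF gG c'] GL_matvec_smult[OF xG GL_matvec_closed[OF gG c']]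
        by (simp add: smult_smult_assoc mult.commute)
    qed
    then show "k \<cdot>\<^sub>v a \<in> ?U" using a W(1) by (simp add: lin_def)
  next
    fix h a assume h: "h \<in> H" and a: "a \<in> ?U"
    then have c': "a \<in> carrier_vec n" using lin_vec[OF W(1)] by auto
    have hG: "h \<in> carrier (GL n)" using h H' by blast
    have "x *\<^sub>v (g *\<^sub>v (h *\<^sub>v a)) = ?c \<cdot>\<^sub>v (g *\<^sub>v (h *\<^sub>v a))" if g: "g \<in> H" for g
    proof -
      have gG: "g \<in> carrier (GL n)" using g H' by blast
      have "g * h \<in> H" using H'(3)[OF g h] .
      then show ?thesis using a GL_matvec_assoc[OF gG hG c'] by force
    qed
    then show "h *\<^sub>v a \<in> ?U" using HW[OF h] a by simp
  qed
  moreover have "v \<in> ?U" using v(1) fx const by simp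
  then have "?U \<noteq> {0\<^sub>v n}" using v(2) by blast
  ultimately have UW: "?U = W" using min[of ?U] by blast
  have "x *\<^sub>v w = ?c \<cdot>\<^sub>v w" if w: "w \<in> W" for w
  proof -
    have "w \<in> ?U" using w UW by blast
    then have "x *\<^sub>v (1\<^sub>m n *\<^sub>v w) = ?c \<cdot>\<^sub>v (1\<^sub>m n *\<^sub>v w)" using H'(2) by blast
    then show ?thesis using one_mult_mat_vec[OF lin_vec[OF W(1) w]] by simp
  qed
  then show ?thesis unfolding scalar_on_def by blast
qed

lemma smult_mat_mult_vec:
  fixes A :: "complex mat"
  assumes "A \<in> carrier_mat n n" "w \<in> carrier_vec n"
  shows "(k \<cdot>\<^sub>m A) *\<^sub>v w = k \<cdot>\<^sub>v (A *\<^sub>v w)"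
  using assms by (intro eq_vecI) auto

lemma zero_smult_vec: "v \<in> carrier_vec n \<Longrightarrow> (0 :: complex) \<cdot>\<^sub>v v = 0\<^sub>v n"
  by (intro eq_vecI) auto

lemma smult_one_mult:
  "(X :: complex mat) \<in> carrier_mat n n \<Longrightarrow> (d \<cdot>\<^sub>m 1\<^sub>m n) * X = d \<cdot>\<^sub>m X"
  using mult_smult_assoc_mat[of "1\<^sub>m n" n n X n d] by simp

lemma adj_ginv:
  assumes g: "g \<in> carrier (GL n)"
  shows "adj_mat g = det g \<cdot>\<^sub>m ginv n g"
proof -
  note gm = GL_mat[OF g] and im = GL_mat[OF GL_inv_closed[OF g]] and am = adj_mat(1)[OF GL_mat[OF g]]
  have "adj_mat g = adj_mat g * (g * ginv n g)" using am g by simp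
  also have "\<dots> = (adj_mat g * g) * ginv n g" using assoc_mult_mat[OF am gm im] by simp
  also have "\<dots> = det g \<cdot>\<^sub>m ginv n g" using adj_mat(3)[OF gm] smult_one_mult[OF im] by simp
  finally show ?thesis .
qed

text \<open>A proportionality factor that can take only finitely many values is constant on a connected
  group. The factor \<open>det h\<close> clears the denominators that inversion would introduce.\<close>

lemma constant_ratio:
  assumes con: "connectedin (zariski n) H" and HG: "H \<subseteq> carrier (GL n)" and W: "lin n W" and w0: "w0 \<in> W"
    and PQ: "\<And>h. h \<in> H \<Longrightarrow> P h \<in> carrier_mat n n" "\<And>h. h \<in> H \<Longrightarrow> Q h \<in> carrier (GL n)" and w0n: "w0 \<noteq> 0\<^sub>v n"
    and ex: "\<And>h. h \<in> H \<Longrightarrow> \<exists>c. \<forall>w\<in>W. P h *\<^sub>v w = c \<cdot>\<^sub>v (Q h *\<^sub>v w)"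
    and FG: "polymap n n F" "polymap n n G" "\<And>h. h \<in> H \<Longrightarrow> F h = det h \<cdot>\<^sub>m P h" "\<And>h. h \<in> H \<Longrightarrow> G h = det h \<cdot>\<^sub>m Q h"
    and S: "finite S" "\<And>h c. h \<in> H \<Longrightarrow> \<forall>w\<in>W. P h *\<^sub>v w = c \<cdot>\<^sub>v (Q h *\<^sub>v w) \<Longrightarrow> c \<in> S"
    and one: "1\<^sub>m n \<in> H"
  shows "\<exists>c. \<forall>h\<in>H. \<forall>w\<in>W. P h *\<^sub>v w = c \<cdot>\<^sub>v (Q h *\<^sub>v w)"
proof -
  define f where "f h = (SOME c. \<forall>w\<in>W. P h *\<^sub>v w = c \<cdot>\<^sub>v (Q h *\<^sub>v w))" for h
  have f: "\<forall>w\<in>W. P h *\<^sub>v w = f h \<cdot>\<^sub>v (Q h *\<^sub>v w)" if "h \<in> H" for h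
    unfolding f_def by (rule someI_ex[OF ex[OF that]])
  have w0c: "w0 \<in> carrier_vec n" using lin_vec[OF W w0] .
  have uniq: "f h = c \<longleftrightarrow> (\<forall>w\<in>W. P h *\<^sub>v w = c \<cdot>\<^sub>v (Q h *\<^sub>v w))" if h: "h \<in> H" for h c
  proof
    assume "\<forall>w\<in>W. P h *\<^sub>v w = c \<cdot>\<^sub>v (Q h *\<^sub>v w)"
    then have "f h \<cdot>\<^sub>v (Q h *\<^sub>v w0) = c \<cdot>\<^sub>v (Q h *\<^sub>v w0)" using f[OF h] w0 by simp
    then show "f h = c"
      by (rule smult_vec_cancel[OF _ GL_matvec_closed[OF PQ(2)[OF h] w0c] GL_matvec_nonzero[OF PQ(2)[OF h] w0c w0n]])
  next
    assume "f h = c"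
    then show "\<forall>w\<in>W. P h *\<^sub>v w = c \<cdot>\<^sub>v (Q h *\<^sub>v w)" using f[OF h] by simp
  qed
  have fin: "finite (f ` H)" by (rule finite_subset[OF _ S(1)]) (use S(2) f in blast)
  have lev: "\<exists>D. closedin (zariski n) D \<and> {h \<in> H. f h = c} = H \<inter> D" for c
  proof (intro exI conjI)
    have Wc: "W \<subseteq> carrier_vec n" using W by (simp add: lin_def)
    show "closedin (zariski n) {A \<in> carrier (GL n). \<forall>w\<in>W. F A *\<^sub>v w = c \<cdot>\<^sub>v (G A *\<^sub>v w)}"
      by (rule closedin_matvec_eq[OF FG(1,2) Wc])
    have eqv: "F h *\<^sub>v w = c \<cdot>\<^sub>v (G h *\<^sub>v w) \<longleftrightarrow> P h *\<^sub>v w = c \<cdot>\<^sub>v (Q h *\<^sub>v w)" if h: "h \<in> H" and w: "w \<in> W" for h w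
    proof -
      have wc: "w \<in> carrier_vec n" using lin_vec[OF W w] .
      have d: "det h \<noteq> 0" using h HG by (auto simp: GL_carrier_iff)
      have "F h *\<^sub>v w = det h \<cdot>\<^sub>v (P h *\<^sub>v w)" "G h *\<^sub>v w = det h \<cdot>\<^sub>v (Q h *\<^sub>v w)"
        unfolding FG(3)[OF h] FG(4)[OF h]
        using smult_mat_mult_vec[OF PQ(1)[OF h] wc] smult_mat_mult_vec[OF GL_mat[OF PQ(2)[OF h]] wc] .
      moreover have "a = b" if "det h \<cdot>\<^sub>v a = det h \<cdot>\<^sub>v b" for a b :: "complex vec"
      proof -
        have "(1 / det h) \<cdot>\<^sub>v (det h \<cdot>\<^sub>v a) = (1 / det h) \<cdot>\<^sub>v (det h \<cdot>\<^sub>v b)" using that by simp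
        then show ?thesis using d by (simp add: smult_smult_assoc)
      qed
      moreover have "c \<cdot>\<^sub>v (det h \<cdot>\<^sub>v (Q h *\<^sub>v w)) = det h \<cdot>\<^sub>v (c \<cdot>\<^sub>v (Q h *\<^sub>v w))"
        by (simp add: smult_smult_assoc mult.commute)
      ultimately show ?thesis by metis
    qed
    have "f h = c \<longleftrightarrow> (\<forall>w\<in>W. F h *\<^sub>v w = c \<cdot>\<^sub>v (G h *\<^sub>v w))" if h: "h \<in> H" for h
      unfolding uniq[OF h] by (rule ball_cong[OF refl], rule eqv[OF h, symmetric])
    then show "{h \<in> H. f h = c} = H \<inter> {A \<in> carrier (GL n). \<forall>w\<in>W. F A *\<^sub>v w = c \<cdot>\<^sub>v (G A *\<^sub>v w)}"
      using HG by blast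
  qed
  have "f h = f (1\<^sub>m n)" if "h \<in> H" for h
    using connected_finite_valued[OF con fin lev that one] .
  then show ?thesis using f by (intro exI[of _ "f (1\<^sub>m n)"]) metis
qed

text \<open>If commutators in \<open>N\<close> act by scalars, then conjugating by the connected group \<open>H\<close> cannot change
  these scalars, so \<open>[H, N]\<close> commutes with \<open>N\<close> and acts by scalars; by the same argument these are
  trivial, and \<open>N\<close> is central.\<close>

lemma scalar_of_derived:
  assumes H: "subgroup H (GL n)" and con: "connectedin (zariski n) H" and irr: "irreducible_on n H W"
    and Nsub: "subgroup N (GL n)" and N: "N \<subseteq> H" and norm: "\<And>g x. g \<in> H \<Longrightarrow> x \<in> N \<Longrightarrow> g * x * ginv n g \<in> N"
    and der: "\<And>x z. x \<in> N \<Longrightarrow> z \<in> N \<Longrightarrow> \<exists>c. \<forall>w\<in>W. (x * z) *\<^sub>v w = c \<cdot>\<^sub>v ((z * x) *\<^sub>v w)"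
    and x: "x \<in> N"
  shows "scalar_on W x"
proof -
  note H' = subgroup_GL_D[OF H] and N' = subgroup_GL_D[OF Nsub]
  have W: "lin n W" "W \<noteq> {0\<^sub>v n}" and HW: "\<And>h w. h \<in> H \<Longrightarrow> w \<in> W \<Longrightarrow> h *\<^sub>v w \<in> W"
    using irr unfolding irreducible_on_def acts_on_def by blast+
  obtain w0 where w0: "w0 \<in> W" "w0 \<noteq> 0\<^sub>v n" using lin_nonzero[OF W] by blast
  note Wc = lin_vec[OF W(1)]
  have G: "h \<in> carrier (GL n)" if "h \<in> H" for h using that H' by blast
  have NG: "h \<in> carrier (GL n)" if "h \<in> N" for h using that N' by blast
  have conj_poly: "h * x * adj_mat h = det h \<cdot>\<^sub>m (h * x * ginv n h)" if "h \<in> H" "x \<in> N" for h x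
  proof -
    have "h * x \<in> carrier_mat n n" "ginv n h \<in> carrier_mat n n"
      using GL_mat[OF GL_mult_closed[OF G[OF that(1)] NG[OF that(2)]]] GL_mat[OF GL_inv_closed[OF G[OF that(1)]]] .
    then show ?thesis using adj_ginv[OF G[OF that(1)]] by (simp add: mult_smult_distrib)
  qed
  have poly_conj: "polymap n n (\<lambda>A. A * x * adj_mat A)" if "x \<in> N" for x
    by (rule polymap_mult[OF polymap_mult[OF polymap_id polymap_const[OF GL_mat[OF NG[OF that]]]] polymap_adj])
  \<comment> \<open>The scalar by which the conjugate \<open>h x h\<^sup>-\<^sup>1\<close> commutes with \<open>z\<close> does not depend on \<open>h\<close>: if \<open>\<mu>\<close> is an
    eigenvalue of \<open>z\<close> on \<open>W\<close>, then so is \<open>\<mu> / c\<close>, which leaves finitely many values for \<open>c\<close>.\<close>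
  have step1: "\<exists>c. c \<noteq> 0 \<and> (\<forall>h\<in>H. \<forall>w\<in>W. ((h * x * ginv n h) * z) *\<^sub>v w = c \<cdot>\<^sub>v ((z * (h * x * ginv n h)) *\<^sub>v w))"
    if xz: "x \<in> N" "z \<in> N" for x z
  proof -
    let ?y = "\<lambda>h. h * x * ginv n h"
    have y: "?y h \<in> N" if "h \<in> H" for h using norm[OF that xz(1)] .
    obtain u \<mu> where u: "u \<in> W" "u \<noteq> 0\<^sub>v n" "z *\<^sub>v u = \<mu> \<cdot>\<^sub>v u"
      using eigenvector_in_subspace[OF W GL_mat[OF NG[OF xz(2)]]] HW xz(2) N by blast
    note uc = Wc[OF u(1)]
    have \<mu>0: "\<mu> \<noteq> 0"
    proof
      assume "\<mu> = 0"
      then have "z *\<^sub>v u = 0\<^sub>v n" using u(3) zero_smult_vec[OF uc] by simp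
      then show False using GL_matvec_nonzero[OF NG[OF xz(2)] uc u(2)] by simp
    qed
    have "\<exists>c. \<forall>h\<in>H. \<forall>w\<in>W. (?y h * z) *\<^sub>v w = c \<cdot>\<^sub>v ((z * ?y h) *\<^sub>v w)"
    proof (rule constant_ratio[OF con H'(1) W(1) w0(1) _ _ w0(2)])
      have zp: "polymap n n (\<lambda>_. z)" by (rule polymap_const[OF GL_mat[OF NG[OF xz(2)]]])
      show "polymap n n (\<lambda>A. A * x * adj_mat A * z)" by (rule polymap_mult[OF poly_conj[OF xz(1)] zp])
      show "polymap n n (\<lambda>A. z * (A * x * adj_mat A))" by (rule polymap_mult[OF zp poly_conj[OF xz(1)]])
      show "finite ((\<lambda>\<nu>. \<mu> / \<nu>) ` eigvals n z)" using finite_eigvals[OF GL_mat[OF NG[OF xz(2)]]] by simp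
      show "1\<^sub>m n \<in> H" using H'(2) .
      fix h assume h: "h \<in> H"
      note yG = NG[OF y[OF h]] and zG = NG[OF xz(2)]
      show "?y h * z \<in> carrier_mat n n" "z * ?y h \<in> carrier (GL n)"
        using GL_mat[OF GL_mult_closed[OF yG zG]] GL_mult_closed[OF zG yG] .
      show "\<exists>c. \<forall>w\<in>W. (?y h * z) *\<^sub>v w = c \<cdot>\<^sub>v ((z * ?y h) *\<^sub>v w)" using der[OF y[OF h] xz(2)] .
      show "h * x * adj_mat h * z = det h \<cdot>\<^sub>m (?y h * z)" "z * (h * x * adj_mat h) = det h \<cdot>\<^sub>m (z * ?y h)"
        unfolding conj_poly[OF h xz(1)]
        using mult_smult_assoc_mat[OF GL_mat[OF yG] GL_mat[OF zG]] mult_smult_distrib[OF GL_mat[OF zG] GL_mat[OF yG]] .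
      fix c assume c: "\<forall>w\<in>W. (?y h * z) *\<^sub>v w = c \<cdot>\<^sub>v ((z * ?y h) *\<^sub>v w)"
      let ?v = "?y h *\<^sub>v u"
      have vc: "?v \<in> carrier_vec n" using GL_matvec_closed[OF yG uc] .
      have v0: "?v \<noteq> 0\<^sub>v n" using GL_matvec_nonzero[OF yG uc u(2)] .
      have "(?y h * z) *\<^sub>v u = \<mu> \<cdot>\<^sub>v ?v" using GL_matvec_assoc[OF yG zG uc] u(3) GL_matvec_smult[OF yG uc] by simp
      then have e: "\<mu> \<cdot>\<^sub>v ?v = c \<cdot>\<^sub>v (z *\<^sub>v ?v)" using c u(1) GL_matvec_assoc[OF zG yG uc] by metis
      have c0: "c \<noteq> 0"
      proof
        assume "c = 0"
        then have "\<mu> \<cdot>\<^sub>v ?v = 0 \<cdot>\<^sub>v ?v" using e zero_smult_vec[OF GL_matvec_closed[OF zG vc]] zero_smult_vec[OF vc] by simp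
        then show False using smult_vec_cancel[OF _ vc v0] \<mu>0 by blast
      qed
      have "z *\<^sub>v ?v = (1 / c) \<cdot>\<^sub>v (c \<cdot>\<^sub>v (z *\<^sub>v ?v))" using c0 by (simp add: smult_smult_assoc)
      also have "\<dots> = (\<mu> / c) \<cdot>\<^sub>v ?v" unfolding e[symmetric] by (simp add: smult_smult_assoc)
      finally have "\<mu> / c \<in> eigvals n z" unfolding eigvals_def using vc v0 by blast
      moreover have "c = \<mu> / (\<mu> / c)" using \<mu>0 by simp
      ultimately show "c \<in> (\<lambda>\<nu>. \<mu> / \<nu>) ` eigvals n z" by (rule image_eqI[rotated])
    qed
    then obtain c where c: "\<forall>h\<in>H. \<forall>w\<in>W. (?y h * z) *\<^sub>v w = c \<cdot>\<^sub>v ((z * ?y h) *\<^sub>v w)" by (rule exE)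
    have "c \<noteq> 0"
    proof
      assume "c = 0"
      note yG = NG[OF y[OF H'(2)]] and zG = NG[OF xz(2)]
      have "(?y (1\<^sub>m n) * z) *\<^sub>v w0 = 0 \<cdot>\<^sub>v ((z * ?y (1\<^sub>m n)) *\<^sub>v w0)" using c H'(2) w0(1) \<open>c = 0\<close> by blast
      then have "(?y (1\<^sub>m n) * z) *\<^sub>v w0 = 0\<^sub>v n"
        using zero_smult_vec[OF GL_matvec_closed[OF GL_mult_closed[OF zG yG] Wc[OF w0(1)]]] by simp
      then show False using GL_matvec_nonzero[OF GL_mult_closed[OF yG zG] Wc[OF w0(1)] w0(2)] by simp
    qed
    then show ?thesis using c by blast
  qed
  \<comment> \<open>The elements of \<open>N\<close> that centralize \<open>N\<close> on \<open>W\<close>; they form a normal subset of \<open>H\<close> and act by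
    scalars.\<close>
  define M where "M = {t \<in> N. \<forall>z\<in>N. \<forall>w\<in>W. t *\<^sub>v (z *\<^sub>v w) = z *\<^sub>v (t *\<^sub>v w)}"
  have scalarM: "scalar_on W t" if t: "t \<in> M" for t
  proof (rule scalar_of_commuting[OF H con irr _ _ _ t])
    show "M \<subseteq> H" using N by (auto simp: M_def)
    show "a *\<^sub>v (b *\<^sub>v w) = b *\<^sub>v (a *\<^sub>v w)" if "a \<in> M" "b \<in> M" "w \<in> W" for a b w
      using that unfolding M_def by blast
    fix g s assume g: "g \<in> H" and s: "s \<in> M"
    have sN: "s \<in> N" using s by (simp add: M_def)
    let ?s = "ginv n g * s * g"
    have sN': "?s \<in> N" using norm[OF H'(4)[OF g] sN] G[OF g] by simp
    have "?s *\<^sub>v (z *\<^sub>v w) = z *\<^sub>v (?s *\<^sub>v w)" if z: "z \<in> N" and w: "w \<in> W" for z w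
    proof -
      let ?z = "g * z * ginv n g"
      have zN: "?z \<in> N" using norm[OF g z] .
      note gG = G[OF g] and sG = NG[OF sN] and zG = NG[OF z] and zG' = NG[OF zN] and wc = Wc[OF w]
      have gw: "g *\<^sub>v w \<in> W" using HW[OF g w] .
      note gwc = Wc[OF gw]
      have e: "?z * (g) = g * z" "ginv n g * ?z = z * ginv n g" using gG zG by (simp_all add: GL_assoc[where n=n])
      have "?s *\<^sub>v (z *\<^sub>v w) = ginv n g *\<^sub>v (s *\<^sub>v (g *\<^sub>v (z *\<^sub>v w)))"
        using gG sG zG wc GL_matvec_closed[OF zG wc]
        by (simp add: GL_matvec_assoc[where n=n] GL_assoc[where n=n] GL_matvec_closed[where n=n])
      also have "g *\<^sub>v (z *\<^sub>v w) = ?z *\<^sub>v (g *\<^sub>v w)"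
        using GL_matvec_assoc[OF gG zG wc] GL_matvec_assoc[OF zG' gG wc] e(1) by simp
      also have "s *\<^sub>v (?z *\<^sub>v (g *\<^sub>v w)) = ?z *\<^sub>v (s *\<^sub>v (g *\<^sub>v w))" using s zN gw by (simp add: M_def)
      also have "ginv n g *\<^sub>v (?z *\<^sub>v (s *\<^sub>v (g *\<^sub>v w))) = z *\<^sub>v (ginv n g *\<^sub>v (s *\<^sub>v (g *\<^sub>v w)))"
        using GL_matvec_assoc[OF GL_inv_closed[OF gG] zG' GL_matvec_closed[OF sG gwc]]
          GL_matvec_assoc[OF zG GL_inv_closed[OF gG] GL_matvec_closed[OF sG gwc]] e(2) by simp
      also have "ginv n g *\<^sub>v (s *\<^sub>v (g *\<^sub>v w)) = ?s *\<^sub>v w"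
        using gG sG wc gwc by (simp add: GL_matvec_assoc[where n=n] GL_assoc[where n=n] GL_matvec_closed[where n=n])
      finally show ?thesis .
    qed
    then show "?s \<in> M" using sN' by (simp add: M_def)
  qed
  \<comment> \<open>Both \<open>g x g\<^sup>-\<^sup>1\<close> and \<open>x\<close> commute with \<open>z\<close> up to the same scalar, so their quotient commutes
    with \<open>z\<close>.\<close>
  have inM: "g * x * ginv n g * ginv n x \<in> M" if g: "g \<in> H" for g
  proof -
    let ?y = "g * x * ginv n g"
    let ?t = "?y * ginv n x"
    have yN: "?y \<in> N" using norm[OF g x] .
    have tN: "?t \<in> N" using N'(3)[OF yN N'(4)[OF x]] .
    note xG = NG[OF x] and yG = NG[OF yN] and tG = NG[OF tN]
    have tx: "?t * x = ?y" using xG yG by (simp add: GL_assoc[where n=n])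
    have "?t *\<^sub>v (z *\<^sub>v w) = z *\<^sub>v (?t *\<^sub>v w)" if z: "z \<in> N" and w: "w \<in> W" for z w
    proof -
      note zG = NG[OF z]
      obtain c where c0: "c \<noteq> 0" and c: "\<forall>h\<in>H. \<forall>w\<in>W. ((h * x * ginv n h) * z) *\<^sub>v w = c \<cdot>\<^sub>v ((z * (h * x * ginv n h)) *\<^sub>v w)"
        using step1[OF x z] by blast
      let ?u = "ginv n x *\<^sub>v w"
      have u: "?u \<in> W" using HW[OF _ w] H'(4) x N by blast
      note uc = Wc[OF u]
      have w_eq: "w = x *\<^sub>v ?u" using xG Wc[OF w] by simp
      have cx: "(x * z) *\<^sub>v ?u = c \<cdot>\<^sub>v ((z * x) *\<^sub>v ?u)" using c[rule_format, OF H'(2) u] xG by simp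
      have cy: "(?y * z) *\<^sub>v ?u = c \<cdot>\<^sub>v ((z * ?y) *\<^sub>v ?u)" using c[rule_format, OF g u] .
      have zxu: "(z * x) *\<^sub>v ?u \<in> carrier_vec n" using GL_matvec_closed[OF GL_mult_closed[OF zG xG] uc] .
      have "c \<cdot>\<^sub>v (?t *\<^sub>v (z *\<^sub>v w)) = c \<cdot>\<^sub>v (?t *\<^sub>v ((z * x) *\<^sub>v ?u))"
        using w_eq GL_matvec_assoc[OF zG xG uc] by simp
      also have "\<dots> = ?t *\<^sub>v ((x * z) *\<^sub>v ?u)" unfolding cx using GL_matvec_smult[OF tG zxu] by simp
      also have "\<dots> = (?t * (x * z)) *\<^sub>v ?u" using GL_matvec_assoc[OF tG GL_mult_closed[OF xG zG] uc] by simp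
      also have "?t * (x * z) = ?y * z" using GL_assoc[OF tG xG zG] tx by simp
      also have "(?y * z) *\<^sub>v ?u = c \<cdot>\<^sub>v (z *\<^sub>v (?t *\<^sub>v w))"
        unfolding cy GL_matvec_assoc[OF zG yG uc] using tx GL_matvec_assoc[OF tG xG uc] w_eq by simp
      finally have "(1 / c) \<cdot>\<^sub>v (c \<cdot>\<^sub>v (?t *\<^sub>v (z *\<^sub>v w))) = (1 / c) \<cdot>\<^sub>v (c \<cdot>\<^sub>v (z *\<^sub>v (?t *\<^sub>v w)))" by simp
      then show ?thesis using c0 by (simp add: smult_smult_assoc)
    qed
    then show ?thesis using tN by (simp add: M_def)
  qed
  note xG = NG[OF x]
  obtain u \<mu> where u: "u \<in> W" "u \<noteq> 0\<^sub>v n" "x *\<^sub>v u = \<mu> \<cdot>\<^sub>v u"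
    using eigenvector_in_subspace[OF W GL_mat[OF xG]] HW x N by blast
  note uc = Wc[OF u(1)]
  have \<mu>0: "\<mu> \<noteq> 0"
  proof
    assume "\<mu> = 0"
    then have "x *\<^sub>v u = 0\<^sub>v n" using u(3) zero_smult_vec[OF uc] by simp
    then show False using GL_matvec_nonzero[OF xG uc u(2)] by simp
  qed
  \<comment> \<open>Hence \<open>h x h\<^sup>-\<^sup>1\<close> is \<open>c\<close> times \<open>x\<close> on \<open>W\<close>, and conjugate matrices have the same eigenvalues, which
    leaves finitely many values for \<open>c\<close>. It is constant, and \<open>h = 1\<close> shows that it is \<open>1\<close>.\<close>
  have "\<exists>c. \<forall>h\<in>H. \<forall>w\<in>W. (h * x * ginv n h) *\<^sub>v w = c \<cdot>\<^sub>v (x *\<^sub>v w)"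
  proof (rule constant_ratio[OF con H'(1) W(1) w0(1) _ _ w0(2)])
    show "polymap n n (\<lambda>A. A * x * adj_mat A)" using poly_conj[OF x] .
    show "polymap n n (\<lambda>A. A * adj_mat A * x)"
      by (rule polymap_mult[OF polymap_mult[OF polymap_id polymap_adj] polymap_const[OF GL_mat[OF xG]]])
    show "finite ((\<lambda>\<nu>. \<nu> / \<mu>) ` eigvals n x)" using finite_eigvals[OF GL_mat[OF xG]] by simp
    show "1\<^sub>m n \<in> H" using H'(2) .
    fix h assume h: "h \<in> H"
    let ?y = "h * x * ginv n h"
    note hG = G[OF h] and yG = NG[OF norm[OF h x]]
    show "?y \<in> carrier_mat n n" "x \<in> carrier (GL n)" using GL_mat[OF yG] xG .
    show "h * x * adj_mat h = det h \<cdot>\<^sub>m ?y" using conj_poly[OF h x] .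
    show "h * adj_mat h * x = det h \<cdot>\<^sub>m x"
      using adj_mat(2)[OF GL_mat[OF hG]] smult_one_mult[OF GL_mat[OF xG]] by simp
    let ?t = "?y * ginv n x"
    have tG: "?t \<in> carrier (GL n)" using yG xG by blast
    obtain c where c: "\<forall>w\<in>W. ?t *\<^sub>v w = c \<cdot>\<^sub>v w" using scalarM[OF inM[OF h]] unfolding scalar_on_def by blast
    have "?y *\<^sub>v w = c \<cdot>\<^sub>v (x *\<^sub>v w)" if w: "w \<in> W" for w
    proof -
      have "x *\<^sub>v w \<in> W" using HW[OF _ w] x N by blast
      then have "?t *\<^sub>v (x *\<^sub>v w) = c \<cdot>\<^sub>v (x *\<^sub>v w)" using c by blast
      moreover have "?t * x = ?y" using xG yG by (simp add: GL_assoc[where n=n])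
      ultimately show ?thesis using GL_matvec_assoc[OF tG xG Wc[OF w]] by simp
    qed
    then show "\<exists>c. \<forall>w\<in>W. ?y *\<^sub>v w = c \<cdot>\<^sub>v (x *\<^sub>v w)" by blast
    fix c assume c: "\<forall>w\<in>W. ?y *\<^sub>v w = c \<cdot>\<^sub>v (x *\<^sub>v w)"
    let ?v = "ginv n h *\<^sub>v u"
    have hiG: "ginv n h \<in> carrier (GL n)" using hG by simp
    have vc: "?v \<in> carrier_vec n" using GL_matvec_closed[OF hiG uc] .
    have v0: "?v \<noteq> 0\<^sub>v n" using GL_matvec_nonzero[OF hiG uc u(2)] .
    have "?y *\<^sub>v u = (c * \<mu>) \<cdot>\<^sub>v u" using c u by (simp add: smult_smult_assoc)
    then have "ginv n h *\<^sub>v (?y *\<^sub>v u) = (c * \<mu>) \<cdot>\<^sub>v ?v" using GL_matvec_smult[OF hiG uc] by simp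
    moreover have "ginv n h *\<^sub>v (?y *\<^sub>v u) = x *\<^sub>v ?v"
    proof -
      have "ginv n h * ?y = x * ginv n h" using hG xG by (simp add: GL_assoc[where n=n])
      then show ?thesis using GL_matvec_assoc[OF hiG yG uc] GL_matvec_assoc[OF xG hiG uc] by simp
    qed
    ultimately have "c * \<mu> \<in> eigvals n x" unfolding eigvals_def using vc v0 by auto
    moreover have "c = (c * \<mu>) / \<mu>" using \<mu>0 by simp
    ultimately show "c \<in> (\<lambda>\<nu>. \<nu> / \<mu>) ` eigvals n x" by (rule image_eqI[rotated])
  qed
  then obtain c where c: "\<forall>h\<in>H. \<forall>w\<in>W. (h * x * ginv n h) *\<^sub>v w = c \<cdot>\<^sub>v (x *\<^sub>v w)" by (rule exE)
  have "1 \<cdot>\<^sub>v (x *\<^sub>v w0) = c \<cdot>\<^sub>v (x *\<^sub>v w0)" using c[rule_format, OF H'(2) w0(1)] xG by simp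
  then have c1: "c = 1"
    using smult_vec_cancel[OF _ GL_matvec_closed[OF xG Wc[OF w0(1)]] GL_matvec_nonzero[OF xG Wc[OF w0(1)] w0(2)]] by metis
  have "x *\<^sub>v (z *\<^sub>v w) = z *\<^sub>v (x *\<^sub>v w)" if z: "z \<in> N" and w: "w \<in> W" for z w
  proof -
    note zG = NG[OF z] and wc = Wc[OF w]
    have zH: "z \<in> H" using z N by blast
    let ?y = "z * x * ginv n z"
    note yG = NG[OF norm[OF zH x]]
    have "?y *\<^sub>v (z *\<^sub>v w) = x *\<^sub>v (z *\<^sub>v w)" using c[rule_format, OF zH HW[OF zH w]] c1 by simp
    moreover have "?y * z = z * x" using zG xG by (simp add: GL_assoc[where n=n])
    ultimately show ?thesis using GL_matvec_assoc[OF yG zG wc] GL_matvec_assoc[OF zG xG wc] by simp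
  qed
  then have "x \<in> M" using x by (simp add: M_def)
  then show ?thesis by (rule scalarM)
qed

text \<open>Derived series computed in a subgroup and in \<open>GL n\<close> agree.\<close>

lemma solvable_of_derived:
  assumes K: "subgroup K (GL n)" and k: "(derived (GL n) ^^ k) K = {1\<^sub>m n}"
  shows "solvable (GL n\<lparr>carrier := K\<rparr>)"
proof -
  have "(derived (GL n\<lparr>carrier := K\<rparr>) ^^ j) K = (derived (GL n) ^^ j) K
      \<and> (derived (GL n) ^^ j) K \<subseteq> K" for j
  proof (induction j)
    case (Suc j)
    then show ?case
      using group.derived_consistent[OF group_GL _ K] group.derived_incl[OF group_GL _ K] by simp
  qed simp
  then show ?thesis
    using group.solvable_iff_trivial_derived_seq[OF group.subgroup_imp_group[OF group_GL K]] k by auto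
qed

text \<open>Descending induction along the derived series: its last term is trivial, and \<open>scalar_of_derived\<close>
  passes from the derived subgroup of a term to the term itself.\<close>

lemma irreducible_scalar:
  assumes H: "subgroup H (GL n)" and con: "connectedin (zariski n) H"
    and sol: "solvable (GL n\<lparr>carrier := H\<rparr>)" and irr: "irreducible_on n H W" and x: "x \<in> H"
  shows "scalar_on W x"
proof -
  let ?G = "GL n\<lparr>carrier := H\<rparr>"
  note H' = subgroup_GL_D[OF H]
  interpret G: group ?G using group.subgroup_imp_group[OF group_GL H] .
  have W: "lin n W" and HW: "\<And>h w. h \<in> H \<Longrightarrow> w \<in> W \<Longrightarrow> h *\<^sub>v w \<in> W"
    using irr unfolding irreducible_on_def acts_on_def by blast+
  have ginvG: "inv\<^bsub>?G\<^esub> h = ginv n h" if "h \<in> H" for h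
    using group.m_inv_consistent[OF group_GL H that] .
  define D where "D k = (derived ?G ^^ k) H" for k
  have Dnorm: "D k \<lhd> ?G" for k
  proof (induction k)
    case 0
    then show ?case using G.normal_self by (simp add: D_def)
  next
    case (Suc k)
    then show ?case using G.derived_is_normal by (simp add: D_def)
  qed
  have DH: "D k \<subseteq> H" for k
    using subgroup.subset[OF normal_imp_subgroup[OF Dnorm[of k]]] by simp
  have Dsub: "subgroup (D k) (GL n)" for k
    using group.incl_subgroup[OF group_GL H normal_imp_subgroup[OF Dnorm[of k]]] .
  have Dconj: "g * d * ginv n g \<in> D k" if "g \<in> H" "d \<in> D k" for g d k
    using normal.inv_op_closed2[OF Dnorm[of k], of g d] that ginvG by simp
  obtain m where m: "D m = {1\<^sub>m n}"
    using sol unfolding G.solvable_iff_trivial_derived_seq D_def by auto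
  have "\<forall>x\<in>D (m - k). scalar_on W x" if "k \<le> m" for k
    using that
  proof (induction k)
    case 0
    have "1\<^sub>m n *\<^sub>v w = 1 \<cdot>\<^sub>v w" if "w \<in> W" for w
      using one_mult_mat_vec[OF lin_vec[OF W that]] by simp
    then have "scalar_on W (1\<^sub>m n)" unfolding scalar_on_def by (intro exI[of _ 1] ballI)
    then show ?case using m by simp
  next
    case (Suc k)
    let ?N = "D (m - Suc k)"
    have Dk: "D (m - k) = derived ?G ?N"
    proof -
      have "m - k = Suc (m - Suc k)" using Suc.prems by simp
      then show ?thesis by (simp add: D_def)
    qed
    have sc: "\<forall>x\<in>D (m - k). scalar_on W x" using Suc by simp
    show ?case
    proof
      fix x assume x: "x \<in> ?N"
      show "scalar_on W x"
      proof (rule scalar_of_derived[OF H con irr Dsub DH Dconj _ x])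
        fix a b assume a: "a \<in> ?N" and b: "b \<in> ?N"
        have aH: "a \<in> H" and bH: "b \<in> H" using a b DH by blast+
        have aG: "a \<in> carrier (GL n)" and bG: "b \<in> carrier (GL n)" using aH bH H' by blast+
        let ?t = "a * b * ginv n a * ginv n b"
        have "?t \<in> derived_set ?G ?N" using a b ginvG[OF aH] ginvG[OF bH] by force
        then have "?t \<in> D (m - k)" unfolding Dk derived_def by (rule generate.incl)
        then obtain c where c: "\<forall>w\<in>W. ?t *\<^sub>v w = c \<cdot>\<^sub>v w" using sc unfolding scalar_on_def by blast
        have tG: "?t \<in> carrier (GL n)" using aG bG by simp
        have "(a * b) *\<^sub>v w = c \<cdot>\<^sub>v ((b * a) *\<^sub>v w)" if w: "w \<in> W" for w
        proof -
          note wc = lin_vec[OF W w]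
          have "(b * a) *\<^sub>v w = b *\<^sub>v (a *\<^sub>v w)" using GL_matvec_assoc[OF bG aG wc] .
          then have "(b * a) *\<^sub>v w \<in> W" using HW aH bH w by simp
          then have "?t *\<^sub>v ((b * a) *\<^sub>v w) = c \<cdot>\<^sub>v ((b * a) *\<^sub>v w)" using c by blast
          moreover have "?t * (b * a) = a * b" using aG bG by (simp add: GL_assoc[where n=n])
          ultimately show ?thesis using GL_matvec_assoc[OF tG GL_mult_closed[OF bG aG] wc] by simp
        qed
        then show "\<exists>c. \<forall>w\<in>W. (a * b) *\<^sub>v w = c \<cdot>\<^sub>v ((b * a) *\<^sub>v w)" by blast
      qed
    qed
  qed
  from this[of m] have "\<forall>x\<in>D 0. scalar_on W x" by simp
  then show ?thesis using x by (simp add: D_def)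
qed

lemma solvable_common_eigenvector:
  assumes H: "subgroup H (GL n)" and con: "connectedin (zariski n) H"
    and sol: "solvable (GL n\<lparr>carrier := H\<rparr>)" and n: "n > 0"
  shows "\<exists>v\<in>carrier_vec n. v \<noteq> 0\<^sub>v n \<and> (\<forall>h\<in>H. \<exists>c. h *\<^sub>v v = c \<cdot>\<^sub>v v)"
proof -
  let ?P = "\<lambda>U. (\<forall>h\<in>H. \<forall>w\<in>U. h *\<^sub>v w \<in> U) \<and> U \<noteq> {0\<^sub>v n}"
  have "(unit_vec n 0 :: complex vec) \<noteq> 0\<^sub>v n"
  proof
    assume "unit_vec n 0 = (0\<^sub>v n :: complex vec)"
    then have "(unit_vec n 0 :: complex vec) $ 0 = 0\<^sub>v n $ 0" by (rule arg_cong)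
    then show False using n by simp
  qed
  then have "carrier_vec n \<noteq> {0\<^sub>v n :: complex vec}" using unit_vec_carrier[of n 0] by (metis singletonD)
  moreover have "h *\<^sub>v w \<in> carrier_vec n" if "h \<in> H" "w \<in> carrier_vec n" for h w
    using GL_matvec_closed[OF subsetD[OF subgroup_GL_D(1)[OF H] that(1)] that(2)] .
  ultimately have "?P (carrier_vec n)" by simp
  then have "\<exists>U. lin n U \<and> ?P U \<and> U \<subseteq> carrier_vec n \<and> (\<forall>X. lin n X \<and> ?P X \<and> X \<subseteq> U \<longrightarrow> X = U)"
    by (intro minimal_subspace[OF lin_carrier])
  then obtain W where *: "lin n W \<and> ?P W \<and> W \<subseteq> carrier_vec n \<and> (\<forall>X. lin n X \<and> ?P X \<and> X \<subseteq> W \<longrightarrow> X = W)"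
    by (rule exE)
  then have irr: "irreducible_on n H W" unfolding irreducible_on_def acts_on_def by simp
  have W: "lin n W" "W \<noteq> {0\<^sub>v n}" using * by simp_all
  obtain v where v: "v \<in> W" "v \<noteq> 0\<^sub>v n" using lin_nonzero[OF W] by blast
  have "\<exists>c. h *\<^sub>v v = c \<cdot>\<^sub>v v" if "h \<in> H" for h
    using irreducible_scalar[OF H con sol irr that] v(1) unfolding scalar_on_def by blast
  then show ?thesis using v lin_vec[OF W(1)] by blast
qed

lemma first_column:
  assumes v: "v \<in> carrier_vec n" "v \<noteq> 0\<^sub>v n"
  shows "\<exists>y\<in>carrier (GL n). \<forall>i<n. y $$ (i, 0) = v $ i"
proof -
  obtain i where i: "i < n" "v $ i \<noteq> 0" using v by (metis carrier_vecD eq_vecI index_zero_vec)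
  let ?\<tau> = "Transposition.transpose 0 i"
  have \<tau>: "?\<tau> permutes {..<n}" using i by (intro permutes_swap_id) auto
  let ?y = "colmat n i (\<lambda>k. v $ k) * permmat n ?\<tau>"
  have "colmat n i (\<lambda>k. v $ k) \<in> carrier (GL n)" using i by (intro colmat_GL)
  then have "?y \<in> carrier (GL n)" using permmat_GL[OF \<tau>] by simp
  moreover have "?y $$ (k, 0) = v $ k" if "k < n" for k
    using mult_permmat[OF colmat_carrier \<tau> that, of 0 i "\<lambda>k. v $ k"] i that by (simp add: colmat_def)
  ultimately show ?thesis by blast
qed

lemma below_diagonal_zero_of_corner:
  assumes "A \<in> carrier_mat (1 + n) (1 + n)" "\<And>i. 0 < i \<Longrightarrow> i < 1 + n \<Longrightarrow> A $$ (i, 0) = 0"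
    "\<And>i j. i < n \<Longrightarrow> j < i \<Longrightarrow> A $$ (1 + i, 1 + j) = 0" "i < 1 + n" "j < i"
  shows "A $$ (i, j) = 0"
proof (cases j)
  case 0
  then show ?thesis using assms by simp
next
  case (Suc k)
  then show ?thesis using assms(3)[of "i - 1" k] assms(4,5) by simp
qed

text \<open>Lie--Kolchin, by induction on the size: a common eigenvector splits off a \<open>1 \<times> 1\<close> block, and the
  complementary block is again a connected solvable group.\<close>

theorem lie_kolchin:
  assumes "subgroup H (GL n)" "connectedin (zariski n) H" "solvable (GL n\<lparr>carrier := H\<rparr>)"
  shows "\<exists>x\<in>carrier (GL n). \<forall>h\<in>H. ginv n x * h * x \<in> UT n"
  using assms
proof (induction n arbitrary: H)
  case 0
  have "ginv 0 (1\<^sub>m 0) * h * 1\<^sub>m 0 \<in> UT 0" if "h \<in> H" for h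
    using subgroup_GL_D(1)[OF 0(1)] that by (auto simp: pat_def)
  then show ?case using GL_one_closed by blast
next
  case (Suc n)
  let ?n = "Suc n"
  note H = Suc.prems(1) and con = Suc.prems(2) and sol = Suc.prems(3)
  note H' = subgroup_GL_D[OF H]
  obtain v where v: "v \<in> carrier_vec ?n" "v \<noteq> 0\<^sub>v ?n" and ev: "\<forall>h\<in>H. \<exists>c. h *\<^sub>v v = c \<cdot>\<^sub>v v"
    using solvable_common_eigenvector[OF H con sol] by auto
  obtain y where yG: "y \<in> carrier (GL ?n)" and y: "\<forall>i<?n. y $$ (i, 0) = v $ i"
    using first_column[OF v] by blast
  have yv: "y *\<^sub>v unit_vec ?n 0 = v"
    using v(1) matvec_unit[OF GL_mat[OF yG], of 0] y GL_mat[OF yG] by (intro eq_vecI) auto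
  define C where "C h = ginv ?n y * h * y" for h
  have CG: "C h \<in> carrier (GL ?n)" if "h \<in> H" for h unfolding C_def using that H' yG by blast
  have Cmult: "C (g * h) = C g * C h" if "g \<in> H" "h \<in> H" for g h
    unfolding C_def using that H'(1) yG by (auto simp: GL_assoc[where n="?n"] subset_iff)
  have C0: "C h $$ (i, 0) = 0" if h: "h \<in> H" and i: "0 < i" "i < ?n" for h i
  proof -
    have hG: "h \<in> carrier (GL ?n)" using h H' by blast
    obtain c where c: "h *\<^sub>v v = c \<cdot>\<^sub>v v" using ev h by blast
    have "C h *\<^sub>v unit_vec ?n 0 = ginv ?n y *\<^sub>v (h *\<^sub>v (y *\<^sub>v unit_vec ?n 0))"
      unfolding C_def using yG hG by (simp add: GL_matvec_assoc[where n="?n"] GL_matvec_closed[where n="?n"])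
    also have "\<dots> = c \<cdot>\<^sub>v (ginv ?n y *\<^sub>v v)" unfolding yv c using GL_matvec_smult[OF GL_inv_closed[OF yG] v(1)] .
    also have "ginv ?n y *\<^sub>v v = unit_vec ?n 0" unfolding yv[symmetric] using yG by simp
    finally have "(C h *\<^sub>v unit_vec ?n 0) $ i = (c \<cdot>\<^sub>v unit_vec ?n 0) $ i" by simp
    then show ?thesis using matvec_unit[OF GL_mat[OF CG[OF h]] _ i(2), of 0] i by simp
  qed
  \<comment> \<open>The action on the quotient by the common eigenvector; it is a homomorphism because the first column
    of \<open>C h\<close> vanishes below the diagonal.\<close>
  define F where "F h = mat n n (\<lambda>(i, j). C h $$ (Suc i, Suc j))" for h
  have Fc: "F h \<in> carrier_mat n n" for h by (simp add: F_def)
  have Fmult: "F (g * h) = F g * F h" if gh: "g \<in> H" "h \<in> H" for g h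
  proof (rule eq_matI)
    fix i j assume "i < dim_row (F g * F h)" "j < dim_col (F g * F h)"
    then have ij: "i < n" "j < n" by (auto simp: F_def)
    have "F (g * h) $$ (i, j) = (\<Sum>k<?n. C g $$ (Suc i, k) * C h $$ (k, Suc j))"
      using ij Cmult[OF gh] GL_mult_entry[OF CG[OF gh(1)] CG[OF gh(2)], of "Suc i" "Suc j"] by (simp add: F_def)
    also have "\<dots> = (\<Sum>k<n. C g $$ (Suc i, Suc k) * C h $$ (Suc k, Suc j))"
      unfolding sum.lessThan_Suc_shift using C0[OF gh(1), of "Suc i"] ij by simp
    also have "\<dots> = (F g * F h) $$ (i, j)"
      unfolding mat_mult_entry[OF Fc Fc ij] using ij by (simp add: F_def)
    finally show "F (g * h) $$ (i, j) = (F g * F h) $$ (i, j)" .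
  qed (auto simp: F_def)
  have F1: "F (1\<^sub>m ?n) = 1\<^sub>m n"
    using yG by (intro eq_matI) (auto simp: F_def C_def)
  have FG: "F h \<in> carrier (GL n)" if h: "h \<in> H" for h
  proof (rule GL_memI[OF Fc Fc])
    show "F h * F (ginv ?n h) = 1\<^sub>m n" using Fmult[OF h H'(4)[OF h]] F1 h H' by auto
  qed
  let ?G = "GL ?n\<lparr>carrier := H\<rparr>"
  have grp: "group ?G" using group.subgroup_imp_group[OF group_GL H] .
  have hom: "group_hom ?G (GL n) F"
    by (intro group_hom.intro group_hom_axioms.intro grp group_GL homI) (use FG Fmult in simp_all)
  have FH: "subgroup (F ` H) (GL n)"
    using group_hom.subgroup_img_is_subgroup[OF hom group.subgroup_self[OF grp]] by simp
  have "solvable_seq (GL n) (F ` H)"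
    using group_hom.solvable_imp_solvable_img[OF hom, of H] sol by (simp add: solvable_def)
  then obtain k where "(derived (GL n) ^^ k) (F ` H) = {\<one>\<^bsub>GL n\<^esub>}"
    using group.solvable_imp_trivial_derived_seq[OF group_GL] by blast
  then have "solvable (GL n\<lparr>carrier := F ` H\<rparr>)" using solvable_of_derived[OF FH, of k] by simp
  moreover have "connectedin (zariski n) (F ` H)"
  proof (rule connected_image[OF con _ FG])
    have p: "polymap ?n ?n (\<lambda>A. ginv ?n y * A * y)"
      by (rule polymap_conj[OF GL_mat[OF GL_inv_closed[OF yG]] GL_mat[OF yG]])
    show "polymap ?n n F" unfolding polymap_def
    proof (intro conjI ballI allI impI Fc)
      fix i j assume "i < n" "j < n"
      then have "poly_on ?n (\<lambda>A. (ginv ?n y * A * y) $$ (Suc i, Suc j))" using p by (simp add: polymap_def)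
      then show "poly_on ?n (\<lambda>A. F A $$ (i, j))" using \<open>i < n\<close> \<open>j < n\<close> by (simp add: F_def C_def)
    qed
  qed
  ultimately obtain x where xG: "x \<in> carrier (GL n)" and x: "\<forall>h\<in>F ` H. ginv n x * h * x \<in> UT n"
    using Suc.IH[OF FH] by blast
  let ?b = "bd 1 n (1\<^sub>m 1) x"
  have bG: "?b \<in> carrier (GL ?n)" using bd_GL[OF GL_one_closed[of 1] xG] by simp
  have bi: "ginv ?n ?b = bd 1 n (1\<^sub>m 1) (ginv n x)" using bd_inv[OF GL_one_closed[of 1] xG] by simp
  have xm: "x \<in> carrier_mat n n" "ginv n x \<in> carrier_mat n n" using xG GL_mat GL_inv_closed by blast+
  have "ginv ?n (y * ?b) * h * (y * ?b) \<in> UT ?n" if h: "h \<in> H" for h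
  proof -
    have hG: "h \<in> carrier (GL ?n)" using h H' by blast
    let ?Z = "ginv ?n ?b * C h * ?b"
    have Z: "ginv ?n (y * ?b) * h * (y * ?b) = ?Z"
      unfolding C_def using yG hG bG by (simp add: GL_assoc[where n="?n"])
    have ZG: "?Z \<in> carrier (GL ?n)" using CG[OF h] bG by blast
    define r where "r = mat 1 n (\<lambda>(i, j). C h $$ (0, Suc j))"
    define a where "a = mat 1 1 (\<lambda>(i, j). C h $$ (0, 0))"
    have ar: "r \<in> carrier_mat 1 n" "a \<in> carrier_mat 1 1" by (auto simp: r_def a_def)
    have Cb: "C h = four_block_mat a r (0\<^sub>m n 1) (F h)"
    proof (rule eq_matI)
      fix i j assume "i < dim_row (four_block_mat a r (0\<^sub>m n 1) (F h))" "j < dim_col (four_block_mat a r (0\<^sub>m n 1) (F h))"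
      then have ij: "i < ?n" "j < ?n" by (auto simp: a_def F_def)
      show "C h $$ (i, j) = four_block_mat a r (0\<^sub>m n 1) (F h) $$ (i, j)"
        using ij C0[OF h, of i] by (cases i; cases j) (auto simp: a_def r_def F_def)
    qed (use GL_mat[OF CG[OF h]] in \<open>auto simp: a_def F_def\<close>)
    have Fx: "F h * x \<in> carrier_mat n n" using mult_carrier_mat[OF Fc xm(1)] .
    have rx: "r * x \<in> carrier_mat 1 n" using mult_carrier_mat[OF ar(1) xm(1)] .
    have "C h * ?b = four_block_mat a (r * x) (0\<^sub>m n 1) (F h * x)"
      unfolding Cb using ar xm Fc[of h] Fx right_mult_zero_mat[OF Fc[of h], of 1]
      by (subst mult_four_block_mat[where ?nr1.0 = 1 and ?n1.0 = 1 and ?n2.0 = n and ?nr2.0 = n and ?nc1.0 = 1 and ?nc2.0 = n]) auto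
    moreover have "ginv ?n ?b * four_block_mat a (r * x) (0\<^sub>m n 1) (F h * x)
        = four_block_mat a (r * x) (0\<^sub>m n 1) (ginv n x * (F h * x))"
      unfolding bi using ar xm Fc[of h] Fx rx left_mult_zero_mat[OF Fx, of 1] mult_carrier_mat[OF xm(2) Fx]
      by (subst mult_four_block_mat[where ?nr1.0 = 1 and ?n1.0 = 1 and ?n2.0 = n and ?nr2.0 = n and ?nc1.0 = 1 and ?nc2.0 = n]) auto
    moreover have "?Z = ginv ?n ?b * (C h * ?b)"
      using CG[OF h] bG by (simp add: GL_assoc[where n="?n"])
    ultimately have Zb: "?Z = four_block_mat a (r * x) (0\<^sub>m n 1) (ginv n x * F h * x)"
      using FG[OF h] xG by (simp add: GL_assoc[where n=n])
    have u: "ginv n x * F h * x \<in> UT n" using x h by blast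
    have uc: "ginv n x * F h * x \<in> carrier_mat n n" using u by (auto simp: pat_def GL_carrier_iff)
    have low: "?Z $$ (i, j) = 0" if "i < 1 + n" "j < i" for i j
    proof (rule below_diagonal_zero_of_corner[OF _ _ _ that])
      show "?Z \<in> carrier_mat (1 + n) (1 + n)" using GL_mat[OF ZG] by simp
      show "?Z $$ (k, 0) = 0" if "0 < k" "k < 1 + n" for k
        unfolding Zb using that ar uc by (auto simp: xm)
      show "?Z $$ (1 + k, 1 + l) = 0" if "k < n" "l < k" for k l
        unfolding Zb using that carrier_matD[OF ar(2)] carrier_matD[OF uc] pat_D[OF u, of k l] by simp
    qed
    have "?Z \<in> UT ?n" unfolding pat_def
    proof (intro CollectI conjI allI impI ZG)
      fix i j assume "i < ?n" "?Z $$ (i, j) \<noteq> 0"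
      then show "i \<le> j" using low[of i j] by (cases "i \<le> j") auto
    qed
    then show ?thesis using Z by simp
  qed
  moreover have "y * ?b \<in> carrier (GL ?n)" using yG bG by simp
  ultimately show ?case by blast
qed

section \<open>Borel subgroups\<close>

lemma solvable_conj:
  assumes H: "subgroup H (GL n)" and sol: "solvable (GL n\<lparr>carrier := H\<rparr>)" and x: "x \<in> carrier (GL n)"
  shows "solvable (GL n\<lparr>carrier := conj_set n x H\<rparr>)"
proof -
  let ?F = "\<lambda>h. x * h * ginv n x"
  have grp: "group (GL n\<lparr>carrier := H\<rparr>)" using group.subgroup_imp_group[OF group_GL H] .
  note H' = subgroup_GL_D[OF H]
  have "group_hom (GL n\<lparr>carrier := H\<rparr>) (GL n) ?F"
  proof (intro group_hom.intro group_hom_axioms.intro grp group_GL homI)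
    fix g h assume gh: "g \<in> carrier (GL n\<lparr>carrier := H\<rparr>)" "h \<in> carrier (GL n\<lparr>carrier := H\<rparr>)"
    then have G: "g \<in> carrier (GL n)" "h \<in> carrier (GL n)" using H' by auto
    then show "?F g \<in> carrier (GL n)" using x by simp
    show "?F (g \<otimes>\<^bsub>GL n\<lparr>carrier := H\<rparr>\<^esub> h) = ?F g \<otimes>\<^bsub>GL n\<^esub> ?F h"
      using G x by (simp add: GL_assoc[where n=n])
  qed
  then have "solvable_seq (GL n) (?F ` H)"
    using group_hom.solvable_imp_solvable_img[of _ "GL n" ?F H] sol by (simp add: solvable_def)
  then obtain k where "(derived (GL n) ^^ k) (?F ` H) = {\<one>\<^bsub>GL n\<^esub>}"
    using group.solvable_imp_trivial_derived_seq[OF group_GL] by blast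
  then show ?thesis
    using solvable_of_derived[OF subgroup_conj_set[OF x H], of k] by (simp add: conj_set_def)
qed

lemma closed_preimage:
  assumes F: "polymap n m F" and H: "\<And>A. A \<in> carrier (GL n) \<Longrightarrow> F A \<in> carrier (GL m)"
    and cE: "closedin (zariski m) E"
  shows "closedin (zariski n) {A \<in> carrier (GL n). F A \<in> E}"
proof -
  obtain \<F> where \<F>: "\<F> \<subseteq> poly_fun m" "E = {A \<in> carrier (GL m). \<forall>f\<in>\<F>. f A = 0}"
    using cE unfolding closedin_zariski by blast
  have "closedin (zariski n) {A \<in> carrier (GL n). \<forall>f\<in>\<F>. f (F A) = 0}"
  proof (rule closedin_polys)
    fix f assume "f \<in> \<F>"
    then show "poly_on n (\<lambda>A. f (F A))" using \<F>(1) by (intro poly_fun_comp[OF F]) blast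
  qed
  moreover have "{A \<in> carrier (GL n). \<forall>f\<in>\<F>. f (F A) = 0} = {A \<in> carrier (GL n). F A \<in> E}"
    unfolding \<F>(2) by (rule Collect_cong) (use H in auto)
  ultimately show ?thesis by simp
qed

lemma conj_set_iff:
  assumes x: "x \<in> carrier (GL n)" and H: "H \<subseteq> carrier (GL n)"
  shows "A \<in> conj_set n x H \<longleftrightarrow> A \<in> carrier (GL n) \<and> ginv n x * A * x \<in> H"
proof
  assume "A \<in> conj_set n x H"
  then obtain h where h: "h \<in> H" "A = x * h * ginv n x" by (auto simp: conj_set_def)
  then have hG: "h \<in> carrier (GL n)" using H by blast
  have "ginv n x * A * x = h" using h(2) hG x by (simp add: GL_assoc[where n=n])
  then show "A \<in> carrier (GL n) \<and> ginv n x * A * x \<in> H" using h hG x by simp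
next
  assume A: "A \<in> carrier (GL n) \<and> ginv n x * A * x \<in> H"
  then have "A = x * (ginv n x * A * x) * ginv n x" using x by (simp add: GL_assoc[where n=n])
  then show "A \<in> conj_set n x H" unfolding conj_set_def using A by blast
qed

lemma closed_conj:
  assumes C: "closedin (zariski n) H" and x: "x \<in> carrier (GL n)"
  shows "closedin (zariski n) (conj_set n x H)"
proof -
  have HG: "H \<subseteq> carrier (GL n)" using closedin_subset[OF C] by (simp add: topspace_zariski)
  have "closedin (zariski n) {A \<in> carrier (GL n). ginv n x * A * x \<in> H}"
    by (rule closed_preimage[OF polymap_conj[OF GL_mat[OF GL_inv_closed[OF x]] GL_mat[OF x]] _ C]) (use x in simp)
  also have "{A \<in> carrier (GL n). ginv n x * A * x \<in> H} = conj_set n x H"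
    using conj_set_iff[OF x HG] by blast
  finally show ?thesis .
qed

lemma closed_connected_solvable_conj:
  assumes C: "closed_connected_solvable n H" and x: "x \<in> carrier (GL n)"
  shows "closed_connected_solvable n (conj_set n x H)"
proof -
  have H: "subgroup H (GL n)" "closedin (zariski n) H" "connectedin (zariski n) H"
    "solvable (GL n\<lparr>carrier := H\<rparr>)" using C by (auto simp: closed_connected_solvable_def)
  have "connectedin (zariski n) ((\<lambda>A. x * A * ginv n x) ` H)"
    by (rule connected_image[OF H(3) polymap_conj[OF GL_mat[OF x] GL_mat[OF GL_inv_closed[OF x]]]])
      (use subgroup_GL_D(1)[OF H(1)] x in auto)
  then show ?thesis
    unfolding closed_connected_solvable_def
    using subgroup_conj_set[OF x H(1)] closed_conj[OF H(2) x] solvable_conj[OF H(1,4) x]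
    by (simp add: conj_set_def)
qed

lemma closed_pat: "closedin (zariski n) (pat R n)"
proof -
  have "closedin (zariski n) {A \<in> carrier (GL n). \<forall>ij\<in>{(i, j). i < n \<and> j < n \<and> \<not> R i j}. A $$ ij = 0}"
    by (rule closedin_polys) (auto intro: poly_on_coord)
  also have "{A \<in> carrier (GL n). \<forall>ij\<in>{(i, j). i < n \<and> j < n \<and> \<not> R i j}. A $$ ij = 0} = pat R n"
    unfolding pat_def by auto
  finally show ?thesis .
qed

lemma UT_GL_iff:
  assumes "A \<in> carrier_mat n n" "\<And>i j. i < n \<Longrightarrow> j < i \<Longrightarrow> A $$ (i, j) = 0"
  shows "A \<in> UT n \<longleftrightarrow> (\<forall>i<n. A $$ (i, i) \<noteq> 0)"
proof -
  have "upper_triangular A" using assms by auto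
  then have "det A = prod_list (diag_mat A)" by (rule det_upper_triangular[OF _ assms(1)])
  then have "det A \<noteq> 0 \<longleftrightarrow> (\<forall>i<n. A $$ (i, i) \<noteq> 0)"
    using assms(1) by (auto simp: prod_list_zero_iff diag_mat_def)
  moreover have "A \<in> UT n \<longleftrightarrow> det A \<noteq> 0"
  proof
    assume "det A \<noteq> 0"
    then show "A \<in> UT n" unfolding pat_def using assms by (force simp: GL_carrier_iff not_less)
  qed (auto simp: pat_def GL_carrier_iff)
  ultimately show ?thesis by simp
qed

text \<open>The line through the identity and an upper triangular matrix consists of upper triangular matrices
  that are invertible for all but finitely many parameters. If two closed sets separated the identity
  from \<open>A\<close>, each of them would contain finitely many points of this line, as polynomials in one
  variable have finitely many zeros; but the field is infinite.\<close>

lemma connected_UT: "connectedin (zariski n) (UT n)"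
  unfolding connectedin_closedin
proof (intro conjI notI)
  show "UT n \<subseteq> topspace (zariski n)" by (simp add: topspace_zariski pat_GL)
  assume "\<exists>E1 E2. closedin (zariski n) E1 \<and> closedin (zariski n) E2 \<and> UT n \<subseteq> E1 \<union> E2 \<and>
    E1 \<inter> E2 \<inter> UT n = {} \<and> E1 \<inter> UT n \<noteq> {} \<and> E2 \<inter> UT n \<noteq> {}"
  then obtain E1 E2 where E: "closedin (zariski n) E1" "closedin (zariski n) E2" "UT n \<subseteq> E1 \<union> E2"
    "E1 \<inter> E2 \<inter> UT n = {}" "E1 \<inter> UT n \<noteq> {}" "E2 \<inter> UT n \<noteq> {}" by (elim exE conjE)
  have I: "1\<^sub>m n \<in> UT n" using subgroup_GL_D(2)[OF subgroup_UT] .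
  have sep: False if E: "closedin (zariski n) E1" "closedin (zariski n) E2" "UT n \<subseteq> E1 \<union> E2"
    "E1 \<inter> E2 \<inter> UT n = {}" and IE: "1\<^sub>m n \<in> E1" and AE: "A \<in> E2" "A \<in> UT n" for E1 E2 A
  proof -
    have Ac: "A \<in> carrier_mat n n" using AE(2) by (auto simp: pat_def GL_carrier_iff)
    define l where "l t = mat n n (\<lambda>(i, j). (1 - t) * (if i = j then 1 else 0) + t * A $$ (i, j))" for t :: complex
    have l0: "l 0 = 1\<^sub>m n" by (rule eq_matI) (auto simp: l_def)
    have l1: "l 1 = A" by (rule eq_matI) (use Ac in \<open>auto simp: l_def\<close>)
    have lUT: "l t \<in> UT n \<longleftrightarrow> (\<forall>i<n. l t $$ (i, i) \<noteq> 0)" for t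
      by (rule UT_GL_iff) (use pat_D[OF AE(2)] in \<open>auto simp: l_def\<close>)
    define bad where "bad = {t. l t \<notin> UT n}"
    have "bad \<subseteq> (\<Union>i<n. {t. poly [:1, A $$ (i, i) - 1:] t = 0})"
      unfolding bad_def using lUT by (auto simp: l_def algebra_simps)
    moreover have "finite {t. poly [:1, A $$ (i, i) - 1:] t = 0}" for i
      by (rule poly_roots_finite) simp
    ultimately have bad: "finite bad" by (meson finite_UN_I finite_lessThan finite_subset)
    have fin: "finite {t. l t \<in> E}" if cE: "closedin (zariski n) E" and X: "l s \<in> UT n" "l s \<notin> E" for E s
    proof -
      obtain \<F> where \<F>: "\<F> \<subseteq> poly_fun n" "E = {A \<in> carrier (GL n). \<forall>f\<in>\<F>. f A = 0}"
        using cE unfolding closedin_zariski by blast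
      have "l s \<in> carrier (GL n)" using X(1) by (simp add: pat_def)
      then obtain f where f: "f \<in> \<F>" "f (l s) \<noteq> 0" using X(2) \<F>(2) by blast
      obtain p where p: "\<forall>t. f (l t) = poly p t"
        using poly_fun_line[OF _ Ac, of f] f(1) \<F>(1) unfolding l_def by blast
      have "p \<noteq> 0" using p f(2) by auto
      then have "finite {t. poly p t = 0}" by (rule poly_roots_finite)
      moreover have "{t. l t \<in> E} \<subseteq> {t. poly p t = 0}"
      proof
        fix t assume "t \<in> {t. l t \<in> E}"
        then have "f (l t) = 0" using \<F>(2) f(1) by blast
        then show "t \<in> {t. poly p t = 0}" using p by simp
      qed
      ultimately show ?thesis by (rule rev_finite_subset)
    qed
    have "A \<notin> E1" using AE E(4) by blast
    then have f1: "finite {t. l t \<in> E1}" using fin[OF E(1), of 1] l1 AE(2) by simp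
    have "1\<^sub>m n \<notin> E2" using IE I E(4) by blast
    then have f2: "finite {t. l t \<in> E2}" using fin[OF E(2), of 0] l0 I by simp
    have "UNIV \<subseteq> bad \<union> {t. l t \<in> E1} \<union> {t. l t \<in> E2}" unfolding bad_def using E(3) by blast
    then have "finite (UNIV :: complex set)" using bad f1 f2 by (meson finite_Un finite_subset)
    then show False using infinite_UNIV_char_0 by blast
  qed
  obtain A1 where A1: "A1 \<in> E1" "A1 \<in> UT n" using E(5) by blast
  obtain A2 where A2: "A2 \<in> E2" "A2 \<in> UT n" using E(6) by blast
  have "UT n \<subseteq> E2 \<union> E1" "E2 \<inter> E1 \<inter> UT n = {}" using E(3,4) by blast+
  then show False using sep[OF E(1-4) _ A2] sep[OF E(2,1) _ _ _ A1] I E(3) by blast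
qed

text \<open>The filtration of the upper triangular group by the number of diagonals that agree with the
  identity: \<open>unip n 0\<close> is the whole group and \<open>unip n 1\<close> its unipotent radical.\<close>

definition unip :: "nat \<Rightarrow> nat \<Rightarrow> complex mat set" where
  "unip n k = {A \<in> carrier (GL n). \<forall>i<n. \<forall>j<n. j < i + k \<longrightarrow> A $$ (i, j) = (if i = j then 1 else 0)}"

lemma unip_0: "unip n 0 = UT n"
proof (intro equalityI subsetI)
  fix A assume A: "A \<in> unip n 0"
  have "i \<le> j" if "i < n" "j < n" "A $$ (i, j) \<noteq> 0" for i j
  proof (rule ccontr)
    assume "\<not> i \<le> j"
    then have "A $$ (i, j) = 0" using A that(1,2) by (simp add: unip_def)
    then show False using that(3) by simp
  qed
  then show "A \<in> UT n" using A by (simp add: unip_def pat_def)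
next
  fix A assume A: "A \<in> UT n"
  have "A $$ (i, j) = 0" if "i < n" "j < n" "j < i" for i j
    using pat_D[OF A that(1,2)] that(3) by simp
  then show "A \<in> unip n 0" using A by (simp add: unip_def pat_def)
qed

lemma unip_UT: "unip n k \<subseteq> UT n"
  unfolding unip_def pat_def by (auto simp: not_less[symmetric])

lemma unip_D: "A \<in> unip n k \<Longrightarrow> i < n \<Longrightarrow> j < n \<Longrightarrow> j < i + k \<Longrightarrow> A $$ (i, j) = (if i = j then 1 else 0)"
  by (auto simp: unip_def)

text \<open>Multiplication by an upper triangular matrix on the right does not let the entries beyond the
  \<open>k\<close>-th diagonal influence those before it.\<close>

lemma unip_factor:
  assumes X: "X \<in> carrier (GL n)" and Y: "Y \<in> carrier (GL n)" and Z: "Z \<in> UT n" and ij: "i < n" "j < n" "j < i + k"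
    and XY: "\<And>l. l < n \<Longrightarrow> l < i + k \<Longrightarrow> X $$ (i, l) = Y $$ (i, l)"
  shows "(X * Z) $$ (i, j) = (Y * Z) $$ (i, j)"
proof -
  have ZG: "Z \<in> carrier (GL n)" using Z by (simp add: pat_def)
  have "X $$ (i, l) * Z $$ (l, j) = Y $$ (i, l) * Z $$ (l, j)" if l: "l < n" for l
  proof (cases "l < i + k")
    case False
    then have "Z $$ (l, j) = 0" using pat_D[OF Z l ij(2)] ij(3) by simp
    then show ?thesis by simp
  qed (use XY l in simp)
  then show ?thesis
    unfolding GL_mult_entry[OF X ZG ij(1,2)] GL_mult_entry[OF Y ZG ij(1,2)] by (intro sum.cong) auto
qed

lemma subgroup_unip: "subgroup (unip n k) (GL n)"
proof (rule subgroup_GL_I)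
  show "unip n k \<subseteq> carrier (GL n)" by (auto simp: unip_def)
  show "1\<^sub>m n \<in> unip n k" by (auto simp: unip_def)
  fix x assume x: "x \<in> unip n k"
  have xG: "x \<in> carrier (GL n)" using x by (simp add: unip_def)
  have ix: "ginv n x \<in> UT n" by (rule pat_inv) (use x unip_UT in auto)
  have "ginv n x $$ (i, j) = (if i = j then 1 else 0)" if ij: "i < n" "j < n" "j < i + k" for i j
  proof -
    have "(1\<^sub>m n * ginv n x) $$ (i, j) = (x * ginv n x) $$ (i, j)"
      by (rule unip_factor[OF GL_one_closed xG ix ij]) (use unip_D[OF x] ij in auto)
    then show ?thesis using xG ij by simp
  qed
  then show "ginv n x \<in> unip n k" using xG by (simp add: unip_def)
  fix y assume y: "y \<in> unip n k"
  have yG: "y \<in> carrier (GL n)" using y by (simp add: unip_def)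
  have "(x * y) $$ (i, j) = (if i = j then 1 else 0)" if ij: "i < n" "j < n" "j < i + k" for i j
  proof -
    have "(x * y) $$ (i, j) = (1\<^sub>m n * y) $$ (i, j)"
      by (rule unip_factor[OF xG GL_one_closed _ ij]) (use unip_D[OF x] subsetD[OF unip_UT y] ij in auto)
    then show ?thesis using yG ij unip_D[OF y ij] by simp
  qed
  then show "x * y \<in> unip n k" using xG yG by (simp add: unip_def)
qed

lemma unip_product_entry:
  assumes x: "x \<in> unip n k" and y: "y \<in> unip n k" and il: "i < n" "l < n" "l < i + Suc k"
  shows "(x * y) $$ (i, l) = (if l < i then 0 else if l = i then x $$ (i, i) * y $$ (i, i)
    else x $$ (i, l) + y $$ (i, l))"
proof -
  have xG: "x \<in> carrier (GL n)" and yG: "y \<in> carrier (GL n)" using x y by (auto simp: unip_def)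
  have xU: "x \<in> UT n" and yU: "y \<in> UT n" using x y unip_UT by auto
  have e: "(x * y) $$ (i, l) = (\<Sum>m<n. x $$ (i, m) * y $$ (m, l))" by (rule GL_mult_entry[OF xG yG il(1,2)])
  have t0: "x $$ (i, m) * y $$ (m, l) = 0" if m: "m < n" "m \<noteq> i" "m \<noteq> l" for m
  proof (cases "i < m \<and> m < l")
    case True
    then have "x $$ (i, m) = 0" using unip_D[OF x il(1) m(1)] il(3) by auto
    then show ?thesis by simp
  next
    case False
    then have "m < i \<or> l < m" using m by auto
    then show ?thesis using pat_D[OF xU il(1) m(1)] pat_D[OF yU m(1) il(2)] by auto
  qed
  have "(\<Sum>m<n. x $$ (i, m) * y $$ (m, l)) = (\<Sum>m\<in>{i, l}. x $$ (i, m) * y $$ (m, l))"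
    by (rule sum.mono_neutral_right) (use il t0 in auto)
  moreover have "x $$ (i, l) = 0" "y $$ (i, l) = 0" if "l < i"
    using pat_D[OF xU il(1,2)] pat_D[OF yU il(1,2)] that by auto
  moreover have "x $$ (i, i) = 1" "y $$ (l, l) = 1" if "i < l"
    using unip_D[OF x il(1) il(1)] unip_D[OF y il(2) il(2)] that il(3) by auto
  ultimately show ?thesis using e by (cases l i rule: linorder_cases) (auto simp: add.commute)
qed

text \<open>On the first diagonals that can be nontrivial the product is the sum, or on the main diagonal for
  \<open>k = 0\<close> the product, of the entries. So \<open>x y\<close> and \<open>y x\<close> agree on one more diagonal.\<close>

lemma unip_commutator:
  assumes x: "x \<in> unip n k" and y: "y \<in> unip n k"
  shows "x * y * ginv n x * ginv n y \<in> unip n (Suc k)"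
proof -
  have xG: "x \<in> carrier (GL n)" and yG: "y \<in> carrier (GL n)" using x y by (auto simp: unip_def)
  let ?z = "ginv n (y * x)"
  have "y * x \<in> UT n" using subgroup_GL_D(3)[OF subgroup_UT] x y unip_UT by blast
  then have z: "?z \<in> UT n" using subgroup_GL_D(4)[OF subgroup_UT] by blast
  have t: "x * y * ginv n x * ginv n y = (x * y) * ?z" using xG yG by (simp add: GL_assoc[where n=n])
  have "((x * y) * ?z) $$ (i, j) = (if i = j then 1 else 0)" if ij: "i < n" "j < n" "j < i + Suc k" for i j
  proof -
    have "((x * y) * ?z) $$ (i, j) = ((y * x) * ?z) $$ (i, j)"
    proof (rule unip_factor[OF _ _ z ij])
      fix l assume l: "l < n" "l < i + Suc k"
      show "(x * y) $$ (i, l) = (y * x) $$ (i, l)"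
        unfolding unip_product_entry[OF x y ij(1) l] unip_product_entry[OF y x ij(1) l] by simp
    qed (use xG yG in auto)
    also have "(y * x) * ?z = 1\<^sub>m n" using GL_r_inv[OF GL_mult_closed[OF yG xG]] .
    finally show ?thesis using ij by simp
  qed
  then show ?thesis unfolding t using xG yG by (simp add: unip_def)
qed

lemma solvable_UT: "solvable (GL n\<lparr>carrier := UT n\<rparr>)"
proof (rule solvable_of_derived[OF subgroup_UT])
  have "(derived (GL n) ^^ k) (UT n) \<subseteq> unip n k" for k
  proof (induction k)
    case 0
    then show ?case by (simp add: unip_0)
  next
    case (Suc k)
    have "derived (GL n) (unip n k) \<subseteq> unip n (Suc k)"
      unfolding derived_def
      by (rule group.generate_subgroup_incl[OF group_GL _ subgroup_unip]) (use unip_commutator in auto)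
    then show ?case using group.mono_derived[OF group_GL Suc] by auto
  qed
  moreover have "unip n n = {1\<^sub>m n}"
  proof (intro equalityI subsetI)
    fix A assume "A \<in> unip n n"
    then have "A = 1\<^sub>m n" by (intro eq_matI) (auto simp: unip_def GL_carrier_iff)
    then show "A \<in> {1\<^sub>m n}" by simp
  qed (use subgroup_GL_D(2)[OF subgroup_unip] in blast)
  moreover have "1\<^sub>m n \<in> (derived (GL n) ^^ n) (UT n)"
    using subgroup_GL_D(2)[OF group.exp_of_derived_is_subgroup[OF group_GL subgroup_UT]] .
  ultimately show "(derived (GL n) ^^ n) (UT n) = {1\<^sub>m n}" by blast
qed

lemma closed_connected_solvable_UT: "closed_connected_solvable n (UT n)"
  unfolding closed_connected_solvable_def
  using subgroup_UT closed_pat connected_UT solvable_UT by blast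

text \<open>By Lie--Kolchin a Borel subgroup lies in a conjugate of the upper triangular group, which is itself
  closed, connected and solvable; maximality gives equality.\<close>

theorem borel_conj_UT:
  assumes "borel_subgroup n B"
  shows "\<exists>x\<in>carrier (GL n). B = conj_set n x (UT n)"
proof -
  have B: "subgroup B (GL n)" "connectedin (zariski n) B" "solvable (GL n\<lparr>carrier := B\<rparr>)"
    and max: "\<And>H. closed_connected_solvable n H \<Longrightarrow> B \<subseteq> H \<Longrightarrow> H = B"
    using assms unfolding borel_subgroup_def closed_connected_solvable_def by blast+
  obtain x where x: "x \<in> carrier (GL n)" "\<forall>h\<in>B. ginv n x * h * x \<in> UT n"
    using lie_kolchin[OF B] by blast
  have "B \<subseteq> conj_set n x (UT n)"
    using conj_set_iff[OF x(1) pat_GL] x(2) subgroup_GL_D(1)[OF B(1)] by blast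
  then have "conj_set n x (UT n) = B"
    using max closed_connected_solvable_conj[OF closed_connected_solvable_UT x(1)] by blast
  then show ?thesis using x(1) by blast
qed

section \<open>Parabolic subgroups\<close>

definition elmat :: "nat \<Rightarrow> nat \<Rightarrow> nat \<Rightarrow> complex \<Rightarrow> complex mat" where
  "elmat n a c t = colmat n c (\<lambda>k. if k = c then 1 else if k = a then t else 0)"

lemma elmat_carrier [simp]: "elmat n a c t \<in> carrier_mat n n"
  by (simp add: elmat_def)

lemma elmat_GL: "c < n \<Longrightarrow> elmat n a c t \<in> carrier (GL n)"
  unfolding elmat_def by (rule colmat_GL) auto

lemma elmat_mult:
  assumes "X \<in> carrier_mat n m" "a \<noteq> c" "c < n" "i < n" "j < m"
  shows "(elmat n a c t * X) $$ (i, j) = X $$ (i, j) + (if i = a then t * X $$ (c, j) else 0)"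
  unfolding elmat_def using colmat_mult[OF assms(1,3,4,5)] assms by auto

lemma elmat_pat:
  assumes "c < n" "reflp R" "R a c"
  shows "elmat n a c t \<in> pat R n"
  unfolding elmat_def by (rule colmat_pat) (use assms reflpD in \<open>auto split: if_splits\<close>)

text \<open>For distinct indices: the root subgroup of \<open>(a, c)\<close> lies in \<open>P\<close>.\<close>

definition root_in :: "nat \<Rightarrow> complex mat set \<Rightarrow> nat \<Rightarrow> nat \<Rightarrow> bool" where
  "root_in n P a c \<longleftrightarrow> (\<forall>t. elmat n a c t \<in> P)"

lemma elmat_commutator:
  assumes "a < n" "b < n" "c < n" "a \<noteq> b" "b \<noteq> c" "a \<noteq> c"
  shows "elmat n a b t * elmat n b c 1 = elmat n a c t * (elmat n b c 1 * elmat n a b t)"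
proof (rule eq_matI)
  fix i j assume "i < dim_row (elmat n a c t * (elmat n b c 1 * elmat n a b t))"
    "j < dim_col (elmat n a c t * (elmat n b c 1 * elmat n a b t))"
  then have ij: "i < n" "j < n" by (auto simp: elmat_def colmat_def)
  have m: "elmat n b c 1 * elmat n a b t \<in> carrier_mat n n" by (rule mult_carrier_mat[OF elmat_carrier elmat_carrier])
  have e: "elmat n x y s $$ (k, l) = (if k = l then 1 else if k = x \<and> l = y then s else 0)"
    if "k < n" "l < n" "x \<noteq> y" for x y s k l
    using that by (auto simp: elmat_def colmat_def)
  show "(elmat n a b t * elmat n b c 1) $$ (i, j) = (elmat n a c t * (elmat n b c 1 * elmat n a b t)) $$ (i, j)"
    unfolding elmat_mult[OF elmat_carrier assms(4,2) ij] elmat_mult[OF m assms(6,3) ij]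
      elmat_mult[OF elmat_carrier assms(5,3) ij] elmat_mult[OF elmat_carrier assms(5,3) assms(3) ij(2)]
    using assms ij by (auto simp: e)
qed (auto simp: elmat_def colmat_def)

text \<open>The commutator relation of elementary matrices.\<close>

lemma root_in_trans:
  assumes P: "subgroup P (GL n)" and lt: "a < n" "b < n" "c < n" "a \<noteq> c"
    and ab: "a = b \<or> root_in n P a b" and bc: "b = c \<or> root_in n P b c"
  shows "root_in n P a c"
proof (cases "a = b \<or> b = c")
  case True
  then show ?thesis using ab bc lt by auto
next
  case False
  note P' = subgroup_GL_D[OF P]
  have "elmat n a c t \<in> P" for t
  proof -
    have in1: "elmat n a b t \<in> P" "elmat n b c 1 \<in> P" using ab bc False by (auto simp: root_in_def)
    let ?A = "elmat n a b t" and ?C = "elmat n b c 1" and ?E = "elmat n a c t"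
    have G: "?A \<in> carrier (GL n)" "?C \<in> carrier (GL n)" "?E \<in> carrier (GL n)" using elmat_GL lt by auto
    have "?E = (?E * (?C * ?A)) * ginv n (?C * ?A)" using G by (simp add: GL_assoc[where n=n])
    also have "\<dots> = (?A * ?C) * ginv n (?C * ?A)"
      using elmat_commutator[OF lt(1-3), of t] False lt by simp
    finally show ?thesis using P'(3)[OF P'(3)[OF in1] P'(4)[OF P'(3)[OF in1(2,1)]]] by simp
  qed
  then show ?thesis by (simp add: root_in_def)
qed

lemma mult_colmat:
  assumes "X \<in> carrier_mat m n" "a < n" "i < m" "j < n"
  shows "(X * colmat n a v) $$ (i, j) = (if j = a then (\<Sum>k<n. X $$ (i, k) * v k) else X $$ (i, j))"
proof -
  have "(X * colmat n a v) $$ (i, j) = (\<Sum>k<n. X $$ (i, k) * colmat n a v $$ (k, j))"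
    using mat_mult_entry[OF assms(1) colmat_carrier assms(3,4)] .
  also have "\<dots> = (if j = a then (\<Sum>k<n. X $$ (i, k) * v k) else X $$ (i, j))"
  proof (cases "j = a")
    case True
    then show ?thesis using assms by (auto simp: colmat_def)
  next
    case False
    have "(\<Sum>k<n. X $$ (i, k) * colmat n a v $$ (k, j)) = (\<Sum>k<n. if k = j then X $$ (i, k) else 0)"
      by (rule sum.cong) (use assms False in \<open>auto simp: colmat_def\<close>)
    then show ?thesis using False assms by simp
  qed
  finally show ?thesis .
qed

text \<open>A transvection \<open>1 + v \<phi>\<close> in \<open>P\<close> can be moved by upper triangular matrices until \<open>v\<close> is the unit
  vector at its last nonzero entry and \<open>\<phi>\<close> the coordinate at its first one.\<close>

lemma transvection_root:
  assumes P: "subgroup P (GL n)" "UT n \<subseteq> P"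
    and T: "T \<in> P" "\<And>k l. k < n \<Longrightarrow> l < n \<Longrightarrow> T $$ (k, l) = (if k = l then 1 else 0) + v k * f l"
    and fv: "(\<Sum>k<n. f k * v k) = 0"
    and a: "a < n" "v a \<noteq> 0" "\<And>k. a < k \<Longrightarrow> k < n \<Longrightarrow> v k = 0"
    and c: "c < n" "f c \<noteq> 0" "\<And>k. k < c \<Longrightarrow> f k = 0" and ca: "c < a"
  shows "elmat n a c 1 \<in> P"
proof -
  note P' = subgroup_GL_D[OF P(1)]
  have TG: "T \<in> carrier (GL n)" using T P' by blast
  define U1 where "U1 = colmat n a v"
  define R where "R = rowmat n a (\<lambda>l. if l = a then 1 else f l)"
  define U2 where "U2 = rowmat n c (\<lambda>l. if l = a then 0 else f l)"
  have U1: "U1 \<in> UT n" unfolding U1_def by (rule colmat_pat) (use a in \<open>auto intro: leI\<close>)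
  have U2: "U2 \<in> UT n" unfolding U2_def by (rule rowmat_pat) (use c ca in \<open>auto intro: leI split: if_splits\<close>)
  have RG: "R \<in> carrier (GL n)" unfolding R_def by (rule rowmat_GL) (use a in auto)
  have G: "U1 \<in> carrier (GL n)" "U2 \<in> carrier (GL n)" using U1 U2 by (auto simp: pat_def)
  have EG: "elmat n a c 1 \<in> carrier (GL n)" using elmat_GL[OF c(1)] .
  \<comment> \<open>The matrix \<open>U1\<close> maps the \<open>a\<close>-th unit vector to \<open>v\<close>; the assumption \<open>fv\<close> makes the transvection
    become the identity plus the \<open>a\<close>-th unit vector times \<open>f\<close> without its \<open>a\<close>-th coordinate.\<close>
  have "T * U1 = U1 * R"
  proof (rule eq_matI)
    fix i j assume "i < dim_row (U1 * R)" "j < dim_col (U1 * R)"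
    then have ij: "i < n" "j < n" by (auto simp: U1_def R_def colmat_def rowmat_def)
    have L: "(T * U1) $$ (i, j) = (if j = a then (\<Sum>k<n. T $$ (i, k) * v k) else T $$ (i, j))"
      unfolding U1_def by (rule mult_colmat[OF GL_mat[OF TG] a(1) ij])
    have "(\<Sum>k<n. T $$ (i, k) * v k) = (\<Sum>k<n. (if k = i then v k else 0) + v i * (f k * v k))"
      by (rule sum.cong) (use T(2) ij in \<open>auto simp: algebra_simps\<close>)
    also have "\<dots> = v i" using ij fv by (simp add: sum.distrib sum_distrib_left[symmetric])
    finally have s: "(\<Sum>k<n. T $$ (i, k) * v k) = v i" .
    have Rr: "(U1 * R) $$ (i, j) = (if i = a then 0 else R $$ (i, j)) + v i * R $$ (a, j)"
      unfolding U1_def by (rule colmat_mult[OF _ a(1) ij]) (use RG in blast)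
    show "(T * U1) $$ (i, j) = (U1 * R) $$ (i, j)"
      unfolding L Rr s using T(2)[OF ij] ij a(1) by (auto simp: R_def rowmat_def)
  qed (use GL_mat[OF TG] in \<open>auto simp: U1_def R_def colmat_def rowmat_def\<close>)
  \<comment> \<open>The matrix \<open>U2\<close> takes the remaining linear form to the \<open>c\<close>-th coordinate.\<close>
  moreover have "U2 * R = elmat n a c 1 * U2"
  proof (rule eq_matI)
    fix i j assume "i < dim_row (elmat n a c 1 * U2)" "j < dim_col (elmat n a c 1 * U2)"
    then have ij: "i < n" "j < n" by (auto simp: U2_def rowmat_def elmat_def colmat_def)
    have L: "(U2 * R) $$ (i, j) = (if j = a then 0 else U2 $$ (i, j)) + U2 $$ (i, a) * (if j = a then 1 else f j)"
      unfolding R_def by (rule mult_rowmat[OF _ a(1) ij]) (use G in blast)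
    have Rr: "(elmat n a c 1 * U2) $$ (i, j) = U2 $$ (i, j) + (if i = a then 1 * U2 $$ (c, j) else 0)"
      by (rule elmat_mult[OF _ _ c(1) ij]) (use G ca in auto)
    show "(U2 * R) $$ (i, j) = (elmat n a c 1 * U2) $$ (i, j)"
      unfolding L Rr using ij a(1) c(1) ca by (auto simp: U2_def rowmat_def)
  qed (use RG in \<open>auto simp: U2_def R_def rowmat_def elmat_def colmat_def\<close>)
  ultimately have "elmat n a c 1 = U2 * (ginv n U1 * (T * U1)) * ginv n U2"
    using G RG EG by (simp add: GL_assoc[where n=n])
  moreover have "U1 \<in> P" "U2 \<in> P" using U1 U2 P(2) by auto
  ultimately show ?thesis using P'(3,4) T(1) by simp
qed

text \<open>Conjugation by diagonal matrices rescales the entry of an elementary matrix.\<close>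

lemma root_in_scale:
  assumes P: "subgroup P (GL n)" "UT n \<subseteq> P" and ac: "a < n" "c < n" "a \<noteq> c" and e: "elmat n a c 1 \<in> P"
  shows "root_in n P a c"
proof -
  note P' = subgroup_GL_D[OF P(1)]
  have "elmat n a c t \<in> P" for t
  proof (cases "t = 0")
    case True
    have "elmat n a c t = 1\<^sub>m n" using True by (intro eq_matI) (auto simp: elmat_def colmat_def)
    then show ?thesis using P'(2) by simp
  next
    case False
    define D where "D = dmat n (\<lambda>k. if k = a then t else 1)"
    have D: "D \<in> UT n" unfolding D_def by (rule dmat_pat) (use False in auto)
    have DG: "D \<in> carrier (GL n)" using D by (simp add: pat_def)
    have "D * elmat n a c 1 = elmat n a c t * D"
    proof (rule eq_matI)
      fix i j assume "i < dim_row (elmat n a c t * D)" "j < dim_col (elmat n a c t * D)"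
      then have ij: "i < n" "j < n" by (auto simp: D_def dmat_def elmat_def colmat_def)
      have L: "(D * elmat n a c 1) $$ (i, j) = (if i = a then t else 1) * elmat n a c 1 $$ (i, j)"
        unfolding D_def by (rule dmat_mult[OF elmat_carrier ij])
      have R: "(elmat n a c t * D) $$ (i, j) = D $$ (i, j) + (if i = a then t * D $$ (c, j) else 0)"
        by (rule elmat_mult[OF _ ac(3,2) ij]) (use DG in blast)
      show "(D * elmat n a c 1) $$ (i, j) = (elmat n a c t * D) $$ (i, j)"
        unfolding L R using ij ac by (auto simp: D_def dmat_def elmat_def colmat_def)
    qed (auto simp: D_def dmat_def elmat_def colmat_def)
    then have "elmat n a c t = (D * elmat n a c 1) * ginv n D"
      using DG elmat_GL[OF ac(2)] by (simp add: GL_assoc[where n=n])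
    moreover have "D \<in> P" using D P(2) by blast
    ultimately show ?thesis using P'(3,4) e by simp
  qed
  then show ?thesis by (simp add: root_in_def)
qed

text \<open>If \<open>A \<in> P\<close> does not preserve the \<open>i\<close>-th step of the standard flag, conjugating an elementary
  transvection of the Borel subgroup by \<open>A\<close> gives a transvection that does not preserve it either.\<close>

lemma simple_root_in:
  assumes P: "subgroup P (GL n)" "UT n \<subseteq> P" and A: "A \<in> P" and ab: "b < i" "i \<le> a0" "a0 < n" "A $$ (a0, b) \<noteq> 0"
  shows "root_in n P i (i - 1)"
proof -
  note P' = subgroup_GL_D[OF P(1)]
  have AG: "A \<in> carrier (GL n)" using A P' by blast
  let ?B = "ginv n A"
  have BG: "?B \<in> carrier (GL n)" using AG by simp
  \<comment> \<open>If the inverse preserved the \<open>i\<close>-th step of the flag, so would \<open>A\<close>.\<close>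
  have "\<exists>r c. i \<le> r \<and> r < n \<and> c < i \<and> ?B $$ (r, c) \<noteq> 0"
  proof (rule ccontr)
    assume no: "\<not> ?thesis"
    have "?B \<in> pat (\<lambda>k l. l < i \<longrightarrow> k < i) n" unfolding pat_def
    proof (intro CollectI conjI allI impI BG)
      fix k l assume kl: "k < n" "l < n" "?B $$ (k, l) \<noteq> 0" "l < i"
      show "k < i"
      proof (rule ccontr)
        assume "\<not> k < i"
        then show False using no kl by (metis not_less)
      qed
    qed
    then have "ginv n ?B \<in> pat (\<lambda>k l. l < i \<longrightarrow> k < i) n"
      by (rule pat_inv[rotated 2]) (auto simp: reflp_def transp_def)
    then have "A \<in> pat (\<lambda>k l. l < i \<longrightarrow> k < i) n" using AG by simp
    from pat_D[OF this ab(3), of b] show False using ab by simp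
  qed
  then obtain r c0 where r: "i \<le> r" "r < n" and c0: "c0 < i" "?B $$ (r, c0) \<noteq> 0" by blast
  have bn: "b < n" "c0 < n" and br: "b \<noteq> r" using ab c0 r by auto
  let ?E = "rowmat n b (\<lambda>k. if k = b then 1 else if k = r then 1 else 0)"
  have E: "?E \<in> UT n" by (rule rowmat_pat) (use bn ab r in \<open>auto split: if_splits\<close>)
  have EG: "?E \<in> carrier (GL n)" using E by (simp add: pat_def)
  \<comment> \<open>The transvection \<open>T\<close> is \<open>1 + v f\<close>, where the column \<open>v\<close> of \<open>A\<close> leaves the \<open>i\<close>-th step of the flag
    and the row \<open>f\<close> of the inverse does not vanish on it.\<close>
  define T where "T = A * ?E * ?B"
  have T: "T \<in> P" unfolding T_def using P'(3,4) A E P(2) by blast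
  define v where "v k = A $$ (k, b)" for k
  define f where "f l = ?B $$ (r, l)" for l
  have Tent: "T $$ (k, l) = (if k = l then 1 else 0) + v k * f l" if kl: "k < n" "l < n" for k l
  proof -
    have AE: "(A * ?E) $$ (k, m) = A $$ (k, m) + (if m = r then v k else 0)" if "m < n" for m
      using mult_rowmat[OF GL_mat[OF AG] bn(1) kl(1) that] br by (auto simp: v_def)
    have "T $$ (k, l) = (\<Sum>m<n. (A * ?E) $$ (k, m) * ?B $$ (m, l))"
      unfolding T_def by (rule GL_mult_entry[OF _ BG kl]) (use AG EG in simp)
    also have "\<dots> = (\<Sum>m<n. A $$ (k, m) * ?B $$ (m, l) + (if m = r then v k * ?B $$ (m, l) else 0))"
      by (rule sum.cong) (use AE in \<open>auto simp: algebra_simps\<close>)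
    also have "\<dots> = (A * ?B) $$ (k, l) + v k * f l"
      using GL_mult_entry[OF AG BG kl] r by (simp add: sum.distrib f_def)
    finally show ?thesis using AG kl by simp
  qed
  have fv: "(\<Sum>k<n. f k * v k) = 0"
    using GL_mult_entry[OF BG AG r(2) bn(1)] AG r(2) bn(1) br by (simp add: f_def v_def)
  obtain a where a: "a \<in> {k. k < n \<and> v k \<noteq> 0}" "\<forall>k\<in>{k. k < n \<and> v k \<noteq> 0}. k \<le> a"
    using ex_maximal_key[of "{k. k < n \<and> v k \<noteq> 0}" "\<lambda>k. k"] ab by (auto simp: v_def)
  obtain c where c: "c \<in> {k. k < n \<and> f k \<noteq> 0}" "\<forall>k\<in>{k. k < n \<and> f k \<noteq> 0}. c \<le> k"
    using ex_minimal_key[of "{k. k < n \<and> f k \<noteq> 0}" "\<lambda>k. k"] c0 bn by (auto simp: f_def)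
  have ia: "i \<le> a" using a(2) ab by (auto simp: v_def)
  have ci: "c < i" using c(2) c0 bn by (force simp: f_def)
  have "elmat n a c 1 \<in> P"
  proof (rule transvection_root[OF P T Tent fv])
    show "v k = 0" if "a < k" "k < n" for k using a(2) that by (metis (mono_tags, lifting) leD mem_Collect_eq)
    show "f k = 0" if "k < c" for k using c that by (metis (mono_tags, lifting) leD less_trans mem_Collect_eq)
  qed (use a c ia ci in auto)
  then have ac: "root_in n P a c" using root_in_scale[OF P] a c ia ci by simp
  \<comment> \<open>The root \<open>(a, c)\<close> satisfies \<open>c < i \<le> a\<close>; upper triangular roots shorten it to \<open>(i, i - 1)\<close>.\<close>
  have up: "root_in n P k l" if "k < l" "l < n" for k l
    unfolding root_in_def using elmat_pat[of l n "(\<le>)" k] that P(2) by auto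
  have an: "a < n" using a by simp
  have ic: "root_in n P i c"
    by (rule root_in_trans[OF P(1), of i a c]) (use an ia ci ac up in \<open>auto simp: le_less\<close>)
  have "c = i - 1 \<or> root_in n P c (i - 1)" using up[of c "i - 1"] an ia ci by (cases "c = i - 1") auto
  then show ?thesis
    by (intro root_in_trans[OF P(1), of i c "i - 1"]) (use an ia ci ic in auto)
qed

lemma roots_column_in:
  assumes P: "subgroup P (GL n)" and K: "finite K" "K \<subseteq> {..<n} - {m}" and m: "m < n"
    and r: "\<forall>k\<in>K. root_in n P k m"
  shows "colmat n m (\<lambda>k. if k = m then 1 else if k \<in> K then f k else 0) \<in> P"
  using K r
proof (induction K rule: finite_induct)
  case empty
  have "colmat n m (\<lambda>k. if k = m then 1 else if k \<in> {} then f k else 0) = 1\<^sub>m n"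
    by (rule eq_matI) (auto simp: colmat_def)
  then show ?case using subgroup_GL_D(2)[OF P] by simp
next
  case (insert k K)
  let ?C = "\<lambda>K. colmat n m (\<lambda>k. if k = m then 1 else if k \<in> K then f k else 0)"
  have km: "k \<noteq> m" "k < n" using insert.prems by auto
  have "elmat n k m (f k) * ?C K = ?C (insert k K)"
  proof (rule eq_matI)
    fix i j assume "i < dim_row (?C (insert k K))" "j < dim_col (?C (insert k K))"
    then have ij: "i < n" "j < n" by (auto simp: colmat_def)
    show "(elmat n k m (f k) * ?C K) $$ (i, j) = ?C (insert k K) $$ (i, j)"
      unfolding elmat_mult[OF colmat_carrier km(1) m ij] using ij m km insert.hyps by (auto simp: colmat_def)
  qed (auto simp: colmat_def elmat_def)
  moreover have "?C K \<in> P" by (rule insert.IH) (use insert.prems in auto)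
  moreover have "elmat n k m (f k) \<in> P" using insert.prems by (auto simp: root_in_def)
  ultimately show ?case using subgroup_GL_D(3)[OF P, of "elmat n k m (f k)" "?C K"] by simp
qed

text \<open>If the entries on and below the diagonal of column \<open>m\<close> all vanished, the first \<open>m + 1\<close> columns
  would span at most \<open>m\<close> dimensions; in terms of the inverse, its row \<open>m\<close> is orthogonal to the first
  \<open>m\<close> columns and hence starts with zeros, so its product with column \<open>m\<close> is zero and not \<open>1\<close>.\<close>

lemma nonzero_pivot:
  assumes X: "X \<in> carrier (GL n)" and m: "m < n"
    and low: "\<And>k l. l < m \<Longrightarrow> l < k \<Longrightarrow> k < n \<Longrightarrow> X $$ (k, l) = 0" and diag: "\<And>l. l < m \<Longrightarrow> X $$ (l, l) \<noteq> 0"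
  shows "\<exists>k. m \<le> k \<and> k < n \<and> X $$ (k, m) \<noteq> 0"
proof (rule ccontr)
  assume "\<not> ?thesis"
  then have z: "X $$ (k, m) = 0" if "m \<le> k" "k < n" for k using that by blast
  let ?Y = "ginv n X"
  have YG: "?Y \<in> carrier (GL n)" using X by simp
  have e: "(\<Sum>k<n. ?Y $$ (m, k) * X $$ (k, l)) = (if m = l then 1 else 0)" if "l < n" for l
    using GL_mult_entry[OF YG X m that] X m that by simp
  have Y0: "?Y $$ (m, l) = 0" if "l < m" for l
    using that
  proof (induction l rule: less_induct)
    case (less l)
    have "(\<Sum>k<n. ?Y $$ (m, k) * X $$ (k, l)) = (\<Sum>k\<in>{l}. ?Y $$ (m, k) * X $$ (k, l))"
    proof (rule sum.mono_neutral_right)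
      show "\<forall>k\<in>{..<n} - {l}. ?Y $$ (m, k) * X $$ (k, l) = 0"
      proof
        fix k assume k: "k \<in> {..<n} - {l}"
        show "?Y $$ (m, k) * X $$ (k, l) = 0"
        proof (cases "k < l")
          case True
          then show ?thesis using less by simp
        next
          case False
          then show ?thesis using low[OF less.prems, of k] k by simp
        qed
      qed
    qed (use less.prems m in auto)
    then show ?case using e[of l] less.prems m diag[OF less.prems] by simp
  qed
  have "(\<Sum>k<n. ?Y $$ (m, k) * X $$ (k, m)) = 0"
  proof (rule sum.neutral, rule ballI)
    fix k assume "k \<in> {..<n}"
    then show "?Y $$ (m, k) * X $$ (k, m) = 0" using Y0[of k] z[of k] by (cases "k < m") auto
  qed
  then show False using e[OF m] by simp
qed

text \<open>Gaussian elimination inside \<open>P\<close>, column by column.\<close>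

lemma std_parabolic_subset:
  assumes P: "subgroup P (GL n)" "UT n \<subseteq> P" and PI: "P \<subseteq> std_parabolic n I"
    and r: "\<And>a c. a < n \<Longrightarrow> c < n \<Longrightarrow> a \<noteq> c \<Longrightarrow> (\<forall>k\<in>I. c < k \<longrightarrow> a < k) \<Longrightarrow> root_in n P a c"
  shows "std_parabolic n I \<subseteq> P"
proof
  note P' = subgroup_GL_D[OF P(1)]
  fix g assume g: "g \<in> std_parabolic n I"
  note std = subgroup_GL_D[OF subgroup_std_parabolic[of n I]]
  have gG: "g \<in> carrier (GL n)" using g std by blast
  have pd: "\<forall>k\<in>I. c < k \<longrightarrow> a < k" if "X \<in> std_parabolic n I" "a < n" "c < n" "X $$ (a, c) \<noteq> 0" for X a c
    using that unfolding std_parabolic_def pat_def by blast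
  have "\<exists>h\<in>P. (\<forall>k l. l < m \<longrightarrow> l < k \<longrightarrow> k < n \<longrightarrow> (h * g) $$ (k, l) = 0) \<and> (\<forall>l<m. (h * g) $$ (l, l) \<noteq> 0)"
    if "m \<le> n" for m
    using that
  proof (induction m)
    case 0
    then show ?case using P'(2) by auto
  next
    case (Suc m)
    then obtain h where h: "h \<in> P" and low: "\<And>k l. l < m \<Longrightarrow> l < k \<Longrightarrow> k < n \<Longrightarrow> (h * g) $$ (k, l) = 0"
      and diag: "\<And>l. l < m \<Longrightarrow> (h * g) $$ (l, l) \<noteq> 0" by auto
    have m: "m < n" using Suc.prems by simp
    have hG: "h \<in> carrier (GL n)" using h P' by blast
    have XG: "h * g \<in> carrier (GL n)" using hG gG by simp
    obtain p where p: "m \<le> p" "p < n" "(h * g) $$ (p, m) \<noteq> 0"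
      using nonzero_pivot[OF XG m low diag] by blast
    \<comment> \<open>Adding a lower row to row \<open>m\<close> makes the diagonal entry nonzero without leaving the upper triangular
      group.\<close>
    define e where "e = (if (h * g) $$ (m, m) = 0 then elmat n m p 1 else 1\<^sub>m n)"
    have mp: "m < p" if "(h * g) $$ (m, m) = 0" using p that by (cases "p = m") auto
    have eP: "e \<in> P"
    proof (cases "(h * g) $$ (m, m) = 0")
      case True
      have "elmat n m p 1 \<in> UT n" by (rule elmat_pat) (use p mp[OF True] in auto)
      then show ?thesis using P(2) True by (auto simp: e_def)
    qed (use P'(2) in \<open>simp add: e_def\<close>)
    have eG: "e \<in> carrier (GL n)" using eP P' by blast
    let ?X = "e * (h * g)"
    have X: "?X $$ (k, l) = (h * g) $$ (k, l) + (if k = m \<and> (h * g) $$ (m, m) = 0 then (h * g) $$ (p, l) else 0)"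
      if kl: "k < n" "l < n" for k l
    proof (cases "(h * g) $$ (m, m) = 0")
      case True
      have "m \<noteq> p" using mp[OF True] by simp
      then have "(elmat n m p 1 * (h * g)) $$ (k, l) = (h * g) $$ (k, l) + (if k = m then 1 * (h * g) $$ (p, l) else 0)"
        by (intro elmat_mult[OF GL_mat[OF XG] _ p(2) kl])
      then show ?thesis using True by (simp add: e_def)
    next
      case False
      then show ?thesis using XG by (simp add: e_def)
    qed
    have Xmm: "?X $$ (m, m) \<noteq> 0" using X[OF m m] p by auto
    have Xlow: "?X $$ (k, l) = 0" if "l < m" "l < k" "k < n" for k l
      using X[of k l] low[OF that] low[of l p] that m p by auto
    have Xdiag: "?X $$ (l, l) \<noteq> 0" if "l < m" for l using X[of l l] diag[OF that] that m by auto
    have XG': "?X \<in> carrier (GL n)" using eG XG by simp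
    have Xstd: "?X \<in> std_parabolic n I" using std(3) eP h g PI by blast
    define K where "K = {k. m < k \<and> k < n \<and> ?X $$ (k, m) \<noteq> 0}"
    define C where "C = colmat n m (\<lambda>k. if k = m then 1 else if k \<in> K then - ?X $$ (k, m) / ?X $$ (m, m) else 0)"
    have CP: "C \<in> P" unfolding C_def
    proof (rule roots_column_in[OF P(1) _ _ m])
      show "\<forall>k\<in>K. root_in n P k m"
      proof
        fix k assume "k \<in> K"
        then have k: "k < n" "k \<noteq> m" "?X $$ (k, m) \<noteq> 0" by (auto simp: K_def)
        show "root_in n P k m" by (rule r[OF k(1) m k(2) pd[OF Xstd k(1) m k(3)]])
      qed
    qed (auto simp: K_def)
    have CG: "C \<in> carrier (GL n)" using CP P' by blast
    have CX: "(C * ?X) $$ (k, l) = (if k = m then 0 else ?X $$ (k, l))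
        + (if k = m then 1 else if k \<in> K then - ?X $$ (k, m) / ?X $$ (m, m) else 0) * ?X $$ (m, l)"
      if "k < n" "l < n" for k l
      unfolding C_def by (rule colmat_mult[OF GL_mat[OF XG'] m that])
    have eq: "(C * e * h) * g = C * ?X" using CG eG hG gG by (simp add: GL_assoc[where n=n])
    have "(C * ?X) $$ (k, l) = 0" if kl: "l < Suc m" "l < k" "k < n" for k l
    proof (cases "l = m")
      case True
      then show ?thesis using CX[of k m] kl m Xmm by (auto simp: K_def)
    next
      case False
      then have lm: "l < m" using kl by simp
      then show ?thesis using CX[of k l] kl m Xlow[OF lm kl(2,3)] Xlow[OF lm lm m] by auto
    qed
    moreover have "(C * ?X) $$ (l, l) \<noteq> 0" if l: "l < Suc m" for l
    proof (cases "l = m")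
      case True
      then show ?thesis using CX[OF m m] Xmm by simp
    next
      case False
      then have lm: "l < m" using l by simp
      have "l \<notin> K" using lm by (simp add: K_def)
      then show ?thesis using CX[of l l] lm m Xdiag[OF lm] by simp
    qed
    moreover have "C * e * h \<in> P" using P'(3) CP eP h by blast
    ultimately show ?case using eq by metis
  qed
  from this[of n] obtain h where h: "h \<in> P" "\<And>k l. l < n \<Longrightarrow> l < k \<Longrightarrow> k < n \<Longrightarrow> (h * g) $$ (k, l) = 0" by auto
  have hG: "h \<in> carrier (GL n)" using h P' by blast
  have "i \<le> j" if "i < n" "j < n" "(h * g) $$ (i, j) \<noteq> 0" for i j
    using h(2)[of j i] that by (cases "i \<le> j") auto
  then have "h * g \<in> UT n" unfolding pat_def using hG gG by auto
  then have "h * g \<in> P" using P(2) by blast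
  then have "ginv n h * (h * g) \<in> P" using P'(3,4) h(1) by blast
  then show "g \<in> P" using hG gG by simp
qed

text \<open>Let \<open>I\<close> consist of the dimensions of the steps of the standard flag that \<open>P\<close> preserves. For every
  other step \<open>k\<close> the root \<open>(k, k - 1)\<close> occurs in \<open>P\<close> by \<open>simple_root_in\<close>. Chains of such roots give
  all roots of the block upper triangular group of \<open>I\<close>, and these generate it over the upper
  triangular matrices.\<close>

theorem contains_UT_std_parabolic:
  assumes P: "subgroup P (GL n)" "UT n \<subseteq> P"
  shows "\<exists>I\<subseteq>{1..<n}. P = std_parabolic n I"
proof -
  define I where "I = {i. 0 < i \<and> i < n \<and> (\<forall>A\<in>P. \<forall>b<i. \<forall>a. i \<le> a \<longrightarrow> a < n \<longrightarrow> A $$ (a, b) = 0)}"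
  have PG: "P \<subseteq> carrier (GL n)" using subgroup_GL_D(1)[OF P(1)] .
  have PI: "P \<subseteq> std_parabolic n I"
  proof
    fix A assume A: "A \<in> P"
    have "i < k" if "i < n" "j < n" "A $$ (i, j) \<noteq> 0" "k \<in> I" "j < k" for i j k
    proof (rule ccontr)
      assume "\<not> i < k"
      then have "A $$ (i, j) = 0" using that A by (auto simp: I_def)
      then show False using that by simp
    qed
    then show "A \<in> std_parabolic n I" unfolding std_parabolic_def pat_def using A PG by blast
  qed
  have simple: "root_in n P k (k - 1)" if k: "0 < k" "k < n" "k \<notin> I" for k
  proof -
    obtain A b a where A: "A \<in> P" and b: "b < k" and a: "k \<le> a" "a < n" and "A $$ (a, b) \<noteq> 0"
      using k unfolding I_def by auto
    then show ?thesis using simple_root_in[OF P A b a] by simp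
  qed
  have up: "root_in n P k l" if "k < l" "l < n" for k l
    unfolding root_in_def using elmat_pat[of l n "(\<le>)" k] that P(2) by auto
  have down: "root_in n P (c + Suc d) c" if "c + Suc d < n" "\<forall>k\<in>I. c < k \<longrightarrow> c + Suc d < k" for c d
    using that
  proof (induction d)
    case 0
    then have "Suc c \<notin> I" by auto
    then show ?case using simple[of "Suc c"] 0 by simp
  next
    case (Suc d)
    have "c + Suc (Suc d) \<notin> I" using Suc.prems by force
    then have s: "root_in n P (c + Suc (Suc d)) (c + Suc d)" using simple[of "c + Suc (Suc d)"] Suc.prems by simp
    have "\<forall>k\<in>I. c < k \<longrightarrow> c + Suc d < k" using Suc.prems(2) by force
    then have "root_in n P (c + Suc d) c" using Suc.IH Suc.prems by simp
    then show ?case by (intro root_in_trans[OF P(1), of _ "c + Suc d"]) (use s Suc.prems in auto)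
  qed
  have "std_parabolic n I \<subseteq> P"
  proof (rule std_parabolic_subset[OF P PI])
    fix a c assume ac: "a < n" "c < n" "a \<noteq> c" "\<forall>k\<in>I. c < k \<longrightarrow> a < k"
    show "root_in n P a c"
    proof (cases "a < c")
      case True
      then show ?thesis using up ac by blast
    next
      case False
      then have "a = c + Suc (a - c - 1)" using ac(3) by simp
      then show ?thesis using down[of c "a - c - 1"] ac by metis
    qed
  qed
  then show ?thesis using PI by (intro exI[of _ I]) (auto simp: I_def)
qed

lemma contains_conj_UT:
  assumes Q: "subgroup Q (GL n)" and x: "x \<in> carrier (GL n)" and B: "conj_set n x (UT n) \<subseteq> Q"
  shows "\<exists>I\<subseteq>{1..<n}. Q = conj_set n x (std_parabolic n I)"
proof -
  note QG = subgroup_GL_D(1)[OF Q] and xi = GL_inv_closed[OF x]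
  have "UT n = conj_set n (ginv n x) (conj_set n x (UT n))" using conj_set_inv(1)[OF x pat_GL] by simp
  also have "\<dots> \<subseteq> conj_set n (ginv n x) Q" using conj_set_mono[OF B] .
  finally obtain I where I: "I \<subseteq> {1..<n}" "conj_set n (ginv n x) Q = std_parabolic n I"
    using contains_UT_std_parabolic[OF subgroup_conj_set[OF xi Q]] by blast
  then have "Q = conj_set n x (std_parabolic n I)" using conj_set_inv(2)[OF x QG] by simp
  then show ?thesis using I(1) by blast
qed

lemma parabolic_conj_std:
  assumes "parabolic_subgroup n Q"
  shows "\<exists>x\<in>carrier (GL n). \<exists>I\<subseteq>{1..<n}. borel_subgroup n (conj_set n x (UT n)) \<and>
    Q = conj_set n x (std_parabolic n I)"
proof -
  obtain B where B: "borel_subgroup n B" "B \<subseteq> Q" and Q: "subgroup Q (GL n)"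
    using assms unfolding parabolic_subgroup_def by blast
  obtain x where x: "x \<in> carrier (GL n)" "B = conj_set n x (UT n)" using borel_conj_UT[OF B(1)] by blast
  then obtain I where "I \<subseteq> {1..<n}" "Q = conj_set n x (std_parabolic n I)"
    using contains_conj_UT[OF Q x(1)] B(2) by blast
  then show ?thesis using x B(1) by blast
qed

lemma parabolic_conj_stdI:
  assumes "x \<in> carrier (GL n)" "borel_subgroup n (conj_set n x (UT n))"
  shows "parabolic_subgroup n (conj_set n x (std_parabolic n I))"
  unfolding parabolic_subgroup_def
  using subgroup_conj_set[OF assms(1) subgroup_std_parabolic]
    closed_conj[OF closed_pat assms(1)] assms(2) conj_set_mono[OF UT_std_parabolic[of n I], of n x]
  unfolding std_parabolic_def by blast

lemma std_parabolic_empty: "std_parabolic n {} = carrier (GL n)"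
  by (auto simp: std_parabolic_def pat_def)

text \<open>A step \<open>j\<close> that is missing from \<open>I\<close> is moved by the root \<open>(j, j - 1)\<close>, which belongs to the
  group of \<open>I\<close>.\<close>

lemma std_parabolic_subset_iff:
  assumes J: "J \<subseteq> {1..<n}"
  shows "std_parabolic n I \<subseteq> std_parabolic n J \<longleftrightarrow> J \<subseteq> I"
proof
  assume s: "std_parabolic n I \<subseteq> std_parabolic n J"
  show "J \<subseteq> I"
  proof
    fix j assume j: "j \<in> J"
    have jn: "1 \<le> j" "j < n" using j J by auto
    show "j \<in> I"
    proof (rule ccontr)
      assume jI: "j \<notin> I"
      have "elmat n j (j - 1) 1 \<in> std_parabolic n I" unfolding std_parabolic_def
      proof (rule elmat_pat)
        show "\<forall>k\<in>I. j - 1 < k \<longrightarrow> j < k"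
        proof (intro ballI impI)
          fix k assume "k \<in> I" "j - 1 < k"
          then show "j < k" using jI jn by (cases "k = j") auto
        qed
      qed (use jn in \<open>auto simp: reflp_def\<close>)
      then have "elmat n j (j - 1) 1 \<in> std_parabolic n J" using s by blast
      then have "elmat n j (j - 1) 1 $$ (j, j - 1) = 0"
        by (rule std_parabolic_zero[OF _ j]) (use jn in auto)
      then show False using jn by (simp add: elmat_def colmat_def split: if_splits)
    qed
  qed
qed (rule std_parabolic_antimono)

lemma conj_set_subset_iff:
  assumes "x \<in> carrier (GL n)" "S \<subseteq> carrier (GL n)" "T \<subseteq> carrier (GL n)"
  shows "conj_set n x S \<subseteq> conj_set n x T \<longleftrightarrow> S \<subseteq> T"
  using conj_set_mono[of "conj_set n x S" "conj_set n x T" n "ginv n x"] conj_set_mono[of S T n x]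
    conj_set_inv(1)[OF assms(1,2)] conj_set_inv(1)[OF assms(1,3)] by auto

text \<open>The parabolic subgroups containing a given Borel subgroup form the lattice of subsets of \<open>{1..<n}\<close>
  with inclusion reversed.\<close>

lemma maximal_parabolic_iff:
  assumes x: "x \<in> carrier (GL n)" and b: "borel_subgroup n (conj_set n x (UT n))" and I: "I \<subseteq> {1..<n}"
  shows "maximal_parabolic n (conj_set n x (std_parabolic n I)) \<longleftrightarrow> (\<exists>i. I = {i})"
proof -
  let ?Q = "\<lambda>I. conj_set n x (std_parabolic n I)"
  have sub: "?Q J \<subseteq> ?Q J' \<longleftrightarrow> J' \<subseteq> J" if "J' \<subseteq> {1..<n}" for J J'
    using conj_set_subset_iff[OF x std_parabolic_GL std_parabolic_GL] std_parabolic_subset_iff[OF that] by simp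
  have GLQ: "carrier (GL n) = ?Q {}" using conj_set_GL[OF x] by (simp add: std_parabolic_empty)
  have eq: "?Q J = ?Q J' \<longleftrightarrow> J = J'" if "J \<subseteq> {1..<n}" "J' \<subseteq> {1..<n}" for J J'
    using sub[OF that(1), of J'] sub[OF that(2), of J] by auto
  show ?thesis
  proof
    assume max: "maximal_parabolic n (?Q I)"
    then have "?Q I \<noteq> ?Q {}" using GLQ unfolding maximal_parabolic_def by simp
    then have "I \<noteq> {}" by auto
    then obtain i where i: "i \<in> I" by blast
    have i1: "{i} \<subseteq> {1..<n}" using i I by blast
    have "?Q I \<subseteq> ?Q {i}" using sub[OF i1] i by simp
    then have "?Q {i} = ?Q I \<or> ?Q {i} = ?Q {}"
      using max parabolic_conj_stdI[OF x b, of "{i}"] GLQ unfolding maximal_parabolic_def by blast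
    then have "{i} = I" using eq[OF i1 I] eq[OF i1, of "{}"] by auto
    then show "\<exists>i. I = {i}" by blast
  next
    assume "\<exists>i. I = {i}"
    then obtain i where i: "I = {i}" by blast
    have "?Q I \<noteq> carrier (GL n)" unfolding GLQ using eq[OF I, of "{}"] i by simp
    moreover have "P' = ?Q I \<or> P' = carrier (GL n)" if P': "parabolic_subgroup n P'" "?Q I \<subseteq> P'" for P'
    proof -
      have "conj_set n x (UT n) \<subseteq> P'" using conj_set_mono[OF UT_std_parabolic[of n I], of n x] P'(2) by blast
      then obtain J where J: "J \<subseteq> {1..<n}" "P' = ?Q J"
        using contains_conj_UT[OF _ x] P'(1) unfolding parabolic_subgroup_def by blast
      then have "J \<subseteq> {i}" using sub[OF J(1), of I] P'(2) i by simp
      then have "J = {} \<or> J = {i}" by blast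
      then show ?thesis using J(2) i GLQ by blast
    qed
    ultimately show "maximal_parabolic n (?Q I)"
      unfolding maximal_parabolic_def using parabolic_conj_stdI[OF x b] by blast
  qed
qed

subsection \<open>Mirabolic subgroups as stabilizers\<close>

lemma stabilizer_cspace:
  assumes m: "m \<le> n"
  shows "subspace_stabilizer n (cspace n m) = std_parabolic n {m}"
proof (intro equalityI subsetI)
  fix A assume A: "A \<in> subspace_stabilizer n (cspace n m)"
  then have AG: "A \<in> carrier (GL n)" and im: "(\<lambda>v. A *\<^sub>v v) ` cspace n m = cspace n m"
    by (auto simp: subspace_stabilizer_def)
  have z: "A $$ (i, j) = 0" if ij: "j < m" "m \<le> i" "i < n" for i j
  proof -
    have "unit_vec n j \<in> cspace n m" using ij m by (auto simp: cspace_def unit_vec_def)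
    then have "A *\<^sub>v unit_vec n j \<in> cspace n m" using im by blast
    then have "(A *\<^sub>v unit_vec n j) $ i = 0" using ij by (simp add: cspace_def)
    then show ?thesis using matvec_unit[OF GL_mat[OF AG] _ ij(3), of j] ij m by simp
  qed
  show "A \<in> std_parabolic n {m}" unfolding std_parabolic_def pat_def
  proof (intro CollectI conjI allI impI ballI AG)
    fix i j k assume "i < n" "A $$ (i, j) \<noteq> 0" "k \<in> {m}" "j < k"
    then show "i < k" using z[of j i] by (cases "i < m") auto
  qed
next
  fix A assume A: "A \<in> std_parabolic n {m}"
  have stab: "X *\<^sub>v v \<in> cspace n m" if X: "X \<in> std_parabolic n {m}" and v: "v \<in> cspace n m" for X v
  proof -
    have XG: "X \<in> carrier (GL n)" using X std_parabolic_GL by blast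
    have vc: "v \<in> carrier_vec n" using v by (simp add: cspace_def)
    have "(X *\<^sub>v v) $ i = 0" if i: "i < n" "m \<le> i" for i
    proof -
      have "(X *\<^sub>v v) $ i = (\<Sum>k<n. X $$ (i, k) * v $ k)" by (rule matvec_entry[OF GL_mat[OF XG] vc i(1)])
      also have "\<dots> = 0"
      proof (rule sum.neutral, rule ballI)
        fix k assume k: "k \<in> {..<n}"
        show "X $$ (i, k) * v $ k = 0"
        proof (cases "k < m")
          case True
          then show ?thesis using std_parabolic_zero[OF X _ True i(2,1)] by simp
        next
          case False
          then show ?thesis using v k by (simp add: cspace_def)
        qed
      qed
      finally show ?thesis .
    qed
    then show ?thesis unfolding cspace_def using GL_matvec_closed[OF XG vc] by simp
  qed
  have AG: "A \<in> carrier (GL n)" using A std_parabolic_GL by blast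
  have iA: "ginv n A \<in> std_parabolic n {m}" using subgroup_GL_D(4)[OF subgroup_std_parabolic A] .
  have "v \<in> (\<lambda>v. A *\<^sub>v v) ` cspace n m" if v: "v \<in> cspace n m" for v
  proof (rule image_eqI)
    show "v = A *\<^sub>v (ginv n A *\<^sub>v v)" using AG v by (simp add: cspace_def)
    show "ginv n A *\<^sub>v v \<in> cspace n m" using stab[OF iA v] .
  qed
  then have "(\<lambda>v. A *\<^sub>v v) ` cspace n m = cspace n m" using stab[OF A] by blast
  then show "A \<in> subspace_stabilizer n (cspace n m)" using AG by (simp add: subspace_stabilizer_def)
qed

lemma stabilizer_conj:
  assumes g: "g \<in> carrier (GL n)" and W: "W \<subseteq> carrier_vec n"
  shows "subspace_stabilizer n ((\<lambda>v. g *\<^sub>v v) ` W) = conj_set n g (subspace_stabilizer n W)"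
proof -
  have sG: "subspace_stabilizer n W \<subseteq> carrier (GL n)" by (auto simp: subspace_stabilizer_def)
  have "A \<in> subspace_stabilizer n ((\<lambda>v. g *\<^sub>v v) ` W) \<longleftrightarrow> A \<in> conj_set n g (subspace_stabilizer n W)" for A
  proof (cases "A \<in> carrier (GL n)")
    case False
    then show ?thesis unfolding conj_set_iff[OF g sG] by (simp add: subspace_stabilizer_def)
  next
    case A: True
    let ?C = "ginv n g * A * g"
    have C: "?C \<in> carrier (GL n)" using A g by simp
    have gC: "g *\<^sub>v (?C *\<^sub>v v) = A *\<^sub>v (g *\<^sub>v v)" if "v \<in> W" for v
    proof -
      have v: "v \<in> carrier_vec n" using that W by blast
      have "g * ?C = A * g" using A g by (simp add: GL_assoc[where n=n])
      then show ?thesis using GL_matvec_assoc[OF g C v] GL_matvec_assoc[OF A g v] by simp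
    qed
    have e1: "(\<lambda>v. A *\<^sub>v v) ` (\<lambda>v. g *\<^sub>v v) ` W = (\<lambda>v. g *\<^sub>v v) ` (\<lambda>v. ?C *\<^sub>v v) ` W"
      unfolding image_image by (rule image_cong[OF refl]) (use gC in simp)
    have inj: "inj_on (\<lambda>v. g *\<^sub>v v) (carrier_vec n)"
      by (rule inj_on_inverseI[where g = "\<lambda>v. ginv n g *\<^sub>v v"]) (use g in simp)
    have CW: "(\<lambda>v. ?C *\<^sub>v v) ` W \<subseteq> carrier_vec n" using GL_matvec_closed[OF C] W by blast
    have "(\<lambda>v. A *\<^sub>v v) ` (\<lambda>v. g *\<^sub>v v) ` W = (\<lambda>v. g *\<^sub>v v) ` W \<longleftrightarrow> (\<lambda>v. ?C *\<^sub>v v) ` W = W"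
      unfolding e1 using inj_on_image_eq_iff[OF inj CW W] .
    then show ?thesis unfolding conj_set_iff[OF g sG] using A C by (simp add: subspace_stabilizer_def)
  qed
  then show ?thesis by blast
qed

lemma mirabolic_conj_std:
  assumes "mirabolic q Q"
  shows "\<exists>g\<in>carrier (GL q). \<exists>m\<in>{1, q - 1}. m \<le> q \<and> Q = conj_set q g (std_parabolic q {m})"
proof -
  obtain W where W: "subspace class_ring W (module_vec TYPE(complex) q)"
    "vectorspace.dim class_ring (module_vec TYPE(complex) q\<lparr>carrier := W\<rparr>) \<in> {1, q - 1}"
    and Q: "Q = subspace_stabilizer q W"
    using assms unfolding mirabolic_def by blast
  obtain g m where g: "g \<in> carrier (GL q)" and m: "m \<le> q" and Wg: "W = (\<lambda>v. g *\<^sub>v v) ` cspace q m"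
    using lin_cspace_image W(1) unfolding subspace_iff_lin by blast
  have "m \<in> {1, q - 1}" using W(2) unfolding Wg dim_cspace_image[OF g m] .
  moreover have "Q = conj_set q g (std_parabolic q {m})"
    unfolding Q Wg stabilizer_cspace[OF m, symmetric]
    by (rule stabilizer_conj[OF g]) (auto simp: cspace_def)
  ultimately show ?thesis using g m by blast
qed

text \<open>The subspace is spanned by the first \<open>m\<close> columns of \<open>x\<close>. For \<open>q = 1\<close> both \<open>m = 0\<close> and \<open>m = 1\<close>
  are admitted, and the stabilizer is the full group.\<close>

lemma mirabolicI:
  assumes Q: "parabolic_subgroup q (conj_set q x (std_parabolic q {m}))" and x: "x \<in> carrier (GL q)"
    and m: "m \<in> {1, q - 1}" "m \<le> q"
  shows "mirabolic q (conj_set q x (std_parabolic q {m}))"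
  unfolding mirabolic_def
proof (intro conjI exI)
  show "subspace class_ring ((\<lambda>v. x *\<^sub>v v) ` cspace q m) (module_vec TYPE(complex) q)"
    unfolding subspace_iff_lin using lin_image[OF lin_cspace GL_mat[OF x]] .
  show "vectorspace.dim class_ring (module_vec TYPE(complex) q\<lparr>carrier := (\<lambda>v. x *\<^sub>v v) ` cspace q m\<rparr>) \<in> {1, q - 1}"
    unfolding dim_cspace_image[OF x m(2)] using m(1) .
  show "conj_set q x (std_parabolic q {m}) = subspace_stabilizer q ((\<lambda>v. x *\<^sub>v v) ` cspace q m)"
    unfolding stabilizer_cspace[OF m(2), symmetric]
    by (rule stabilizer_conj[OF x, symmetric]) (auto simp: cspace_def)
qed (rule Q)

section \<open>The classification\<close>

lemma finite_cosets_conj_blocks: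
  assumes x: "x \<in> carrier (GL (p + q))" and y1: "y1 \<in> carrier (GL p)" and y2: "y2 \<in> carrier (GL q)"
    and H1: "H1 \<subseteq> carrier (GL p)" and H2: "H2 \<subseteq> carrier (GL q)"
  shows "finite_double_cosets (p + q) (block_diag p q (conj_set p y1 H1) (conj_set q y2 H2)) (conj_set (p + q) x (UT (p + q)))
    \<longleftrightarrow> finite_double_cosets (p + q) (block_diag p q H1 H2) (UT (p + q))"
proof -
  have "block_diag p q H1 H2 \<subseteq> carrier (GL (p + q))"
    using H1 H2 by (auto simp: block_diag_def)
  then show ?thesis
    unfolding conj_set_block_diag[OF y1 y2 H1 H2, symmetric]
    by (rule finite_double_cosets_conj_iff[OF bd_GL[OF y1 y2] x _ pat_GL])
qed

lemma torus_finite_mirabolic: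
  assumes "mirabolic q Q" and q: "q \<ge> 1"
  shows "torus_finite q Q"
proof -
  obtain g m where g: "g \<in> carrier (GL q)" and m: "m \<in> {1, q - 1}" and Q: "Q = conj_set q g (std_parabolic q {m})"
    using mirabolic_conj_std[OF assms(1)] by blast
  have "torus_finite q (std_parabolic q {m})"
    using m torus_finite_line[OF q] torus_finite_hyperplane[OF q] unfolding std_parabolic_def by auto
  then show ?thesis unfolding Q using torus_finite_conj std_parabolic_GL g by blast
qed

theorem theorem6p3:
  fixes n p q :: nat and B Q1 Q2 :: "complex mat set"
  assumes "p + q = n" and "q \<ge> p" and "p \<ge> 1"
    and "borel_subgroup n B"
    and "parabolic_subgroup p Q1"
    and "parabolic_subgroup q Q2"
  shows "finite (orbits (K_group p q) (double_flag p q B Q1 Q2) (diag_action p q B Q1 Q2))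
    \<longleftrightarrow>
      (Q1 = carrier (GL p) \<and> Q2 = carrier (GL q))
    \<or> (Q1 = carrier (GL p) \<and> mirabolic q Q2)
    \<or> (p = 1 \<and> Q1 = carrier (GL 1))
    \<or> (p = 2 \<and> Q1 = carrier (GL 2) \<and> maximal_parabolic q Q2)
    \<or> (mirabolic p Q1 \<and> Q2 = carrier (GL q))"
proof -
  have n: "n = p + q" and q1: "q \<ge> 1" using assms(1-3) by auto
  obtain x where x: "x \<in> carrier (GL (p + q))" and B: "B = conj_set (p + q) x (UT (p + q))"
    using borel_conj_UT[OF assms(4)] unfolding n by blast
  obtain y1 I where y1: "y1 \<in> carrier (GL p)" and I: "I \<subseteq> {1..<p}"
    and b1: "borel_subgroup p (conj_set p y1 (UT p))" and Q1: "Q1 = conj_set p y1 (std_parabolic p I)"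
    using parabolic_conj_std[OF assms(5)] by blast
  obtain y2 J where y2: "y2 \<in> carrier (GL q)" and J: "J \<subseteq> {1..<q}"
    and b2: "borel_subgroup q (conj_set q y2 (UT q))" and Q2: "Q2 = conj_set q y2 (std_parabolic q J)"
    using parabolic_conj_std[OF assms(6)] by blast
  have Bsub: "subgroup B (GL (p + q))" unfolding B using subgroup_conj_set[OF x subgroup_UT] .
  have Q1sub: "subgroup Q1 (GL p)" unfolding Q1 using subgroup_conj_set[OF y1 subgroup_std_parabolic] .
  have Q2sub: "subgroup Q2 (GL q)" unfolding Q2 using subgroup_conj_set[OF y2 subgroup_std_parabolic] .
  note QG = subgroup_GL_D(1)[OF Q1sub] subgroup_GL_D(1)[OF Q2sub]
  have I0: "Q1 = carrier (GL p) \<longleftrightarrow> I = {}"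
    using conj_set_subset_iff[OF y1 std_parabolic_GL std_parabolic_GL, of "{}" I]
      std_parabolic_subset_iff[OF I, of "{}"] conj_set_GL[OF y1] QG(1)
    unfolding Q1 std_parabolic_empty by auto
  have J0: "Q2 = carrier (GL q) \<longleftrightarrow> J = {}"
    using conj_set_subset_iff[OF y2 std_parabolic_GL std_parabolic_GL, of "{}" J]
      std_parabolic_subset_iff[OF J, of "{}"] conj_set_GL[OF y2] QG(2)
    unfolding Q2 std_parabolic_empty by auto
  have maxJ: "maximal_parabolic q Q2 \<longleftrightarrow> (\<exists>j. J = {j})" unfolding Q2 using maximal_parabolic_iff[OF y2 b2 J] .
  have mirJ: "mirabolic q Q2" if "J = {j}" "j \<in> {1, q - 1}" for j
    unfolding Q2 that(1) using mirabolicI[OF parabolic_conj_stdI[OF y2 b2] y2 that(2)] that J by auto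
  have mirI: "mirabolic p Q1" if "I = {i}" "i \<in> {1, p - 1}" for i
    unfolding Q1 that(1) using mirabolicI[OF parabolic_conj_stdI[OF y1 b1] y1 that(2)] that I by auto
  let ?fin = "finite_double_cosets (p + q) (block_diag p q Q1 Q2) B"
  have std: "?fin \<longleftrightarrow> finite_double_cosets (p + q) (block_diag p q (std_parabolic p I) (std_parabolic q J)) (UT (p + q))"
    unfolding B Q1 Q2 by (rule finite_cosets_conj_blocks[OF x y1 y2 std_parabolic_GL std_parabolic_GL])
  have semi: "?fin \<longleftrightarrow> finite_double_cosets (p + q) (block_diag p q Q1 Q2) (UT (p + q))"
    using finite_cosets_conj_blocks[OF x GL_one_closed GL_one_closed QG] conj_set_one[OF QG(1)] conj_set_one[OF QG(2)]
    unfolding B by simp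
  have "?fin \<longleftrightarrow>
      (Q1 = carrier (GL p) \<and> Q2 = carrier (GL q))
    \<or> (Q1 = carrier (GL p) \<and> mirabolic q Q2)
    \<or> (p = 1 \<and> Q1 = carrier (GL 1))
    \<or> (p = 2 \<and> Q1 = carrier (GL 2) \<and> maximal_parabolic q Q2)
    \<or> (mirabolic p Q1 \<and> Q2 = carrier (GL q))" (is "_ \<longleftrightarrow> ?cases")
  proof
    assume ?cases
    then consider (i) "Q1 = carrier (GL p)" "Q2 = carrier (GL q)" | (ii) "Q1 = carrier (GL p)" "mirabolic q Q2"
      | (iii) "p = 1" "Q1 = carrier (GL p)" | (iv) "p = 2" "Q1 = carrier (GL p)" "maximal_parabolic q Q2"
      | (v) "mirabolic p Q1" "Q2 = carrier (GL q)" by auto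
    then show ?fin
    proof cases
      \<comment> \<open>The trivial case is covered by the mirabolic one: the full group has a single torus orbit.\<close>
      case i
      then show ?thesis unfolding semi using finite_cosets_mirabolic_right[OF Q2sub] torus_finite_GL by simp
    next
      case ii
      then show ?thesis
        unfolding semi using finite_cosets_mirabolic_right[OF Q2sub torus_finite_mirabolic[OF ii(2) q1]] by simp
    next
      case iii
      have "I = {}" using iii(2) I0 by blast
      then have "finite_double_cosets (p + q) (block_diag p q (std_parabolic p I) (std_parabolic q J)) (UT (p + q))"
        unfolding iii(1) std_parabolic_empty[symmetric]
        using finite_cosets_line[OF subgroup_std_parabolic UT_std_parabolic, of q J]
        by (simp only: std_parabolic_empty)
      then show ?thesis using std by blast
    next
      case iv
      obtain j where "J = {j}" using iv(3) maxJ by blast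
      moreover have "I = {}" using iv(2) I0 by blast
      moreover have "std_parabolic q {j} = pat (\<lambda>i l. l < j \<longrightarrow> i < j) q" by (simp add: std_parabolic_def)
      ultimately have "finite_double_cosets (p + q) (block_diag p q (std_parabolic p I) (std_parabolic q J)) (UT (p + q))"
        using finite_cosets_plane[of q j] by (simp only: iv(1) std_parabolic_empty)
      then show ?thesis using std by blast
    next
      case v
      then show ?thesis
        unfolding semi using finite_cosets_mirabolic_left[OF Q1sub torus_finite_mirabolic[OF v(1) assms(3)]] by simp
    qed
  next
    assume fin: ?fin
    show ?cases
    proof (rule ccontr)
      assume no: "\<not> ?cases"
      have inf: False if "\<not> finite_double_cosets (p + q) (block_diag p q (std_parabolic p I) (std_parabolic q J)) (UT (p + q))"
        using that fin std by blast
      have p2: "p \<ge> 2"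
      proof (rule ccontr)
        assume "\<not> p \<ge> 2"
        then have "p = 1" using assms(3) by simp
        then show False using no I I0 by auto
      qed
      show False
      proof (cases "I = {} \<or> J = {}")
        case False
        then obtain i j where ij: "i \<in> I" "j \<in> J" by blast
        then have "0 < i" "i < p" "0 < j" "j < q" using subsetD[OF I ij(1)] subsetD[OF J ij(2)] by auto
        then show False using inf[OF infinite_two_proper[OF ij(1) _ _ ij(2)]] by simp
      next
        case True
        then consider (right) "I = {}" "J \<noteq> {}" | (left) "J = {}" "I \<noteq> {}" using no I0 J0 by blast
        then show False
        proof cases
          case right
          have Q1G: "Q1 = carrier (GL p)" using I0 right by blast
          show False
          proof (cases "\<exists>j. J = {j}")
            case True
            then obtain j where j: "J = {j}" by blast
            have "j \<noteq> 1" "j \<noteq> q - 1" using mirJ[OF j] no Q1G by auto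
            moreover have "p \<noteq> 2" using no Q1G maxJ True by auto
            ultimately have "3 \<le> p" "2 \<le> j" "j + 2 \<le> q" using p2 j J by auto
            then show False using inf infinite_middle_right[of p j J q] j right by (simp add: std_parabolic_empty)
          next
            case False
            obtain a b where "a \<in> J" "b \<in> J" "a < b" using False right(2) by (metis linorder_neqE_nat is_singletonI' is_singleton_def)
            then show False using inf infinite_two_step_right[OF p2, of a J b q] J right by (force simp: std_parabolic_empty)
          qed
        next
          case left
          have Q2G: "Q2 = carrier (GL q)" using J0 left by blast
          show False
          proof (cases "\<exists>i. I = {i}")
            case True
            then obtain i where i: "I = {i}" by blast
            have "i \<noteq> 1" "i \<noteq> p - 1" using mirI[OF i] no Q2G by auto
            then have "3 \<le> q" "2 \<le> i" "i + 2 \<le> p" using i I assms(2) by auto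
            then show False using inf infinite_middle_left[of q i I p] i left by (simp add: std_parabolic_empty)
          next
            case False
            obtain a b where "a \<in> I" "b \<in> I" "a < b" using False left(2) by (metis linorder_neqE_nat is_singletonI' is_singleton_def)
            then show False using inf infinite_two_step_left[of q a I b p] I left p2 assms(2) by (force simp: std_parabolic_empty)
          qed
        qed
      qed
    qed
  qed
  then show ?thesis using finite_orbits_iff[OF Bsub Q1sub Q2sub] by simp
qed

end
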